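(* Fix $\kappa\in[1,\infty)$ and let $P^{\rm c}_{\kappa,\rm s},P^{\rm c}_{\kappa,\rm w},P_{\kappa,\rm s},P_{\kappa,\rm w}\subset[1,\infty]$ satisfy: (i) each is of the form $\{\infty\}$, $[p_0,\infty]$ or $(p_0,\infty]$ for some $p_0\in[1,\infty)$; (ii) $P_{\kappa,\rm s}\subset P^{\rm c}_{\kappa,\rm s}$, $P_{\kappa,\rm w}\subset P^{\rm c}_{\kappa,\rm w}$, $P^{\rm c}_{\kappa,\rm s}\subset P^{\rm c}_{\kappa,\rm w}\subset\overline{P^{\rm c}_{\kappa,\rm s}}$, $P_{\kappa,\rm s}\subset P_{\kappa,\rm w}\subset\overline{P_{\kappa,\rm s}}$ (closure in $\mathbb R\cup\{\infty\}$); (iii) if $\kappa\ge2$ then $P^{\rm c}_{\kappa,\rm w}=[1,\infty]$; (iv) if $\kappa\ge3$ then $P_{\kappa,\rm w}=[1,\infty]$. Then there is a nondoubling metric measure space $\mathfrak Z$ such that $\mathcal M^{\rm c}_{\kappa,\mathfrak Z}$ is of strong (respectively weak) type $(p,p)$ iff $p\in P^{\rm c}_{\kappa,\rm s}$ (respectively $p\in P^{\rm c}_{\kappa,\rm w}$), and $\mathcal M_{\kappa,\mathfrak Z}$ is of strong (respectively weak) type $(p,p)$ iff $p\in P_{\kappa,\rm s}$ (respectively $p\in P_{\kappa,\rm w}$).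
   Context: Metric measure space $(X,\rho,\mu)$: nonempty set, metric, nonnegative Borel measure, every open ball $B(x,s)$ having finite strictly positive measure; doubling means $\mu(B(x,2s))\le C\mu(B(x,s))$ uniformly. For $\kappa\ge1$, the modified maximal operators are $\mathcal M^{\rm c}_{\kappa}f(x)=\sup_{s>0}\mu(B(x,\kappa s))^{-1}\int_{B(x,s)}|f|d\mu$ and $\mathcal M_\kappa f(x)=\sup\{\mu(B(y,\kappa s))^{-1}\int_{B(y,s)}|f|d\mu : y\in X,\ s>0,\ x\in B(y,s)\}$. Strong type $(p,p)$: bounded on $L^p$; weak type $(p,p)$ for $p<\infty$: $\lambda\mu(\{|Tf|>\lambda\})^{1/p}\lesssim\|f\|_p$ uniformly; weak type $(\infty,\infty)$ means bounded on $L^\infty$. *)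

theory Defs
  imports "HOL-Analysis.Analysis"
begin

definition mm_space :: "'a set \<Rightarrow> ('a \<Rightarrow> 'a \<Rightarrow> real) \<Rightarrow> 'a measure \<Rightarrow> bool" where
  "mm_space X \<rho> \<mu> \<longleftrightarrow> X \<noteq> {} \<and> Metric_space X \<rho> \<and> space \<mu> = X \<and>
     sets \<mu> = sigma_sets X {U. openin (Metric_space.mtopology X \<rho>) U} \<and>
     (\<forall>x\<in>X. \<forall>s>0. 0 < emeasure \<mu> (Metric_space.mball X \<rho> x s)
                   \<and> emeasure \<mu> (Metric_space.mball X \<rho> x s) < \<infinity>)"

definition doubling :: "'a set \<Rightarrow> ('a \<Rightarrow> 'a \<Rightarrow> real) \<Rightarrow> 'a measure \<Rightarrow> bool" where
  "doubling X \<rho> \<mu> \<longleftrightarrow> (\<exists>C::real. \<forall>x\<in>X. \<forall>s>0.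
      emeasure \<mu> (Metric_space.mball X \<rho> x (2 * s)) \<le> ennreal C * emeasure \<mu> (Metric_space.mball X \<rho> x s))"

definition cmax :: "'a set \<Rightarrow> ('a \<Rightarrow> 'a \<Rightarrow> real) \<Rightarrow> 'a measure \<Rightarrow> real \<Rightarrow> ('a \<Rightarrow> real) \<Rightarrow> 'a \<Rightarrow> ennreal" where
  "cmax X \<rho> \<mu> \<kappa> f x = (SUP s\<in>{0<..}.
      (\<integral>\<^sup>+ y \<in> Metric_space.mball X \<rho> x s. ennreal \<bar>f y\<bar> \<partial>\<mu>) / emeasure \<mu> (Metric_space.mball X \<rho> x (\<kappa> * s)))"

definition umax :: "'a set \<Rightarrow> ('a \<Rightarrow> 'a \<Rightarrow> real) \<Rightarrow> 'a measure \<Rightarrow> real \<Rightarrow> ('a \<Rightarrow> real) \<Rightarrow> 'a \<Rightarrow> ennreal" where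
  "umax X \<rho> \<mu> \<kappa> f x = (SUP ys\<in>{(y, s). y \<in> X \<and> 0 < s \<and> x \<in> Metric_space.mball X \<rho> y s}.
      (\<integral>\<^sup>+ z \<in> Metric_space.mball X \<rho> (fst ys) (snd ys). ennreal \<bar>f z\<bar> \<partial>\<mu>)
        / emeasure \<mu> (Metric_space.mball X \<rho> (fst ys) (\<kappa> * snd ys)))"

text \<open>Outer measure and upper integral (agree with measure / integral on measurable data;
  used so that no measurability of the maximal function is presupposed).\<close>
definition outer_meas :: "'a measure \<Rightarrow> 'a set \<Rightarrow> ennreal" where
  "outer_meas \<mu> S = (INF A\<in>{A \<in> sets \<mu>. S \<inter> space \<mu> \<subseteq> A}. emeasure \<mu> A)"

definition upper_nn_integral :: "'a measure \<Rightarrow> ('a \<Rightarrow> ennreal) \<Rightarrow> ennreal" where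
  "upper_nn_integral \<mu> g = (INF h\<in>{h \<in> borel_measurable \<mu>. \<forall>x\<in>space \<mu>. g x \<le> h x}. \<integral>\<^sup>+ x. h x \<partial>\<mu>)"

definition ess_norm :: "'a measure \<Rightarrow> ('a \<Rightarrow> ennreal) \<Rightarrow> ennreal" where
  "ess_norm \<mu> g = Inf {c. outer_meas \<mu> {x \<in> space \<mu>. c < g x} = 0}"

definition epow :: "ennreal \<Rightarrow> real \<Rightarrow> ennreal" where
  "epow a p = (if a = \<infinity> then \<infinity> else ennreal (enn2real a powr p))"

definition strong_type :: "'a measure \<Rightarrow> (('a \<Rightarrow> real) \<Rightarrow> 'a \<Rightarrow> ennreal) \<Rightarrow> ereal \<Rightarrow> bool" where
  "strong_type \<mu> T p \<longleftrightarrow>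
     (if p = \<infinity> then
        (\<exists>C::real>0. \<forall>f \<in> borel_measurable \<mu>. ess_norm \<mu> (\<lambda>x. ennreal \<bar>f x\<bar>) < \<infinity> \<longrightarrow>
            ess_norm \<mu> (T f) \<le> ennreal C * ess_norm \<mu> (\<lambda>x. ennreal \<bar>f x\<bar>))
      else
        (\<exists>C::real>0. \<forall>f \<in> borel_measurable \<mu>.
            (\<integral>\<^sup>+ x. ennreal (\<bar>f x\<bar> powr real_of_ereal p) \<partial>\<mu>) < \<infinity> \<longrightarrow>
            upper_nn_integral \<mu> (\<lambda>x. epow (T f x) (real_of_ereal p))
              \<le> ennreal (C powr real_of_ereal p) * (\<integral>\<^sup>+ x. ennreal (\<bar>f x\<bar> powr real_of_ereal p) \<partial>\<mu>)))"

definition weak_type :: "'a measure \<Rightarrow> (('a \<Rightarrow> real) \<Rightarrow> 'a \<Rightarrow> ennreal) \<Rightarrow> ereal \<Rightarrow> bool" where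
  "weak_type \<mu> T p \<longleftrightarrow>
     (if p = \<infinity> then strong_type \<mu> T p
      else
        (\<exists>C::real>0. \<forall>f \<in> borel_measurable \<mu>.
            (\<integral>\<^sup>+ x. ennreal (\<bar>f x\<bar> powr real_of_ereal p) \<partial>\<mu>) < \<infinity> \<longrightarrow>
            (\<forall>t::real>0. ennreal (t powr real_of_ereal p) * outer_meas \<mu> {x \<in> space \<mu>. ennreal t < T f x}
              \<le> ennreal (C powr real_of_ereal p) * (\<integral>\<^sup>+ x. ennreal (\<bar>f x\<bar> powr real_of_ereal p) \<partial>\<mu>))))"

definition exp_set_form :: "ereal set \<Rightarrow> bool" where
  "exp_set_form P \<longleftrightarrow> P = {\<infinity>} \<or>
     (\<exists>p0::real. 1 \<le> p0 \<and> (P = {ereal p0..} \<or> P = {ereal p0<..}))"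

end

theory Submission
  imports Defs
begin

text \<open>
  Points of a countable discrete space carry a summable weight; separate blocks have mutual
  distance 4 and diameter at most 4, so a ball either stays inside one block or is the whole space.

  A star block has a hub of weight c, leaves of weight c m_i and spokes of total weight c. Seen from
  leaf i, the hub indicator has maximal function about 1/m_i as soon as some admissible ball contains the
  hub and leaf i while its dilate contains no other leaf. Thus strong type (p,p) amounts to a bound
  on the sum of m_i^(1-p), and weak type (p,p) to bounding the sum of those m_i with m_i \<le> m_j by a
  multiple of m_j^p, uniformly over the stars. Leaves at mutual distance 4 make
  this visible for the centred operator when \<open>\<kappa> < 2\<close>; at mutual distance 2 they hide it from the
  centred operator, but balls centred at the spokes still show it to the noncentred one when
  \<open>\<kappa> < 3\<close>.

  For larger dilations only strong type (1,1) may fail. This is achieved by a chain of points accumulating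
  geometrically with ratio \<open>1 / lam\<close> and having superexponentially decreasing weights: with
  \<open>lam = 4 * \<kappa>\<close> the centred operator already fails, with \<open>lam = \<kappa>\<close> any dilated ball
  centred at the l-th point and reaching past its successor contains the much heavier
  preceding point, so that only the noncentred operator fails.

  Upper bounds for all p at once use \<open>a \<le> s + s powr (1 - p) * a powr p\<close> for every \<open>s > 0\<close>: it turns
  averages of f into averages of \<open>\<bar>f\<bar> powr p\<close>, which are controlled by the column sums of a kernel.
\<close>

section \<open>Discrete weighted metric spaces\<close>

text \<open>The noncentred operator dominates the centred one, so every star meant for the centred
  operator constrains the noncentred one too; this is harmless because the noncentred sets are the
  smaller ones. The thresholds 2 and 3 are quotients of distances in a star. The hub is 2 away from
  a leaf, and other leaves can be kept 4 away; a spoke is 1 away from its hub and its leaf, and 3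
  away from all other leaves. Once \<kappa> reaches 4/2 or 3/1, no ball separates hub and one leaf
  from the other leaves. But then the weak set is everything, and the closure condition leaves only
  p = 1 open for the strong one. Chains attack just this exponent: they are of weak type (1,1) and
  of strong type for all p > 1. The main difficulty is that one space needs sharp upper bounds for
  both operators at all p. Every average is therefore dominated by a part \<open>tame\<close>,
  harmless for all p, plus a part \<open>wild\<close> in which only the intended obstructions
  survive. Strong type needs a linearisation of \<open>wild\<close>, weak type its level sets. Star
  n has mass at most 2^(-n), which keeps the total mass finite and destroys doubling.\<close>

lemma ennreal_le_powr_dual:
  fixes a Q :: ennreal and c p :: real
  assumes p: "1 \<le> p" and c: "0 \<le> c"
    and dual: "\<And>s. 0 < s \<Longrightarrow> a \<le> ennreal (c * s) + ennreal (s powr (1 - p)) * Q"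
  shows "epow a p \<le> ennreal ((c + 1) powr p) * Q"
proof (cases "Q = \<infinity>")
  case True
  with c show ?thesis by (simp add: ennreal_mult_top)
next
  case False
  then obtain q where q: "Q = ennreal q" "0 \<le> q" by (cases Q) auto
  have afin: "a \<noteq> \<infinity>" using dual[of 1] q
    by (auto simp: top_unique ennreal_mult_eq_top_iff)
  then obtain b where b: "a = ennreal b" "0 \<le> b" by (cases a) auto
  have dual': "b \<le> c * s + s powr (1 - p) * q" if "0 < s" for s
  proof -
    have "ennreal b \<le> ennreal (c * s + s powr (1 - p) * q)"
      using dual[OF that] q b c that by (simp add: ennreal_mult ennreal_plus)
    then show ?thesis using q c that by (subst (asm) ennreal_le_iff) auto
  qed
  have "b powr p \<le> (c + 1) powr p * q"
  proof (cases "q = 0")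
    case True
    have "b \<le> 0"
    proof (rule field_le_epsilon)
      fix e :: real assume "0 < e"
      have "b \<le> c * (e / (c + 1))" using dual'[of "e / (c + 1)"] True c \<open>0 < e\<close> by simp
      also have "\<dots> \<le> e" using c \<open>0 < e\<close> by (simp add: field_simps)
      finally show "b \<le> 0 + e" by simp
    qed
    with b show ?thesis by (simp add: True)
  next
    case False
    with q have "0 < q" by simp
    \<comment> \<open>This scale balances the two terms of \<open>dual\<close>: s powr (1 - p) * q
      equals s. It requires q > 0; for q = 0 the claim came from letting s tend to 0.\<close>
    define s where "s = q powr (1 / p)"
    have s: "0 < s" "s powr p = q" using \<open>0 < q\<close> p by (auto simp: s_def powr_powr)
    have "s powr (1 - p) * q = s"
      using s by (metis powr_add add.commute diff_add_cancel powr_one less_imp_le)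
    with dual'[OF s(1)] have "b \<le> (c + 1) * s" by (simp add: algebra_simps)
    then have "b powr p \<le> ((c + 1) * s) powr p" using b p by (intro powr_mono2) auto
    also have "\<dots> = (c + 1) powr p * q" using s c by (simp add: powr_mult)
    finally show ?thesis .
  qed
  with b q afin show ?thesis by (simp add: epow_def flip: ennreal_mult)
qed

text \<open>Cancels the powers of t in \<open>weak_typeI\<close>, where the scale s = t / (4 c) is
  put into Markov's inequality.\<close>

lemma weak_typeI_constant:
  fixes t c p :: real
  assumes "0 < t" "0 < c"
  shows "t powr p * (4 * (t / (4 * c)) powr (1 - p) / t) = 4 powr p * c powr (p - 1)"
proof -
  have "0 < t powr p" "0 < c powr p" "0 < (4::real) powr p" using assms by auto
  moreover have "(t / (4 * c)) powr (1 - p) = (t / t powr p) / ((4 / 4 powr p) * (c / c powr p))"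
    using assms by (simp add: powr_divide powr_mult powr_diff)
  moreover have "c powr (p - 1) = c powr p / c" using assms by (simp add: powr_diff)
  ultimately show ?thesis using assms by (simp only:) (simp add: divide_simps)
qed

text \<open>For a > s the nonpositive exponent gives a powr (1 - p) \<le> s powr (1 - p). This takes
  the place of Hoelder's inequality: it is linear in the p-th power, hence can be integrated against
  any kernel, and p = 1 is no special case.\<close>

lemma le_add_powr_dual:
  fixes a s p :: real
  assumes "0 \<le> a" "0 < s" "1 \<le> p"
  shows "a \<le> s + s powr (1 - p) * a powr p"
proof (cases "a \<le> s")
  case True
  then show ?thesis using assms by (simp add: add_increasing2)
next
  case False
  then have "a = a powr (1 - p) * a powr p"
    using assms by (metis powr_add add.commute diff_add_cancel powr_one less_le_trans not_le less_imp_le order_trans)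
  also have "\<dots> \<le> s powr (1 - p) * a powr p"
    using False assms by (intro mult_right_mono powr_mono2') auto
  finally show ?thesis using assms by linarith
qed

lemma ennreal_inverse_antimono: "a \<le> b \<Longrightarrow> inverse b \<le> inverse (a :: ennreal)"
proof (cases "a = 0 \<or> b = \<infinity>")
  case False
  moreover assume "a \<le> b"
  ultimately obtain u v where "a = ennreal u" "b = ennreal v" "0 < u" "u \<le> v"
    by (cases a; cases b) (auto simp: top_unique)
  then show ?thesis by (simp add: inverse_ennreal le_imp_inverse_le)
qed auto

lemma epow_mono: "a \<le> b \<Longrightarrow> 0 \<le> p \<Longrightarrow> epow a p \<le> epow b p"
  by (auto simp: epow_def top_unique less_top intro!: ennreal_leI powr_mono2 enn2real_mono)

lemma emeasure_density_count_space_finite: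
  assumes "finite S" "S \<subseteq> X" "\<And>x. x \<in> S \<Longrightarrow> 0 \<le> w x"
  shows "emeasure (density (count_space X) (\<lambda>x. ennreal (w x))) S = ennreal (\<Sum>x\<in>S. w x)"
proof -
  have "emeasure (density (count_space X) (\<lambda>x. ennreal (w x))) S
      = (\<integral>\<^sup>+x. ennreal (w x) * indicator S x \<partial>count_space X)"
    using assms by (subst emeasure_density) auto
  also have "\<dots> = (\<Sum>x\<in>S. ennreal (w x) * indicator S x)"
    using assms by (intro nn_integral_count_space') auto
  also have "\<dots> = (\<Sum>x\<in>S. ennreal (w x))" by (intro sum.cong) auto
  finally show ?thesis using assms by (simp add: sum_ennreal)
qed

locale discrete_mm = Metric_space X d for X :: "'a set" and d :: "'a \<Rightarrow> 'a \<Rightarrow> real" +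
  fixes w :: "'a \<Rightarrow> real"
  assumes X_nonempty: "X \<noteq> {}"
    and X_countable: "countable X"
    and w_pos: "x \<in> X \<Longrightarrow> 0 < w x"
    and discrete: "x \<in> X \<Longrightarrow> \<exists>r>0. mball x r = {x}"
    and finite_mass: "emeasure (density (count_space X) (\<lambda>x. ennreal (w x))) X < \<infinity>"
begin

definition \<mu> :: "'a measure" where
  "\<mu> = density (count_space X) (\<lambda>x. ennreal (w x))"

lemma space_mu [simp]: "space \<mu> = X" and sets_mu [simp]: "sets \<mu> = Pow X"
  by (simp_all add: \<mu>_def)

lemma borel_measurable_mu [simp, measurable]: "f \<in> borel_measurable \<mu>"
  by (simp add: \<mu>_def)

lemma nn_integral_mu: "(\<integral>\<^sup>+x. f x \<partial>\<mu>) = (\<integral>\<^sup>+x. ennreal (w x) * f x \<partial>count_space X)"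
  unfolding \<mu>_def by (rule nn_integral_density) auto

lemma emeasure_finite_mu: "finite S \<Longrightarrow> S \<subseteq> X \<Longrightarrow> emeasure \<mu> S = ennreal (\<Sum>x\<in>S. w x)"
  unfolding \<mu>_def using w_pos by (intro emeasure_density_count_space_finite) (auto intro: less_imp_le)

lemma emeasure_singleton_mu: "x \<in> X \<Longrightarrow> emeasure \<mu> {x} = ennreal (w x)"
  by (subst emeasure_finite_mu) auto

lemma nn_integral_singleton_mu:
  assumes "x \<in> X" shows "(\<integral>\<^sup>+y. f y * indicator {x} y \<partial>\<mu>) = ennreal (w x) * f x"
proof -
  have "(\<integral>\<^sup>+y. f y * indicator {x} y \<partial>\<mu>) = (\<integral>\<^sup>+y. f x * indicator {x} y \<partial>\<mu>)"
    by (intro nn_integral_cong) (auto simp: indicator_def)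
  also have "\<dots> = f x * emeasure \<mu> {x}"
    by (rule nn_integral_cmult_indicator) (use assms in auto)
  finally show ?thesis using assms by (simp add: emeasure_singleton_mu mult.commute)
qed

lemma emeasure_mu_less_top: "emeasure \<mu> A < \<infinity>"
proof (cases "A \<in> sets \<mu>")
  case True
  then have "emeasure \<mu> A \<le> emeasure \<mu> X" by (intro emeasure_mono) auto
  then show ?thesis using finite_mass by (simp add: \<mu>_def le_less_trans)
qed (simp add: emeasure_notin_sets)

lemma emeasure_mono_mu: "A \<subseteq> B \<Longrightarrow> B \<subseteq> X \<Longrightarrow> emeasure \<mu> A \<le> emeasure \<mu> B"
  by (rule emeasure_mono) auto

lemma emeasure_pos_mu: "x \<in> A \<Longrightarrow> A \<subseteq> X \<Longrightarrow> 0 < emeasure \<mu> A"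
proof -
  assume A: "x \<in> A" "A \<subseteq> X"
  then have "0 < emeasure \<mu> {x}" using w_pos[of x] by (subst emeasure_singleton_mu) auto
  also have "\<dots> \<le> emeasure \<mu> A" using A by (intro emeasure_mono_mu) auto
  finally show ?thesis .
qed

lemma mball_subset: "mball x r \<subseteq> X" by auto

text \<open>Singletons are balls, so every set is open and the Borel sets are all subsets of
  X.\<close>

lemma mm_space_mu: "mm_space X d \<mu>"
proof -
  have "sigma_sets X {U. openin mtopology U} = Pow X"
  proof (intro antisym subsetI)
    fix A assume "A \<in> sigma_sets X {U. openin mtopology U}"
    then show "A \<in> Pow X"
      using sigma_sets_into_sp[of "{U. openin mtopology U}" X A] openin_subset[of mtopology] by (auto simp: subset_iff)
  next
    fix A assume "A \<in> Pow X"
    then have A: "A \<subseteq> X" by simp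
    have "A = (\<Union>x\<in>A. {x})" by auto
    have "openin mtopology A"
      unfolding openin_mtopology
    proof (intro conjI ballI allI impI)
      fix x assume "x \<in> A"
      with A discrete[of x] obtain r where "r > 0" "mball x r = {x}" by auto
      with \<open>x \<in> A\<close> show "\<exists>r>0. mball x r \<subseteq> A" by auto
    qed (use A in auto)
    then show "A \<in> sigma_sets X {U. openin mtopology U}" by auto
  qed
  then show ?thesis
    unfolding mm_space_def
    using X_nonempty Metric_space_axioms emeasure_mu_less_top
    by (auto intro!: emeasure_pos_mu mball_subset)
qed

lemma upper_nn_integral_mu: "upper_nn_integral \<mu> g = (\<integral>\<^sup>+x. g x \<partial>\<mu>)"
  unfolding upper_nn_integral_def
  by (rule antisym) (auto intro!: INF_lower INF_greatest nn_integral_mono)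

lemma outer_meas_mu: "S \<subseteq> X \<Longrightarrow> outer_meas \<mu> S = emeasure \<mu> S"
  unfolding outer_meas_def
  by (rule antisym) (auto intro!: INF_lower INF_greatest emeasure_mono)

text \<open>Every point has positive mass, so only the empty set is null.\<close>

lemma ess_norm_mu: "ess_norm \<mu> g = (SUP x\<in>X. g x)"
proof -
  have "outer_meas \<mu> {x \<in> space \<mu>. c < g x} = 0 \<longleftrightarrow> (\<forall>x\<in>X. g x \<le> c)" for c
  proof
    assume "outer_meas \<mu> {x \<in> space \<mu>. c < g x} = 0"
    then have "emeasure \<mu> {x \<in> X. c < g x} = 0" by (subst (asm) outer_meas_mu) auto
    then have "{x \<in> X. c < g x} = {}"
      using emeasure_pos_mu[of _ "{x \<in> X. c < g x}"] by fastforce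
    then show "\<forall>x\<in>X. g x \<le> c" by (auto simp: not_less)
  next
    assume "\<forall>x\<in>X. g x \<le> c"
    then have "{x \<in> space \<mu>. c < g x} = {}" by (auto simp: not_less)
    then show "outer_meas \<mu> {x \<in> space \<mu>. c < g x} = 0"
      by (simp only: outer_meas_mu[OF empty_subsetI] emeasure_empty)
  qed
  then have "ess_norm \<mu> g = Inf {c. \<forall>x\<in>X. g x \<le> c}" by (simp add: ess_norm_def)
  also have "\<dots> = (SUP x\<in>X. g x)"
    by (rule antisym) (auto intro!: Inf_lower Inf_greatest SUP_upper SUP_least)
  finally show ?thesis .
qed

text \<open>With weights and indicators moved into the integrand, both sides become iterated
  integrals for counting measure on the whole type, where the order may be exchanged freely.\<close>

lemma nn_integral_mu_swap:
  "(\<integral>\<^sup>+x. (\<integral>\<^sup>+z. K x z \<partial>\<mu>) \<partial>\<mu>) = (\<integral>\<^sup>+z. (\<integral>\<^sup>+x. K x z \<partial>\<mu>) \<partial>\<mu>)"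
proof -
  define G where "G = (\<lambda>(x, z). ennreal (w x) * ennreal (w z) * K x z * indicator X x * indicator X z)"
  have 1: "(\<integral>\<^sup>+x. (\<integral>\<^sup>+z. K x z \<partial>\<mu>) \<partial>\<mu>)
      = (\<integral>\<^sup>+x. (\<integral>\<^sup>+z. G (x, z) \<partial>count_space UNIV) \<partial>count_space UNIV)"
    unfolding nn_integral_mu
    by (subst (1 2) nn_integral_count_space_indicator)
      (auto simp: G_def nn_integral_cmult nn_integral_multc mult_ac intro!: nn_integral_cong
        simp flip: nn_integral_cmult split: split_indicator)
  have 2: "(\<integral>\<^sup>+z. (\<integral>\<^sup>+x. K x z \<partial>\<mu>) \<partial>\<mu>)
      = (\<integral>\<^sup>+z. (\<integral>\<^sup>+x. G (x, z) \<partial>count_space UNIV) \<partial>count_space UNIV)"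
    unfolding nn_integral_mu
    by (subst (1 2) nn_integral_count_space_indicator)
      (auto simp: G_def nn_integral_cmult nn_integral_multc mult_ac intro!: nn_integral_cong
        simp flip: nn_integral_cmult split: split_indicator)
  show ?thesis unfolding 1 2 nn_integral_fst_count_space nn_integral_snd_count_space ..
qed

text \<open>Bounded column integrals suffice on L^1, and F will be a p-th power of |f|. The row
  condition of Schur's test is replaced by the s-term of the duality inequality.\<close>

lemma kernel_nn_integral_le:
  fixes F :: "'a \<Rightarrow> ennreal"
  assumes "\<And>z. z \<in> X \<Longrightarrow> (\<integral>\<^sup>+x. k x z \<partial>\<mu>) \<le> C"
  shows "(\<integral>\<^sup>+x. (\<integral>\<^sup>+z. k x z * F z \<partial>\<mu>) \<partial>\<mu>) \<le> C * (\<integral>\<^sup>+z. F z \<partial>\<mu>)"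
proof -
  have "(\<integral>\<^sup>+x. (\<integral>\<^sup>+z. k x z * F z \<partial>\<mu>) \<partial>\<mu>) = (\<integral>\<^sup>+z. (\<integral>\<^sup>+x. k x z \<partial>\<mu>) * F z \<partial>\<mu>)"
    by (subst nn_integral_mu_swap) (simp add: nn_integral_multc)
  also have "\<dots> \<le> (\<integral>\<^sup>+z. C * F z \<partial>\<mu>)"
    by (intro nn_integral_mono mult_right_mono assms) auto
  finally show ?thesis by (simp add: nn_integral_cmult)
qed

section \<open>Averages over balls and the two maximal operators\<close>

abbreviation abs_on :: "('a \<Rightarrow> real) \<Rightarrow> 'a set \<Rightarrow> ennreal" where
  "abs_on f Z \<equiv> \<integral>\<^sup>+x\<in>Z. ennreal \<bar>f x\<bar> \<partial>\<mu>"

lemma nn_integral_add_le: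
  assumes "(\<integral>\<^sup>+x. A x \<partial>\<mu>) \<le> ennreal a * I" "(\<integral>\<^sup>+x. B x \<partial>\<mu>) \<le> ennreal b * I" "0 \<le> a" "0 \<le> b"
  shows "(\<integral>\<^sup>+x. A x + B x \<partial>\<mu>) \<le> ennreal (a + b) * I"
  using add_mono[OF assms(1,2)] assms(3,4) by (simp add: nn_integral_add ennreal_plus distrib_right)

definition avg :: "real \<Rightarrow> ('a \<Rightarrow> real) \<Rightarrow> 'a \<Rightarrow> real \<Rightarrow> ennreal" where
  "avg \<kappa> f y r = abs_on f (mball y r) / emeasure \<mu> (mball y (\<kappa> * r))"

abbreviation norm_pow :: "real \<Rightarrow> ('a \<Rightarrow> real) \<Rightarrow> ennreal" where
  "norm_pow p f \<equiv> \<integral>\<^sup>+x. ennreal (\<bar>f x\<bar> powr p) \<partial>\<mu>"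

abbreviation norm_pow_on :: "real \<Rightarrow> ('a \<Rightarrow> real) \<Rightarrow> 'a set \<Rightarrow> ennreal" where
  "norm_pow_on p f Z \<equiv> \<integral>\<^sup>+x\<in>Z. ennreal (\<bar>f x\<bar> powr p) \<partial>\<mu>"

lemma cmax_le_iff: "cmax X d \<mu> \<kappa> f x \<le> b \<longleftrightarrow> (\<forall>r>0. avg \<kappa> f x r \<le> b)"
  by (auto simp: cmax_def avg_def SUP_le_iff)

lemma umax_le_iff:
  "umax X d \<mu> \<kappa> f x \<le> b \<longleftrightarrow> (\<forall>y\<in>X. \<forall>r>0. x \<in> mball y r \<longrightarrow> avg \<kappa> f y r \<le> b)"
  by (auto simp: umax_def avg_def SUP_le_iff)

lemma avg_le_cmax: "0 < r \<Longrightarrow> avg \<kappa> f x r \<le> cmax X d \<mu> \<kappa> f x"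
  using cmax_le_iff[of \<kappa> f x "cmax X d \<mu> \<kappa> f x"] by auto

lemma avg_le_umax: "y \<in> X \<Longrightarrow> 0 < r \<Longrightarrow> x \<in> mball y r \<Longrightarrow> avg \<kappa> f y r \<le> umax X d \<mu> \<kappa> f x"
  using umax_le_iff[of \<kappa> f x "umax X d \<mu> \<kappa> f x"] by auto

lemma cmax_le_umax: "x \<in> X \<Longrightarrow> cmax X d \<mu> \<kappa> f x \<le> umax X d \<mu> \<kappa> f x"
  unfolding cmax_le_iff by (auto intro!: avg_le_umax)

lemma nn_integral_ball_dual:
  assumes "0 < s" "1 \<le> p"
  shows "abs_on f B \<le>
    ennreal s * emeasure \<mu> (B \<inter> X) + ennreal (s powr (1 - p)) * norm_pow_on p f B"
proof -
  have "abs_on f B \<le>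
    (\<integral>\<^sup>+z. ennreal s * indicator (B \<inter> X) z + ennreal (s powr (1 - p)) * (ennreal (\<bar>f z\<bar> powr p) * indicator B z) \<partial>\<mu>)"
    using le_add_powr_dual[of _ s p] assms
    by (intro nn_integral_mono) (auto split: split_indicator simp flip: ennreal_mult ennreal_plus)
  also have "\<dots> = ennreal s * emeasure \<mu> (B \<inter> X) + ennreal (s powr (1 - p)) * norm_pow_on p f B"
    by (simp add: nn_integral_add nn_integral_cmult)
  finally show ?thesis .
qed

lemma avg_le:
  assumes "0 < v" "ennreal v \<le> emeasure \<mu> (mball y (\<kappa> * r))" "mball y r \<subseteq> Z"
  shows "avg \<kappa> f y r \<le> ennreal (1 / v) * abs_on f Z"
proof -
  have inv: "inverse (emeasure \<mu> (mball y (\<kappa> * r))) \<le> ennreal (1 / v)"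
    using ennreal_inverse_antimono[OF assms(2)] assms(1) by (simp add: inverse_eq_divide inverse_ennreal)
  have "avg \<kappa> f y r = inverse (emeasure \<mu> (mball y (\<kappa> * r))) * abs_on f (mball y r)"
    by (simp add: avg_def divide_ennreal_def mult.commute)
  also have "\<dots> \<le> ennreal (1 / v) * abs_on f Z"
    using assms(3) by (intro mult_mono inv nn_integral_mono) (auto split: split_indicator)
  finally show ?thesis .
qed

text \<open>The two terms use the dilated ball differently: its true mass absorbs the mass of the
  ball, so that the coefficient of s is exactly 1, while only the p-th powers see the cruder data v
  and Z.\<close>

lemma avg_le_dual:
  assumes "1 \<le> \<kappa>" "y \<in> X" "0 < r" "0 < v" "ennreal v \<le> emeasure \<mu> (mball y (\<kappa> * r))"
    "mball y r \<subseteq> Z" "0 < s" "1 \<le> p"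
  shows "avg \<kappa> f y r \<le> ennreal s +
    ennreal (s powr (1 - p)) * (ennreal (1 / v) * norm_pow_on p f Z)"
proof -
  let ?B = "mball y r" and ?U = "emeasure \<mu> (mball y (\<kappa> * r))"
  have "r \<le> \<kappa> * r" using assms by simp
  then have sub: "mball y r \<subseteq> mball y (\<kappa> * r)" by (rule mball_subset_concentric)
  have inv: "inverse ?U \<le> ennreal (1 / v)"
    using ennreal_inverse_antimono[OF assms(5)] assms(4) by (simp add: inverse_eq_divide inverse_ennreal)
  have U: "?U \<noteq> 0" "?U \<noteq> \<infinity>"
    using assms(4,5) emeasure_mu_less_top[of "mball y (\<kappa> * r)"] by (auto simp: ennreal_eq_0_iff)
  have UB: "emeasure \<mu> ?B \<le> ?U" by (intro emeasure_mono_mu sub mball_subset)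
  have "avg \<kappa> f y r \<le> inverse ?U * (ennreal s * emeasure \<mu> ?B +
      ennreal (s powr (1 - p)) * norm_pow_on p f ?B)"
    using nn_integral_ball_dual[OF assms(7,8), of f ?B] mball_subset[of y r]
    by (simp add: avg_def divide_ennreal_def mult.commute Int_absorb2 mult_left_mono)
  also have "\<dots> = ennreal s * (emeasure \<mu> ?B * inverse ?U) +
      ennreal (s powr (1 - p)) * (inverse ?U * norm_pow_on p f ?B)"
    by (simp add: distrib_left mult_ac)
  also have "\<dots> \<le> ennreal s * (?U * inverse ?U) +
      ennreal (s powr (1 - p)) * (ennreal (1 / v) * norm_pow_on p f Z)"
    using assms(6) by (intro add_mono mult_mono inv UB order_refl nn_integral_mono) (auto split: split_indicator)
  also have "?U * inverse ?U = 1"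
    using U by (metis divide_ennreal_def ennreal_divide_self infinity_ennreal_def top.not_eq_extremum)
  finally show ?thesis by simp
qed

lemma avg_le_Sup:
  assumes "1 \<le> \<kappa>" "y \<in> X" "0 < r"
  shows "avg \<kappa> f y r \<le> (SUP x\<in>X. ennreal \<bar>f x\<bar>)"
proof -
  let ?B = "mball y r" and ?U = "emeasure \<mu> (mball y (\<kappa> * r))" and ?S = "SUP x\<in>X. ennreal \<bar>f x\<bar>"
  have "r \<le> \<kappa> * r" using assms by simp
  then have sub: "mball y r \<subseteq> mball y (\<kappa> * r)" by (rule mball_subset_concentric)
  have "0 < ?U" by (rule emeasure_pos_mu[of y]) (use assms in auto)
  have "abs_on f ?B \<le> (\<integral>\<^sup>+z. ?S * indicator ?B z \<partial>\<mu>)"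
    by (intro nn_integral_mono) (auto intro!: SUP_upper split: split_indicator)
  also have "\<dots> = ?S * emeasure \<mu> ?B" by (rule nn_integral_cmult_indicator) auto
  also have "\<dots> \<le> ?S * ?U" by (intro mult_left_mono emeasure_mono_mu sub mball_subset) auto
  finally show ?thesis unfolding avg_def
    using \<open>0 < ?U\<close> emeasure_mu_less_top by (intro divide_le_posI_ennreal) (auto simp: mult.commute)
qed

section \<open>Strong type at infinity, and sufficient criteria for finite exponents\<close>

lemma strong_type_infinity:
  assumes "1 \<le> \<kappa>"
  shows "strong_type \<mu> (umax X d \<mu> \<kappa>) \<infinity>" "strong_type \<mu> (cmax X d \<mu> \<kappa>) \<infinity>"
    "weak_type \<mu> (umax X d \<mu> \<kappa>) \<infinity>" "weak_type \<mu> (cmax X d \<mu> \<kappa>) \<infinity>"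
proof -
  have u: "umax X d \<mu> \<kappa> f x \<le> (SUP x\<in>X. ennreal \<bar>f x\<bar>)" if "x \<in> X" for f x
    unfolding umax_le_iff using assms by (auto intro!: avg_le_Sup)
  show 1: "strong_type \<mu> (umax X d \<mu> \<kappa>) \<infinity>" "strong_type \<mu> (cmax X d \<mu> \<kappa>) \<infinity>"
    unfolding strong_type_def ess_norm_mu
    by (auto intro!: exI[of _ 1] SUP_least u intro: order_trans[OF cmax_le_umax u])
  show "weak_type \<mu> (umax X d \<mu> \<kappa>) \<infinity>" "weak_type \<mu> (cmax X d \<mu> \<kappa>) \<infinity>"
    using 1 by (simp_all add: weak_type_def)
qed

text \<open>\<open>ennreal_le_powr_dual\<close> condenses the bounds for all s into a pointwise
  bound of the p-th power of T f by Q, which is then integrated.\<close>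

lemma strong_typeI:
  fixes p c D :: real
  assumes p: "1 \<le> p" and "0 \<le> c" "0 < D"
    and dual: "\<And>f x s. x \<in> X \<Longrightarrow> 0 < s \<Longrightarrow> T f x \<le> ennreal (c * s) + ennreal (s powr (1 - p)) * Q f x"
    and Q: "\<And>f. (\<integral>\<^sup>+x. Q f x \<partial>\<mu>) \<le> ennreal D * norm_pow p f"
  shows "strong_type \<mu> T (ereal p)"
proof -
  define E where "E = (c + 1) powr p * D"
  have E: "0 < E" using assms by (simp add: E_def)
  have "(\<integral>\<^sup>+x. epow (T f x) p \<partial>\<mu>) \<le> ennreal E * norm_pow p f" for f
  proof -
    have "(\<integral>\<^sup>+x. epow (T f x) p \<partial>\<mu>) \<le> (\<integral>\<^sup>+x. ennreal ((c + 1) powr p) * Q f x \<partial>\<mu>)"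
      using p assms(2) dual by (intro nn_integral_mono ennreal_le_powr_dual) auto
    also have "\<dots> = ennreal ((c + 1) powr p) * (\<integral>\<^sup>+x. Q f x \<partial>\<mu>)" by (simp add: nn_integral_cmult)
    also have "\<dots> \<le> ennreal ((c + 1) powr p) * (ennreal D * norm_pow p f)"
      by (intro mult_left_mono Q) auto
    finally show ?thesis using assms by (simp add: E_def ennreal_mult mult.assoc)
  qed
  moreover have "(E powr (1 / p)) powr p = E" using p E by (simp add: powr_powr)
  ultimately show ?thesis
    using E by (auto simp: strong_type_def upper_nn_integral_mu intro!: exI[of _ "E powr (1 / p)"])
qed

text \<open>R collects what is controlled only through its level sets. Where T f exceeds t, either R
  exceeds t / 2 or the Q-term is at least t / 4, and the latter is a case for Markov's
  inequality.\<close>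

lemma weak_typeI:
  fixes p c D :: real
  assumes p: "1 \<le> p" and "0 < c" "0 < D" "0 < D'"
    and dual: "\<And>f x s. x \<in> X \<Longrightarrow> 0 < s \<Longrightarrow>
      T f x \<le> ennreal (c * s) + ennreal (s powr (1 - p)) * Q f x + R f x"
    and Q: "\<And>f. (\<integral>\<^sup>+x. Q f x \<partial>\<mu>) \<le> ennreal D * norm_pow p f"
    and R: "\<And>f t. 0 < t \<Longrightarrow> ennreal (t powr p) * emeasure \<mu> {x\<in>X. ennreal t < R f x}
      \<le> ennreal D' * norm_pow p f"
  shows "weak_type \<mu> T (ereal p)"
proof -
  define E where "E = 4 powr p * c powr (p - 1) * D + 2 powr p * D'"
  have E: "0 < E" using assms by (simp add: E_def add_pos_pos)
  have "ennreal (t powr p) * emeasure \<mu> {x\<in>X. ennreal t < T f x}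
      \<le> ennreal E * norm_pow p f" if t: "0 < t" for f t
  proof -
    let ?I = "\<integral>\<^sup>+x. ennreal (\<bar>f x\<bar> powr p) \<partial>\<mu>"
    \<comment> \<open>Makes c * s equal to t / 4. With the constant a of the next line, the Q-term
      is at least t / 4 exactly where 1 \<le> a * Q.\<close>
    define s where "s = t / (4 * c)"
    define a where "a = 4 * s powr (1 - p) / t"
    have s: "0 < s" "0 < a" using t assms by (simp_all add: s_def a_def)
    let ?A = "{x\<in>X. 1 \<le> ennreal a * Q f x}" and ?B = "{x\<in>X. ennreal (t / 2) < R f x}"
    have sub: "{x\<in>X. ennreal t < T f x} \<subseteq> ?A \<union> ?B"
    proof safe
      fix x assume x: "x \<in> X" "ennreal t < T f x" "\<not> ennreal (t / 2) < R f x"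
      show "1 \<le> ennreal a * Q f x"
      proof (rule ccontr)
        assume "\<not> ?thesis"
        then have "ennreal a * Q f x < 1" by simp
        then have "ennreal (t / 4) * (ennreal a * Q f x) \<le> ennreal (t / 4) * 1"
          by (intro mult_left_mono) auto
        moreover have "ennreal (t / 4) * (ennreal a * Q f x) = ennreal (s powr (1 - p)) * Q f x"
          using t by (simp add: a_def mult.assoc[symmetric] flip: ennreal_mult)
        ultimately have "ennreal (s powr (1 - p)) * Q f x \<le> ennreal (t / 4)" by simp
        moreover have "ennreal (c * s) \<le> ennreal (t / 4)" using assms by (simp add: s_def)
        moreover have "R f x \<le> ennreal (t / 2)" using x(3) by simp
        ultimately have "ennreal (c * s) + ennreal (s powr (1 - p)) * Q f x + R f x
            \<le> ennreal (t / 4) + ennreal (t / 4) + ennreal (t / 2)"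
          by (intro add_mono)
        with dual[OF x(1) s(1), of f] have "T f x \<le> ennreal (t / 4) + ennreal (t / 4) + ennreal (t / 2)"
          by (rule order_trans)
        also have "\<dots> = ennreal t" using t by (simp flip: ennreal_plus)
        finally show False using x(2) by simp
      qed
    qed
    have "emeasure \<mu> {x\<in>X. ennreal t < T f x} \<le> emeasure \<mu> ?A + emeasure \<mu> ?B"
      by (rule order_trans[OF emeasure_mono[OF sub] emeasure_subadditive]) auto
    also have "emeasure \<mu> ?A \<le> ennreal a * (\<integral>\<^sup>+x\<in>X. Q f x \<partial>\<mu>)"
      using nn_integral_Markov_inequality[of "Q f" X \<mu> "ennreal a"] by (simp add: Collect_conj_eq Int_commute)
    also have "(\<integral>\<^sup>+x\<in>X. Q f x \<partial>\<mu>) = (\<integral>\<^sup>+x. Q f x \<partial>\<mu>)" by (intro nn_integral_cong) simp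
    also have "\<dots> \<le> ennreal D * ?I" by (rule Q)
    finally have "emeasure \<mu> {x\<in>X. ennreal t < T f x} \<le> ennreal a * (ennreal D * ?I) + emeasure \<mu> ?B"
      by (simp add: mult_left_mono add_mono)
    then have "ennreal (t powr p) * emeasure \<mu> {x\<in>X. ennreal t < T f x}
      \<le> ennreal (t powr p) * (ennreal a * (ennreal D * ?I) + emeasure \<mu> ?B)"
      by (rule mult_left_mono) simp
    also have "\<dots> = ennreal (t powr p) * (ennreal a * (ennreal D * ?I)) + ennreal (t powr p) * emeasure \<mu> ?B"
      by (rule distrib_left)
    also have "ennreal (t powr p) * (ennreal a * (ennreal D * ?I)) = ennreal (t powr p * a * D) * ?I"
      using s assms by (simp add: ennreal_mult mult.assoc)
    also have "t powr p * a * D = 4 powr p * c powr (p - 1) * D"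
      using weak_typeI_constant[OF t assms(2)] by (simp add: a_def s_def)
    also have "ennreal (t powr p) * emeasure \<mu> ?B
        = ennreal (2 powr p) * (ennreal ((t / 2) powr p) * emeasure \<mu> ?B)"
      using t by (simp add: powr_divide mult.assoc[symmetric] flip: ennreal_mult)
    also have "\<dots> \<le> ennreal (2 powr p) * (ennreal D' * ?I)" using R[of "t/2" f] t by (intro mult_left_mono) auto
    also have "ennreal (4 powr p * c powr (p - 1) * D) * ?I + ennreal (2 powr p) * (ennreal D' * ?I)
      = ennreal E * ?I"
      using assms by (simp add: E_def ennreal_mult ennreal_plus distrib_right mult.assoc)
    finally show ?thesis by (simp add: add_mono)
  qed
  moreover have "(E powr (1 / p)) powr p = E" using p E by (simp add: powr_powr)
  moreover have "{x \<in> space \<mu>. ennreal t < T f x} = {x\<in>X. ennreal t < T f x}" for t f by simp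
  moreover have "outer_meas \<mu> {x\<in>X. ennreal t < T f x} = emeasure \<mu> {x\<in>X. ennreal t < T f x}" for t f
    by (rule outer_meas_mu) auto
  ultimately show ?thesis
    using E by (auto simp: weak_type_def intro!: exI[of _ "E powr (1 / p)"])
qed

section \<open>Testing operators on point masses\<close>

lemma nn_integral_indicator_powr:
  assumes "z \<in> X" "1 \<le> p"
  shows "(\<integral>\<^sup>+x. ennreal (\<bar>indicator {z} x\<bar> powr p) \<partial>\<mu>) = ennreal (w z)"
proof -
  have "(\<integral>\<^sup>+x. ennreal (\<bar>indicator {z} x\<bar> powr p) \<partial>\<mu>) = (\<integral>\<^sup>+x. 1 * indicator {z} x \<partial>\<mu>)"
    using assms by (intro nn_integral_cong) (auto split: split_indicator)
  also have "\<dots> = ennreal (w z)" using nn_integral_singleton_mu[OF assms(1), of "\<lambda>_. 1"] by simp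
  finally show ?thesis .
qed

lemma le_avg_indicator:
  assumes "z \<in> mball y r" "y \<in> X" "mball y (\<kappa> * r) \<subseteq> Z" "Z \<subseteq> X" "emeasure \<mu> Z \<le> ennreal v" "0 < v"
  shows "ennreal (w z / v) \<le> avg \<kappa> (indicator {z}) y r"
proof -
  have z: "z \<in> X" using assms(1) by auto
  have "emeasure \<mu> (mball y (\<kappa> * r)) \<le> ennreal v"
    using emeasure_mono_mu[OF assms(3,4)] assms(5) by simp
  then have inv: "ennreal (1 / v) \<le> inverse (emeasure \<mu> (mball y (\<kappa> * r)))"
    using ennreal_inverse_antimono assms(6) by (fastforce simp: inverse_eq_divide inverse_ennreal)
  have "(\<integral>\<^sup>+x\<in>mball y r. ennreal \<bar>indicator {z} x\<bar> \<partial>\<mu>) = (\<integral>\<^sup>+x. 1 * indicator {z} x \<partial>\<mu>)"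
    using assms(1) by (intro nn_integral_cong) (auto split: split_indicator)
  also have "\<dots> = ennreal (w z)" using nn_integral_singleton_mu[OF z, of "\<lambda>_. 1"] by simp
  finally have "avg \<kappa> (indicator {z}) y r = ennreal (w z) * inverse (emeasure \<mu> (mball y (\<kappa> * r)))"
    by (simp add: avg_def divide_ennreal_def)
  moreover have "ennreal (w z / v) = ennreal (w z) * ennreal (1 / v)"
    using w_pos[OF z] assms(6) by (simp flip: ennreal_mult)
  ultimately show ?thesis using inv by (simp add: mult_left_mono)
qed

text \<open>All necessary conditions come from indicators of single points. Lower bounds g on a
  finite S are enough, so no maximal function has to be computed.\<close>

lemma strong_type_indicator:
  assumes "strong_type \<mu> T (ereal p)" "1 \<le> p"
  obtains C :: real where "0 < C"
    "\<And>z S g. z \<in> X \<Longrightarrow> finite S \<Longrightarrow> S \<subseteq> X \<Longrightarrow>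
      (\<And>x. x \<in> S \<Longrightarrow> 0 \<le> g x \<and> ennreal (g x) \<le> T (indicator {z}) x) \<Longrightarrow>
      (\<Sum>x\<in>S. w x * g x powr p) \<le> C * w z"
proof -
  from assms obtain C :: real where C: "0 < C" and
    bnd: "\<And>f. norm_pow p f < \<infinity> \<Longrightarrow> (\<integral>\<^sup>+x. epow (T f x) p \<partial>\<mu>)
       \<le> ennreal (C powr p) * norm_pow p f"
    by (auto simp: strong_type_def upper_nn_integral_mu)
  show thesis
  proof (rule that[of "C powr p"])
    show "0 < C powr p" using C by simp
    fix z S g assume z: "z \<in> X" and S: "finite S" "S \<subseteq> X"
      and g: "\<And>x. x \<in> S \<Longrightarrow> 0 \<le> g x \<and> ennreal (g x) \<le> T (indicator {z}) x"
    have "ennreal (\<Sum>x\<in>S. w x * g x powr p) = (\<Sum>x\<in>S. ennreal (w x) * ennreal (g x powr p))"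
      using S w_pos by (subst sum_ennreal[symmetric]) (auto simp: ennreal_mult less_imp_le subset_iff intro!: sum.cong)
    also have "\<dots> = (\<Sum>x\<in>S. \<integral>\<^sup>+y. ennreal (g y powr p) * indicator {x} y \<partial>\<mu>)"
      using S by (intro sum.cong refl) (subst nn_integral_singleton_mu, auto)
    also have "\<dots> = (\<integral>\<^sup>+y. (\<Sum>x\<in>S. ennreal (g y powr p) * indicator {x} y) \<partial>\<mu>)"
      by (subst nn_integral_sum) auto
    also have "\<dots> \<le> (\<integral>\<^sup>+y. epow (T (indicator {z}) y) p \<partial>\<mu>)"
    proof (intro nn_integral_mono)
      fix y
      have *: "(\<Sum>x\<in>S. ennreal (g y powr p) * indicator {x} y) = (if y \<in> S then ennreal (g y powr p) else 0)"
        using S by (auto simp: indicator_def if_distrib[of "\<lambda>c. _ * c"] sum.delta cong: if_cong)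
      show "(\<Sum>x\<in>S. ennreal (g y powr p) * indicator {x} y) \<le> epow (T (indicator {z}) y) p"
      proof (cases "y \<in> S")
        case True
        have "ennreal (g y powr p) = epow (ennreal (g y)) p" using g[OF True] by (simp add: epow_def)
        also have "\<dots> \<le> epow (T (indicator {z}) y) p" using g[OF True] assms(2) by (intro epow_mono) auto
        finally show ?thesis using * True by simp
      qed (simp add: *)
    qed
    also have "\<dots> \<le> ennreal (C powr p) * ennreal (w z)"
      using bnd[of "indicator {z}"] nn_integral_indicator_powr[OF z assms(2)] by simp
    finally show "(\<Sum>x\<in>S. w x * g x powr p) \<le> C powr p * w z"
      using w_pos[OF z] C by (simp add: ennreal_le_iff flip: ennreal_mult)
  qed
qed

lemma weak_type_indicator:
  assumes "weak_type \<mu> T (ereal p)" "1 \<le> p"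
  obtains C :: real where "0 < C"
    "\<And>z S t. z \<in> X \<Longrightarrow> finite S \<Longrightarrow> S \<subseteq> X \<Longrightarrow> 0 < t \<Longrightarrow>
      (\<And>x. x \<in> S \<Longrightarrow> ennreal t < T (indicator {z}) x) \<Longrightarrow>
      t powr p * (\<Sum>x\<in>S. w x) \<le> C * w z"
proof -
  from assms obtain C :: real where C: "0 < C" and
    bnd: "\<And>f t. norm_pow p f < \<infinity> \<Longrightarrow> 0 < t \<Longrightarrow>
       ennreal (t powr p) * outer_meas \<mu> {x \<in> X. ennreal t < T f x}
       \<le> ennreal (C powr p) * norm_pow p f"
    by (auto simp: weak_type_def)
  show thesis
  proof (rule that[of "C powr p"])
    show "0 < C powr p" using C by simp
    fix z S and t :: real assume z: "z \<in> X" and S: "finite S" "S \<subseteq> X" and t: "0 < t"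
      and g: "\<And>x. x \<in> S \<Longrightarrow> ennreal t < T (indicator {z}) x"
    have "ennreal (t powr p * (\<Sum>x\<in>S. w x)) = ennreal (t powr p) * emeasure \<mu> S"
      using S by (simp add: emeasure_finite_mu ennreal_mult')
    also have "\<dots> \<le> ennreal (t powr p) * outer_meas \<mu> {x \<in> X. ennreal t < T (indicator {z}) x}"
      using S g by (subst outer_meas_mu) (auto intro!: mult_left_mono emeasure_mono_mu)
    also have "\<dots> \<le> ennreal (C powr p) * ennreal (w z)"
      using bnd[of "indicator {z}" t] nn_integral_indicator_powr[OF z assms(2)] t by simp
    finally show "t powr p * (\<Sum>x\<in>S. w x) \<le> C powr p * w z"
      using w_pos[OF z] C by (simp add: ennreal_le_iff flip: ennreal_mult)
  qed
qed

end

section \<open>Stars and chains\<close>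

text \<open>Leaf i of star n hangs on its own spoke \<open>Spoke n i\<close>. Links carry a flag
  because up to two chains are required, one against each operator.\<close>

datatype pt = Hub nat | Spoke nat nat | Leaf nat nat | Link bool nat

instance pt :: countable
  by countable_datatype

text \<open>The factor 1 + 1 / lam is the length of the path from i over i + 1 to i + 2, so for
  these two points it is the largest value the triangle inequality allows. This excess distance of
  nonneighbours is what \<open>umax_link_ge\<close> exploits.\<close>

definition chain_dist :: "real \<Rightarrow> nat \<Rightarrow> nat \<Rightarrow> real" where
  "chain_dist lam i j =
    (if i = j then 0 else if i = Suc j \<or> j = Suc i then (1 / lam) ^ min i j
     else (1 + 1 / lam) * (1 / lam) ^ min i j)"

text \<open>Within a star this is the path metric of the tree with unit edges hub-spoke and
  spoke-leaf, except between leaves: q n = 4 is the tree distance, q n = 2 a shortcut that puts all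
  leaves within reach as soon as the hub is.\<close>

fun pt_dist :: "(nat \<Rightarrow> real) \<Rightarrow> (bool \<Rightarrow> real) \<Rightarrow> pt \<Rightarrow> pt \<Rightarrow> real" where
  "pt_dist q lam (Hub n) (Hub k) = (if n = k then 0 else 4)"
| "pt_dist q lam (Hub n) (Spoke k j) = (if n = k then 1 else 4)"
| "pt_dist q lam (Hub n) (Leaf k j) = (if n = k then 2 else 4)"
| "pt_dist q lam (Spoke n i) (Hub k) = (if n = k then 1 else 4)"
| "pt_dist q lam (Spoke n i) (Spoke k j) = (if n = k then if i = j then 0 else 2 else 4)"
| "pt_dist q lam (Spoke n i) (Leaf k j) = (if n = k then if i = j then 1 else 3 else 4)"
| "pt_dist q lam (Leaf n i) (Hub k) = (if n = k then 2 else 4)"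
| "pt_dist q lam (Leaf n i) (Spoke k j) = (if n = k then if i = j then 1 else 3 else 4)"
| "pt_dist q lam (Leaf n i) (Leaf k j) = (if n = k then if i = j then 0 else q n else 4)"
| "pt_dist q lam (Link e i) (Link k j) = (if e = k then chain_dist (lam e) i j else 4)"
| "pt_dist q lam _ _ = 4"

lemma chain_dist_commute: "chain_dist lam i j = chain_dist lam j i"
  by (auto simp: chain_dist_def min.commute)

lemma chain_dist_bounds:
  assumes "1 \<le> lam" "i < j"
  shows "(1 / lam) ^ i \<le> chain_dist lam i j" "chain_dist lam i j \<le> (1 + 1 / lam) * (1 / lam) ^ i"
    "chain_dist lam i j \<le> 2"
proof -
  have p: "0 \<le> (1 / lam) ^ i" using assms by simp
  show "(1 / lam) ^ i \<le> chain_dist lam i j" "chain_dist lam i j \<le> (1 + 1 / lam) * (1 / lam) ^ i"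
    using assms mult_right_mono[OF _ p, of 1 "1 + 1 / lam"] by (auto simp: chain_dist_def)
  moreover have "(1 + 1 / lam) * (1 / lam) ^ i \<le> 2 * 1"
    using assms by (intro mult_mono power_le_one) auto
  ultimately show "chain_dist lam i j \<le> 2" by simp
qed

lemma chain_dist_nonneg: "0 < lam \<Longrightarrow> 0 \<le> chain_dist lam i j"
  by (auto simp: chain_dist_def)

text \<open>Let i < k. A detour over j < i has two legs of length at least (1 / lam)^j, together
  enough. A detour over j > i is critical only for j = i + 1 with k beyond it, since otherwise its
  first leg is already long enough; there the missing (1 / lam)^(i + 1) is supplied by the second
  leg.\<close>

lemma chain_dist_triangle:
  assumes lam: "2 \<le> lam"
  shows "chain_dist lam i k \<le> chain_dist lam i j + chain_dist lam j k"
proof -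
  have *: "chain_dist lam i k \<le> chain_dist lam i j + chain_dist lam j k" if "i < k" for i k
  proof -
    define a where "a = 1 / lam"
    have a: "0 < a" "a \<le> 1" using lam by (auto simp: a_def)
    have nn: "0 \<le> chain_dist lam x y" for x y using lam by (intro chain_dist_nonneg) simp
    have lo: "a ^ x \<le> chain_dist lam x y" if "x < y" for x y
      using chain_dist_bounds(1)[of lam x y] that lam by (simp add: a_def)
    have hi: "chain_dist lam x y \<le> (1 + a) * a ^ x" if "x < y" for x y
      using chain_dist_bounds(2)[of lam x y] that lam by (simp add: a_def)
    consider "j < i" | "j = i" | "j = k" | "i < j" "j \<noteq> k" by linarith
    then show ?thesis
    proof cases
      case 1
      have "chain_dist lam i k \<le> (1 + a) * a ^ i" using hi \<open>i < k\<close> by simp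
      also have "\<dots> \<le> 2 * a ^ j" using a 1 by (intro mult_mono power_decreasing) auto
      also have "\<dots> \<le> chain_dist lam i j + chain_dist lam j k"
        using lo[of j i] lo[of j k] 1 \<open>i < k\<close> by (simp add: chain_dist_commute)
      finally show ?thesis .
    next
      case 4
      show ?thesis
      proof (cases "k = Suc i \<or> j \<noteq> Suc i")
        case True
        then have "chain_dist lam i k \<le> chain_dist lam i j"
          using 4 \<open>i < k\<close> lo[of i j] hi[of i k] by (auto simp: chain_dist_def a_def)
        then show ?thesis using nn[of j k] by simp
      next
        case False
        then have "Suc i < k" "j = Suc i" using 4 \<open>i < k\<close> by auto
        then have "chain_dist lam i k \<le> a ^ i + a ^ Suc i" "chain_dist lam i j = a ^ i"
          using hi[of i k] \<open>i < k\<close> by (auto simp: chain_dist_def a_def algebra_simps)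
        then show ?thesis using lo[of j k] \<open>Suc i < k\<close> \<open>j = Suc i\<close> by simp
      qed
    qed (use nn in auto)
  qed
  show ?thesis
  proof (cases i k rule: linorder_cases)
    case less then show ?thesis by (rule *)
  next
    case equal then show ?thesis using lam chain_dist_nonneg[of lam] by (simp add: chain_dist_def)
  next
    case greater
    then show ?thesis using *[of k i] by (simp add: chain_dist_commute add.commute)
  qed
qed

text \<open>Star n has N n leaves at mutual distance q n, with weights m n i relative to the hub; h
  says which chains are present, and lam e is the ratio of chain e. By m \<ge> 1 no leaf is lighter
  than its hub.\<close>

locale glued =
  fixes \<kappa> :: real and N :: "nat \<Rightarrow> nat" and m :: "nat \<Rightarrow> nat \<Rightarrow> real" and q :: "nat \<Rightarrow> real"
    and h :: "bool \<Rightarrow> bool" and lam :: "bool \<Rightarrow> real"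
  assumes kappa: "1 \<le> \<kappa>"
    and m_ge_1: "i < N n \<Longrightarrow> 1 \<le> m n i"
    and q_cases: "q n = 2 \<or> q n = 4"
    and lam: "2 \<le> lam e"
begin

definition X :: "pt set" where
  "X = {x. case x of Hub n \<Rightarrow> True | Spoke n i \<Rightarrow> i < N n | Leaf n i \<Rightarrow> i < N n | Link e l \<Rightarrow> h e}"

abbreviation d :: "pt \<Rightarrow> pt \<Rightarrow> real" where "d \<equiv> pt_dist q lam"

text \<open>In units of the hub weight, hub and spokes together have mass at most 2, so the quotient
  gives star n mass at most 2^(-n).\<close>

definition c :: "nat \<Rightarrow> real" where "c n = (1 / 2) ^ n / (2 + (\<Sum>i<N n. m n i))"

text \<open>The exponent is quadratic because the ratios of consecutive weights have to be summable
  in \<open>kern_column_tail\<close>; for a geometric sequence they would be constant.\<close>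

definition chain_w :: "nat \<Rightarrow> real" where "chain_w l = (1 / 2) ^ (l * l)"

definition w :: "pt \<Rightarrow> real" where
  "w x = (case x of Hub n \<Rightarrow> c n | Spoke n i \<Rightarrow> c n / N n | Leaf n i \<Rightarrow> c n * m n i | Link e l \<Rightarrow> chain_w l)"

definition K :: "nat \<Rightarrow> pt set" where "K n = insert (Hub n) (Spoke n ` {..<N n})"

definition Y :: "nat \<Rightarrow> pt set" where "Y n = K n \<union> Leaf n ` {..<N n}"

definition tail :: "bool \<Rightarrow> nat \<Rightarrow> pt set" where "tail e t = Link e ` {t..}"

lemma X_simps [simp]:
  "Hub n \<in> X" "Spoke n i \<in> X \<longleftrightarrow> i < N n" "Leaf n i \<in> X \<longleftrightarrow> i < N n" "Link e l \<in> X \<longleftrightarrow> h e"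
  by (simp_all add: X_def)

lemma w_simps [simp]:
  "w (Hub n) = c n" "w (Spoke n i) = c n / N n" "w (Leaf n i) = c n * m n i" "w (Link e l) = chain_w l"
  by (simp_all add: w_def)

lemma sum_m_nonneg: "0 \<le> (\<Sum>i<N n. m n i)"
  by (intro sum_nonneg) (use m_ge_1 in force)

lemma c_pos: "0 < c n"
  using sum_m_nonneg[of n] by (simp add: c_def add_pos_nonneg)

lemma chain_w_pos: "0 < chain_w l" by (simp add: chain_w_def)

lemma w_pos: "x \<in> X \<Longrightarrow> 0 < w x"
  using c_pos m_ge_1 chain_w_pos
  by (cases x) (auto intro!: mult_pos_pos divide_pos_pos intro: less_le_trans[OF zero_less_one])

lemma q_bounds: "2 \<le> q n" "q n \<le> 4"
  using q_cases[of n] by auto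

lemma lam_pos: "0 < lam e"
  using lam[of e] by simp

lemma chain_dist_le_2: "chain_dist (lam e) i j \<le> 2"
  using chain_dist_bounds(3)[of "lam e" i j] chain_dist_bounds(3)[of "lam e" j i] lam[of e]
  by (cases i j rule: linorder_cases) (auto simp: chain_dist_commute[of _ j i] chain_dist_def[of _ j j])

lemma d_le: "d x y \<le> 4"
proof -
  have "chain_dist (lam e) i j \<le> 4" for e i j using chain_dist_le_2[of e i j] by simp
  then show ?thesis using q_bounds by (cases x; cases y) auto
qed

sublocale Metric_space X d
proof
  have q0: "0 \<le> q n" for n using q_bounds(1)[of n] by simp
  show "0 \<le> d x y" for x y
    using lam_pos by (cases x; cases y) (auto intro!: chain_dist_nonneg q0)
  show "d x y = d y x" for x y
    by (cases x; cases y) (auto simp: chain_dist_commute)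
  have q_ne: "q n \<noteq> 0" for n using q_bounds(1)[of n] by simp
  have "chain_dist (lam e) i j \<noteq> 0" if "i \<noteq> j" for e i j
  proof -
    have "0 < 1 + 1 / lam e" using lam_pos[of e] by (simp add: add_pos_pos)
    then show ?thesis using that lam_pos[of e] by (auto simp: chain_dist_def)
  qed
  then show "(d x y = 0) = (x = y)" if "x \<in> X" "y \<in> X" for x y
    using q_ne by (cases x; cases y) (auto simp: chain_dist_def)
  have tri: "chain_dist (lam e) i k \<le> chain_dist (lam e) i j + chain_dist (lam e) j k" for e i j k
    using lam by (rule chain_dist_triangle)
  have c0: "0 \<le> chain_dist (lam e) i j" for e i j using lam_pos by (rule chain_dist_nonneg)
  have qs: "q n \<le> 4 + x" "q n \<le> x + 4" "2 \<le> q n + x" "2 \<le> x + q n" "0 \<le> q n + x" "0 \<le> x + q n"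
    "q n \<le> 6" "q n \<le> 8" if "0 \<le> x" for n x
    using q_bounds[of n] that by simp_all
  have c8: "chain_dist (lam e) i j \<le> 8" for e i j using chain_dist_le_2[of e i j] by simp
  show "d x z \<le> d x y + d y z" if "x \<in> X" "y \<in> X" "z \<in> X" for x y z
    using q_bounds c0
    by (cases x; cases y; cases z) (auto intro!: tri c8 q0 qs simp: add_increasing2 add_increasing)
qed

section \<open>Masses of stars and chain tails\<close>

lemma chain_w_Suc: "chain_w (Suc l) \<le> (1 / 2) ^ Suc l * chain_w l"
proof -
  have "chain_w (Suc l) = (1 / 2) ^ (l + Suc l) * chain_w l"
    by (simp add: chain_w_def algebra_simps flip: power_add)
  also have "\<dots> \<le> (1 / 2) ^ Suc l * chain_w l"
    using chain_w_pos[of l] by (intro mult_right_mono power_decreasing) auto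
  finally show ?thesis .
qed

lemma chain_w_add: "chain_w (t + k) \<le> (1 / 2) ^ k * chain_w t"
proof -
  have "chain_w (t + k) = (1 / 2) ^ (2 * t * k + k * k) * chain_w t"
    unfolding chain_w_def power_add[symmetric] by (rule arg_cong[where f = "power _"]) (simp add: algebra_simps)
  also have "\<dots> \<le> (1 / 2) ^ k * chain_w t"
    using chain_w_pos[of t] by (intro mult_right_mono power_decreasing) (cases k, auto)
  finally show ?thesis .
qed

lemma chain_w_le: "chain_w l \<le> (1 / 2) ^ l"
  using chain_w_add[of 0 l] by (simp add: chain_w_def)

lemma chain_w_antimono: "t \<le> l \<Longrightarrow> chain_w l \<le> chain_w t"
  by (simp add: chain_w_def power_decreasing mult_le_mono)

lemma finite_K [simp]: "finite (K n)" and finite_Y [simp]: "finite (Y n)"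
  by (simp_all add: K_def Y_def)

lemma K_subset_Y: "K n \<subseteq> Y n" by (simp add: Y_def)

lemma Y_subset: "Y n \<subseteq> X" by (auto simp: Y_def K_def)

lemma K_subset: "K n \<subseteq> X" using K_subset_Y Y_subset by blast

lemma tail_subset: "h e \<Longrightarrow> tail e t \<subseteq> X" by (auto simp: tail_def)

lemma mem_simps [simp]:
  "Hub n \<in> K k \<longleftrightarrow> n = k" "Spoke n i \<in> K k \<longleftrightarrow> n = k \<and> i < N n" "Leaf n i \<notin> K k" "Link e l \<notin> K k"
  "Hub n \<in> Y k \<longleftrightarrow> n = k" "Spoke n i \<in> Y k \<longleftrightarrow> n = k \<and> i < N n"
  "Leaf n i \<in> Y k \<longleftrightarrow> n = k \<and> i < N n" "Link e l \<notin> Y k"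
  "Hub n \<notin> tail e t" "Spoke n i \<notin> tail e t" "Leaf n i \<notin> tail e t" "Link e' l \<in> tail e t \<longleftrightarrow> e' = e \<and> t \<le> l"
  by (auto simp: K_def Y_def tail_def)

lemma sum_w_K: "(\<Sum>x\<in>K n. w x) \<le> 2 * c n"
proof -
  have "(\<Sum>x\<in>K n. w x) = c n + (\<Sum>x\<in>Spoke n ` {..<N n}. w x)"
    unfolding K_def by (subst sum.insert) auto
  also have "(\<Sum>x\<in>Spoke n ` {..<N n}. w x) = (\<Sum>i<N n. c n / N n)"
    by (subst sum.reindex) (auto simp: inj_on_def)
  also have "\<dots> \<le> c n" using c_pos[of n] by simp
  finally show ?thesis by simp
qed

lemma sum_w_Y: "(\<Sum>x\<in>Y n. w x) = (\<Sum>x\<in>K n. w x) + c n * (\<Sum>i<N n. m n i)"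
proof -
  have "(\<Sum>x\<in>Y n. w x) = (\<Sum>x\<in>K n. w x) + (\<Sum>x\<in>Leaf n ` {..<N n}. w x)"
    unfolding Y_def by (subst sum.union_disjoint) auto
  also have "(\<Sum>x\<in>Leaf n ` {..<N n}. w x) = (\<Sum>i<N n. c n * m n i)"
    by (subst sum.reindex) (auto simp: inj_on_def)
  finally show ?thesis by (simp add: sum_distrib_left)
qed

lemma sum_w_Y_le: "(\<Sum>x\<in>Y n. w x) \<le> (1 / 2) ^ n"
proof -
  have "(\<Sum>x\<in>Y n. w x) \<le> c n * (2 + (\<Sum>i<N n. m n i))"
    unfolding sum_w_Y using sum_w_K[of n] by (simp add: algebra_simps)
  also have "\<dots> = (1 / 2) ^ n" using sum_m_nonneg[of n] by (simp add: c_def)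
  finally show ?thesis .
qed

lemma emeasure_X: "emeasure (density (count_space X) (\<lambda>x. ennreal (w x))) X < \<infinity>"
proof -
  let ?\<nu> = "density (count_space X) (\<lambda>x. ennreal (w x))"
  \<comment> \<open>The k-th star and the k-th point of each chain: finite pieces of mass at most 3
    * 2^(-k) that exhaust the space.\<close>
  define Z where "Z k = Y k \<union> {x\<in>X. x = Link True k \<or> x = Link False k}" for k
  have Z: "Z k \<subseteq> X" "finite (Z k)" for k
    using Y_subset[of k] finite_subset[of "{x\<in>X. x = Link True k \<or> x = Link False k}" "{Link True k, Link False k}"]
    by (auto simp: Z_def)
  have "x \<in> (\<Union>k. Z k)" if "x \<in> X" for x
    using that by (cases x) (auto simp: Z_def intro: exI)
  then have "X = (\<Union>k. Z k)" using Z(1) by blast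
  have "emeasure ?\<nu> (Z k) \<le> ennreal (3 * (1 / 2) ^ k)" for k
  proof -
    have "(\<Sum>x\<in>Z k. w x) \<le> (\<Sum>x\<in>Y k. w x) + (\<Sum>x\<in>{x\<in>X. x = Link True k \<or> x = Link False k}. w x)"
      unfolding Z_def by (subst sum.union_disjoint) (auto simp: Y_def K_def)
    also have "(\<Sum>x\<in>{x\<in>X. x = Link True k \<or> x = Link False k}. w x)
        \<le> (\<Sum>x\<in>{Link True k, Link False k}. w x)"
      using less_imp_le[OF chain_w_pos[of k]] by (intro sum_mono2) auto
    also have "(\<Sum>x\<in>{Link True k, Link False k}. w x) \<le> 2 * (1 / 2) ^ k"
      using chain_w_le[of k] by simp
    finally have "(\<Sum>x\<in>Z k. w x) \<le> 3 * (1 / 2) ^ k" using sum_w_Y_le[of k] by simp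
    then show ?thesis using Z w_pos
      by (subst emeasure_density_count_space_finite) (auto intro!: ennreal_leI less_imp_le)
  qed
  then have "(\<Sum>k. emeasure ?\<nu> (Z k)) \<le> (\<Sum>k. ennreal (3 * (1 / 2) ^ k))"
    by (intro suminf_le) auto
  also have "\<dots> < \<infinity>"
    by (subst suminf_ennreal2) (auto intro!: summable_mult summable_geometric)
  finally have "(\<Sum>k. emeasure ?\<nu> (Z k)) < \<infinity>" .
  moreover have "emeasure ?\<nu> (\<Union>k. Z k) \<le> (\<Sum>k. emeasure ?\<nu> (Z k))"
    using Z by (intro emeasure_subadditive_countably) auto
  ultimately show ?thesis using \<open>X = (\<Union>k. Z k)\<close> by simp
qed

sublocale discrete_mm X d w
proof
  show "X \<noteq> {}" using X_simps(1) by blast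
  show "countable X" by simp
  show "emeasure (density (count_space X) (\<lambda>x. ennreal (w x))) X < \<infinity>" by (rule emeasure_X)
  show "\<exists>r>0. mball x r = {x}" if x: "x \<in> X" for x
  proof -
    \<comment> \<open>The nearest neighbour of a chain point is its successor, at distance (1 / lam
      e)^l; a star point is at least 1 away from every other point.\<close>
    define r where "r = (case x of Link e l \<Rightarrow> (1 / lam e) ^ l | _ \<Rightarrow> 1)"
    have "0 < r" using lam_pos by (auto simp: r_def split: pt.split)
    moreover have "y = x" if "d x y < r" for y
    proof (cases "\<exists>e i j. x = Link e i \<and> y = Link e j")
      case True
      then obtain e i j where eq: "x = Link e i" "y = Link e j" by blast
      have l: "1 \<le> lam e" using lam[of e] by simp
      have "(1 / lam e) ^ i \<le> (1 / lam e) ^ j" if "j \<le> i"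
        using that l by (intro power_decreasing) auto
      then show ?thesis
        using \<open>d x y < r\<close> chain_dist_bounds(1)[OF l, of i j] chain_dist_bounds(1)[OF l, of j i]
        by (cases i j rule: linorder_cases) (auto simp: eq r_def chain_dist_commute[of _ j i])
    next
      case False
      have "0 \<le> 1 / lam e \<and> 1 / lam e \<le> 1" for e using lam[of e] by simp
      then have "r \<le> 1" by (auto simp: r_def split: pt.split intro!: power_le_one simp del: divide_le_eq_1_pos)
      then have "d x y < 1" using that by simp
      moreover have "\<not> q n < 1" for n using q_bounds(1)[of n] by simp
      ultimately show ?thesis using False by (cases x; cases y) (auto split: if_splits)
    qed
    ultimately show ?thesis using x by (intro exI[of _ r]) (auto simp: in_mball)
  qed
qed (rule w_pos)

lemma emeasure_K: "emeasure \<mu> (K n) \<le> ennreal (2 * c n)"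
  using sum_w_K[of n] K_subset by (subst emeasure_finite_mu) (auto intro: ennreal_leI)

lemma nn_integral_tail:
  assumes "h e"
  shows "(\<integral>\<^sup>+x\<in>tail e t. g x \<partial>\<mu>) = (\<Sum>k. ennreal (chain_w (t + k)) * g (Link e (t + k)))"
proof -
  have bij: "bij_betw (\<lambda>k. Link e (t + k)) UNIV (tail e t)"
    by (auto simp: bij_betw_def inj_on_def tail_def image_def) (metis le_Suc_ex)
  have "(\<integral>\<^sup>+x\<in>tail e t. g x \<partial>\<mu>) = (\<integral>\<^sup>+x. ennreal (w x) * (g x * indicator (tail e t) x) \<partial>count_space X)"
    by (rule nn_integral_mu)
  also have "\<dots> = (\<integral>\<^sup>+x. ennreal (w x) * g x \<partial>count_space (tail e t))"
    using tail_subset[OF assms, of t]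
    by (subst (1 2) nn_integral_count_space_indicator) (auto intro!: nn_integral_cong split: split_indicator)
  also have "\<dots> = (\<integral>\<^sup>+k. ennreal (chain_w (t + k)) * g (Link e (t + k)) \<partial>count_space UNIV)"
    by (subst nn_integral_bij_count_space[OF bij, symmetric]) simp
  finally show ?thesis by (simp add: nn_integral_count_space_nat)
qed

lemma emeasure_tail: 
  assumes "h e" shows "emeasure \<mu> (tail e t) \<le> ennreal (2 * chain_w t)"
proof -
  have "emeasure \<mu> (tail e t) = (\<integral>\<^sup>+x\<in>tail e t. 1 \<partial>\<mu>)" using tail_subset[OF assms, of t] by simp
  also have "\<dots> = (\<Sum>k. ennreal (chain_w (t + k)))" unfolding nn_integral_tail[OF assms] by simp
  also have "\<dots> \<le> (\<Sum>k. ennreal ((1 / 2) ^ k * chain_w t))"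
    using chain_w_add by (intro suminf_le) (auto intro: ennreal_leI)
  also have "\<dots> = ennreal (\<Sum>k. (1 / 2) ^ k * chain_w t)"
    using chain_w_pos[of t] by (intro suminf_ennreal2 summable_mult2 summable_geometric) auto
  also have "(\<Sum>k. (1 / 2) ^ k * chain_w t) = 2 * chain_w t"
    by (subst suminf_mult2[symmetric]) (auto simp: suminf_geometric summable_geometric)
  finally show ?thesis .
qed

lemma mball_big: "x \<in> X \<Longrightarrow> 4 < r \<Longrightarrow> mball x r = X"
  using le_less_trans[OF d_le] by (auto simp: in_mball)

text \<open>A ball of radius 4 about hub n stays in star n and has mass at most 2^(-n), whereas
  radius 8 gives the whole space.\<close>

lemma not_doubling: "\<not> doubling X d \<mu>"
proof
  assume "doubling X d \<mu>"
  then obtain C where C: "\<And>x s. x \<in> X \<Longrightarrow> 0 < s \<Longrightarrow>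
      emeasure \<mu> (mball x (2 * s)) \<le> ennreal C * emeasure \<mu> (mball x s)"
    unfolding doubling_def by blast
  have "emeasure \<mu> X \<le> ennreal (\<bar>C\<bar> * (1 / 2) ^ n)" for n
  proof -
    have sub: "mball (Hub n) 4 \<subseteq> Y n"
    proof
      fix x assume "x \<in> mball (Hub n) 4"
      then show "x \<in> Y n" by (cases x) (auto simp: in_mball split: if_splits)
    qed
    have "emeasure \<mu> X = emeasure \<mu> (mball (Hub n) (2 * 4))" by (simp add: mball_big)
    also have "\<dots> \<le> ennreal C * emeasure \<mu> (mball (Hub n) 4)" by (rule C) auto
    also have "\<dots> \<le> ennreal \<bar>C\<bar> * emeasure \<mu> (Y n)"
      using sub Y_subset by (intro mult_mono emeasure_mono_mu ennreal_leI) auto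
    also have "emeasure \<mu> (Y n) \<le> ennreal ((1 / 2) ^ n)"
      using sum_w_Y_le[of n] Y_subset by (subst emeasure_finite_mu) (auto intro: ennreal_leI)
    finally show ?thesis by (simp add: ennreal_mult mult_left_mono)
  qed
  moreover have "(\<lambda>n. ennreal (\<bar>C\<bar> * (1 / 2) ^ n)) \<longlonglongrightarrow> ennreal (\<bar>C\<bar> * 0)"
    by (intro tendsto_intros LIMSEQ_power_zero) auto
  ultimately have "emeasure \<mu> X \<le> 0" using LIMSEQ_le_const by fastforce
  moreover have "0 < emeasure \<mu> X" by (rule emeasure_pos_mu[of "Hub 0"]) auto
  ultimately show False by simp
qed

end

section \<open>Pointwise upper bounds\<close>

lemma le_add_ennreal: "a \<le> b \<Longrightarrow> a \<le> b + (c :: ennreal)"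
  using add_increasing2[of c a b] by simp

context glued
begin

definition W :: real where "W = enn2real (emeasure \<mu> X)"

text \<open>The mass of hub and leaves without the spokes; by the case distinction in
  \<open>avg_le_leaf\<close>, a ball of radius at most 4 meeting two leaves of a star contains all
  these points.\<close>

definition b :: "nat \<Rightarrow> real" where "b n = c n * (1 + (\<Sum>i<N n. m n i))"

text \<open>At \<open>l = 0\<close> the truncated \<open>l - 1\<close> makes the top point of a chain its own predecessor.\<close>

definition kern :: "pt \<Rightarrow> pt \<Rightarrow> ennreal" where
  "kern x z = (case x of
     Hub n \<Rightarrow> ennreal (1 / c n) * indicator (Y n) z
   | Spoke n i \<Rightarrow> ennreal (1 / c n) * indicator (Y n) z
   | Leaf n i \<Rightarrow> ennreal (1 / b n) * indicator (Y n) z + ennreal (1 / w x) * indicator {Spoke n i} z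
   | Link e l \<Rightarrow> ennreal (1 / chain_w (l - 1)) * indicator (tail e 0) z
       + ennreal (1 / w x) * indicator {Link e (Suc l)} z)"

text \<open>Three sources: the value at x itself, the global average with denominator W, and the
  local averages recorded in row x of \<open>kern\<close>.\<close>

definition tame :: "real \<Rightarrow> (pt \<Rightarrow> real) \<Rightarrow> pt \<Rightarrow> ennreal" where
  "tame p f x = ennreal (\<bar>f x\<bar> powr p) + (\<integral>\<^sup>+z. (ennreal (1 / W) + kern x z) * ennreal (\<bar>f z\<bar> powr p) \<partial>\<mu>)"

text \<open>
  The only averages not dominated by the kernel: at a leaf, the mass of the core of its star
  divided by the weight of the leaf; at a chain point, averages over tails starting at or
  above it. For the noncentred operator all stars and chains contribute, for the centred one
  only those with \<open>q n = 4\<close> and \<open>lam e \<noteq> \<kappa>\<close>.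
\<close>

definition wild :: "nat set \<Rightarrow> bool set \<Rightarrow> (pt \<Rightarrow> real) \<Rightarrow> pt \<Rightarrow> ennreal" where
  "wild S E f x = (case x of
     Leaf n i \<Rightarrow> if n \<in> S then ennreal (1 / w x) * abs_on f (K n) else 0
   | Link e l \<Rightarrow> if e \<in> E then (SUP t\<in>{..l}. ennreal (1 / chain_w t) * abs_on f (tail e t)) else 0
   | _ \<Rightarrow> 0)"

lemma wild_Leaf:
  "wild S E f (Leaf n i) =
    (if n \<in> S then ennreal (1 / w (Leaf n i)) * abs_on f (K n) else 0)"
  by (simp add: wild_def)

lemma wild_Link:
  "wild S E f (Link e l) =
    (if e \<in> E then (SUP t\<in>{..l}. ennreal (1 / chain_w t) * abs_on f (tail e t)) else 0)"
  by (simp add: wild_def)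

lemma emeasure_X_eq: "emeasure \<mu> X = ennreal W" and W_pos: "0 < W"
  using emeasure_mu_less_top[of X] emeasure_pos_mu[of "Hub 0" X]
  by (auto simp: W_def enn2real_positive_iff)

lemma b_pos: "0 < b n"
  using c_pos[of n] sum_m_nonneg[of n] by (simp add: b_def add_pos_nonneg)

section \<open>Column sums of the kernel\<close>

lemma kern_column_Leafs:
  "(\<integral>\<^sup>+x. ennreal (1 / b n) * indicator (Leaf n ` {..<N n}) x \<partial>\<mu>) \<le> 1"
proof -
  have "(\<Sum>x\<in>Leaf n ` {..<N n}. w x) = c n * (\<Sum>i<N n. m n i)"
    by (subst sum.reindex) (auto simp: inj_on_def sum_distrib_left)
  also have "\<dots> \<le> b n" using c_pos[of n] by (simp add: b_def)
  finally have "ennreal (1 / b n) * emeasure \<mu> (Leaf n ` {..<N n}) \<le> ennreal (1 / b n) * ennreal (b n)"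
    by (subst emeasure_finite_mu) (auto intro!: mult_left_mono ennreal_leI)
  then show ?thesis using b_pos[of n]
    by (subst nn_integral_cmult_indicator) (auto simp flip: ennreal_mult)
qed

lemma kern_column_point:
  assumes "y \<in> X" shows "(\<integral>\<^sup>+x. ennreal (1 / w y) * indicator {y} x \<partial>\<mu>) = 1"
  using nn_integral_singleton_mu[OF assms, of "\<lambda>_. ennreal (1 / w y)"] w_pos[OF assms]
  by (simp flip: ennreal_mult)

lemma kern_column_K:
  "(\<integral>\<^sup>+x. ennreal (1 / c n) * indicator (K n) x \<partial>\<mu>) \<le> 2"
proof -
  have "ennreal (1 / c n) * emeasure \<mu> (K n) \<le> ennreal (1 / c n) * ennreal (2 * c n)"
    by (intro mult_left_mono emeasure_K) auto
  also have "\<dots> = 2" using c_pos[of n] by (simp flip: ennreal_mult)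
  finally show ?thesis using K_subset[of n] by (subst nn_integral_cmult_indicator) auto
qed

text \<open>The weight of point l is at most 2^(-l) times that of its predecessor, with ratio 1 at l
  = 0, so the series is dominated by a geometric one.\<close>

lemma kern_column_tail:
  assumes "h e"
  shows "(\<integral>\<^sup>+x\<in>tail e 0. (case x of Link e l \<Rightarrow> ennreal (1 / chain_w (l - 1)) | _ \<Rightarrow> 0) \<partial>\<mu>) \<le> 2"
proof -
  have "(\<integral>\<^sup>+x\<in>tail e 0. (case x of Link e l \<Rightarrow> ennreal (1 / chain_w (l - 1)) | _ \<Rightarrow> 0) \<partial>\<mu>)
      = (\<Sum>l. ennreal (chain_w l) * ennreal (1 / chain_w (l - 1)))"
    using nn_integral_tail[OF assms, of "\<lambda>x. case x of Link e l \<Rightarrow> ennreal (1 / chain_w (l - 1)) | _ \<Rightarrow> 0" 0] by simp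
  also have "\<dots> \<le> (\<Sum>l. ennreal ((1 / 2) ^ l))"
  proof (intro suminf_le)
    fix l
    have "chain_w l * (1 / chain_w (l - 1)) \<le> (1 / 2) ^ l"
    proof (cases l)
      case (Suc k)
      then show ?thesis using chain_w_Suc[of k] chain_w_pos[of k] by (simp add: divide_simps)
    qed (simp add: chain_w_def)
    then show "ennreal (chain_w l) * ennreal (1 / chain_w (l - 1)) \<le> ennreal ((1 / 2) ^ l)"
      using chain_w_pos[of l] chain_w_pos[of "l - 1"] by (simp add: ennreal_leI flip: ennreal_mult)
  qed auto
  also have "\<dots> = ennreal (\<Sum>l. (1 / 2) ^ l)"
    by (intro suminf_ennreal2 summable_geometric) auto
  also have "(\<Sum>l. (1 / 2 :: real) ^ l) = 2" by (simp add: suminf_geometric)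
  finally show ?thesis by simp
qed

text \<open>A point of star n is charged 1 / c n by the core, of mass at most 2 * c n, then 1 / b n
  by the leaves, of mass at most b n, and, if it is a spoke, once more by its leaf: 2 + 1 + 1. A
  chain point receives 2 through \<open>kern_column_tail\<close> and 1 from its predecessor.\<close>

lemma kern_column:
  assumes z: "z \<in> X"
  shows "(\<integral>\<^sup>+x. kern x z \<partial>\<mu>) \<le> 4"
proof (cases "\<exists>e j. z = Link e j")
  case True
  then obtain e j where zj: "z = Link e j" by blast
  with z have h: "h e" by simp
  \<comment> \<open>The second term of \<open>kern\<close> hits Link e j only from the row l = j -
    1. For j = 0 there is no such row, and the truncated index merely enlarges the right-hand
    side.\<close>
  have "kern x z \<le> (case x of Link e l \<Rightarrow> ennreal (1 / chain_w (l - 1)) | _ \<Rightarrow> 0) * indicator (tail e 0) x +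
     ennreal (1 / w (Link e (j - 1))) * indicator {Link e (j - 1)} x" for x
    by (cases x) (auto simp: kern_def zj split: split_indicator)
  then have "(\<integral>\<^sup>+x. kern x z \<partial>\<mu>) \<le>
    (\<integral>\<^sup>+x. (case x of Link e l \<Rightarrow> ennreal (1 / chain_w (l - 1)) | _ \<Rightarrow> 0) * indicator (tail e 0) x \<partial>\<mu>) +
    (\<integral>\<^sup>+x. ennreal (1 / w (Link e (j - 1))) * indicator {Link e (j - 1)} x \<partial>\<mu>)"
    by (subst nn_integral_add[symmetric]) (auto intro: nn_integral_mono)
  also have "\<dots> \<le> 2 + 1"
    using h by (intro add_mono kern_column_tail) (simp_all only: kern_column_point X_simps order_refl)
  finally show ?thesis by (rule order_trans) simp
next
  case False
  then obtain n where zn: "z \<in> Y n" "\<And>k. z \<in> Y k \<longleftrightarrow> k = n" using z by (cases z) auto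
  define i where "i = (case z of Spoke k j \<Rightarrow> j | _ \<Rightarrow> 0)"
  have i: "k = n \<and> j = i" if "z = Spoke k j" for k j
    using that zn by (auto simp: i_def)
  have iN: "i < N n" if "\<exists>j. z = Spoke n j"
    using that z by (auto simp: i_def)
  have Yz: "indicator (Y k) z = (if k = n then 1 else (0::ennreal))" for k
    using zn(2)[of k] by (simp add: indicator_def)
  let ?P = "if \<exists>j. z = Spoke n j then {Leaf n i} else {}"
  have "kern x z \<le> ennreal (1 / c n) * indicator (K n) x + ennreal (1 / b n) * indicator (Leaf n ` {..<N n}) x
      + ennreal (1 / w (Leaf n i)) * indicator ?P x" if "x \<in> X" for x
  proof (cases x)
    case (Leaf k j)
    show ?thesis
    proof (cases "z = Spoke k j")
      case True
      then have "k = n" "j = i" "?P = {Leaf n i}" using i by auto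
      then show ?thesis using that Leaf by (simp add: kern_def Yz True)
    next
      case False
      moreover have "k = n \<Longrightarrow> indicator (Leaf n ` {..<N n}) x = (1 :: ennreal)"
        using that Leaf by simp
      ultimately show ?thesis using Leaf by (simp add: kern_def Yz le_add_ennreal)
    qed
  qed (use that False in \<open>auto simp: kern_def Yz le_add_ennreal tail_def split: split_indicator\<close>)
  then have "(\<integral>\<^sup>+x. kern x z \<partial>\<mu>) \<le> (\<integral>\<^sup>+x. (ennreal (1 / c n) * indicator (K n) x + ennreal (1 / b n) * indicator (Leaf n ` {..<N n}) x
      + ennreal (1 / w (Leaf n i)) * indicator ?P x) \<partial>\<mu>)"
    by (intro nn_integral_mono) simp
  also have "\<dots> = (\<integral>\<^sup>+x. ennreal (1 / c n) * indicator (K n) x \<partial>\<mu>) +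
     (\<integral>\<^sup>+x. ennreal (1 / b n) * indicator (Leaf n ` {..<N n}) x \<partial>\<mu>)
      + (\<integral>\<^sup>+x. ennreal (1 / w (Leaf n i)) * indicator ?P x \<partial>\<mu>)"
    by (simp add: nn_integral_add)
  also have "\<dots> \<le> 2 + 1 + 1"
  proof (intro add_mono kern_column_K kern_column_Leafs)
    show "(\<integral>\<^sup>+x. ennreal (1 / w (Leaf n i)) * indicator ?P x \<partial>\<mu>) \<le> 1"
      using kern_column_point[of "Leaf n i"] iN by (cases "\<exists>j. z = Spoke n j") auto
  qed
  finally show ?thesis by simp
qed

text \<open>6 is 1 for the pointwise term, 1 for the global average and 4 from
  \<open>kern_column\<close>.\<close>

lemma nn_integral_tame:
  "(\<integral>\<^sup>+x. tame p f x \<partial>\<mu>) \<le> ennreal 6 * norm_pow p f"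
proof -
  let ?F = "\<lambda>x. ennreal (\<bar>f x\<bar> powr p)"
  have "(\<integral>\<^sup>+x. ennreal (1 / W) + kern x z \<partial>\<mu>) \<le> 1 + 4" if "z \<in> X" for z
  proof -
    have "(\<integral>\<^sup>+x. ennreal (1 / W) \<partial>\<mu>) = 1"
      using W_pos by (simp add: emeasure_X_eq flip: ennreal_mult)
    then show ?thesis
      using add_left_mono[OF kern_column[OF that], of 1] by (simp add: nn_integral_add del: nn_integral_const)
  qed
  then have "(\<integral>\<^sup>+x. tame p f x \<partial>\<mu>) \<le> (\<integral>\<^sup>+x. ?F x \<partial>\<mu>) + (1 + 4) * (\<integral>\<^sup>+x. ?F x \<partial>\<mu>)"
    unfolding tame_def by (subst nn_integral_add) (auto intro!: add_mono kernel_nn_integral_le)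
  also have "\<dots> = (1 + (1 + 4)) * (\<integral>\<^sup>+x. ?F x \<partial>\<mu>)" by (simp only: distrib_right mult_1)
  finally show ?thesis by simp
qed

lemma le_tame:
  assumes "\<And>z. a * indicator Z z \<le> ennreal (1 / W) + kern x z"
  shows "ennreal (\<bar>f x\<bar> powr p) + a * norm_pow_on p f Z \<le> tame p f x"
    "a * norm_pow_on p f Z \<le> tame p f x"
proof -
  have "a * norm_pow_on p f Z
      = (\<integral>\<^sup>+z. a * indicator Z z * ennreal (\<bar>f z\<bar> powr p) \<partial>\<mu>)"
    by (simp add: nn_integral_cmult[symmetric] mult_ac)
  also have "\<dots> \<le> (\<integral>\<^sup>+z. (ennreal (1 / W) + kern x z) * ennreal (\<bar>f z\<bar> powr p) \<partial>\<mu>)"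
    by (intro nn_integral_mono mult_right_mono assms) auto
  finally show 1: "ennreal (\<bar>f x\<bar> powr p) + a * norm_pow_on p f Z \<le> tame p f x"
    unfolding tame_def by (rule add_left_mono)
  show "a * norm_pow_on p f Z \<le> tame p f x"
    by (rule order_trans[OF _ 1]) simp
qed

lemma tame_ge_pointwise: "ennreal (\<bar>f x\<bar> powr p) \<le> tame p f x"
  by (simp add: tame_def)

text \<open>The interface for the pointwise estimates: exhibit points S of total weight at least v
  in the dilated ball, and a set Z around the ball such that the weight 1 / v on Z is paid for by
  \<open>tame\<close>.\<close>

lemma avg_le_tame:
  assumes "y \<in> X" "0 < r" "0 < v" "finite S" "S \<subseteq> mball y (\<kappa> * r)" "v \<le> (\<Sum>x\<in>S. w x)"
    "mball y r \<subseteq> Z" "0 < s" "1 \<le> p"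
    and *: "ennreal (1 / v) * norm_pow_on p f Z \<le> tame p f x"
  shows "avg \<kappa> f y r \<le> ennreal s + ennreal (s powr (1 - p)) * tame p f x"
proof -
  have "S \<subseteq> X" using assms(5) mball_subset by blast
  then have "ennreal v \<le> emeasure \<mu> S"
    using assms by (subst emeasure_finite_mu) (auto intro: ennreal_leI)
  also have "\<dots> \<le> emeasure \<mu> (mball y (\<kappa> * r))" by (intro emeasure_mono_mu assms mball_subset)
  finally have "avg \<kappa> f y r \<le> ennreal s +
      ennreal (s powr (1 - p)) * (ennreal (1 / v) * norm_pow_on p f Z)"
    using assms kappa by (intro avg_le_dual) auto
  also have "\<dots> \<le> ennreal s + ennreal (s powr (1 - p)) * tame p f x"
    by (intro add_left_mono mult_left_mono *) auto
  finally show ?thesis .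
qed

lemma mball_sub_kappa: "0 < r \<Longrightarrow> mball y r \<subseteq> mball y (\<kappa> * r)"
  using kappa by (intro mball_subset_concentric) simp

lemma avg_le_big:
  assumes "y \<in> X" "4 < r" "0 < s" "1 \<le> p"
  shows "avg \<kappa> f y r \<le> ennreal s + ennreal (s powr (1 - p)) * tame p f x"
proof -
  have "X \<subseteq> mball y (\<kappa> * r)" using mball_sub_kappa[of r y] mball_big[of y r] assms by simp
  then have "ennreal W \<le> emeasure \<mu> (mball y (\<kappa> * r))"
    unfolding emeasure_X_eq[symmetric] by (intro emeasure_mono_mu mball_subset)
  then have "avg \<kappa> f y r \<le> ennreal s +
      ennreal (s powr (1 - p)) * (ennreal (1 / W) * norm_pow_on p f X)"
    using assms W_pos kappa by (intro avg_le_dual mball_subset) auto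
  also have "\<dots> \<le> ennreal s + ennreal (s powr (1 - p)) * tame p f x"
    by (intro add_left_mono mult_left_mono le_tame) (auto split: split_indicator)
  finally show ?thesis .
qed

lemma small_ball_block:
  assumes "x \<in> mball y r" "r \<le> 4"
  shows "x \<in> Y n \<Longrightarrow> mball y r \<subseteq> Y n" "x \<in> Y n \<Longrightarrow> y \<in> Y n"
    "x = Link e l \<Longrightarrow> mball y r \<subseteq> tail e 0" "x = Link e l \<Longrightarrow> y \<in> tail e 0"
proof -
  have *: "z \<in> Y n" if "u \<in> Y n" "d u z < 4" "z \<in> X" for u z
    using that by (cases u; cases z) (auto split: if_splits)
  have **: "z \<in> tail e 0" if "u \<in> tail e 0" "d u z < 4" "z \<in> X" for u z
    using that by (cases u; cases z) (auto split: if_splits)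
  have y: "y \<in> X" "d y x < 4" and xX: "x \<in> X" using assms by auto
  then have xy: "d x y < 4" by (simp only: commute[of x y])
  have ball: "z \<in> X" "d y z < 4" if "z \<in> mball y r" for z using that assms(2) by auto
  show 1: "x \<in> Y n \<Longrightarrow> y \<in> Y n" by (rule *[OF _ xy y(1)])
  show "x \<in> Y n \<Longrightarrow> mball y r \<subseteq> Y n" using *[OF 1] ball by blast
  show 2: "x = Link e l \<Longrightarrow> y \<in> tail e 0" by (rule **[OF _ xy y(1)]) simp
  show "x = Link e l \<Longrightarrow> mball y r \<subseteq> tail e 0" using **[OF 2] ball by blast
qed

text \<open>A ball through a hub or spoke x, if it is neither the whole space nor just {x}, contains
  a point of weight at least c n: its centre, if that is a hub or a leaf, and otherwise the hub,
  since a ball about a spoke with a second point has radius above 1. Row x of \<open>kern\<close> is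
  made for this denominator.\<close>

lemma avg_le_core:
  assumes "x \<in> K n" "x \<in> mball y r" "y \<in> X" "0 < r" "0 < s" "1 \<le> p"
  shows "avg \<kappa> f y r \<le> ennreal s + ennreal (s powr (1 - p)) * tame p f x"
proof (cases "4 < r")
  case False
  then have r4: "r \<le> 4" by simp
  have x: "x \<in> X" "x \<in> Y n" using assms(1) K_subset K_subset_Y by auto
  note sub = mball_sub_kappa[OF assms(4), of y]
  note y = small_ball_block(2)[OF assms(2) r4 x(2)]
  show ?thesis
  proof (cases "mball y r = {x}")
    case True
    have "norm_pow_on p f {x} = ennreal (w x) * ennreal (\<bar>f x\<bar> powr p)"
      by (rule nn_integral_singleton_mu[OF x(1)])
    then have "ennreal (1 / w x) * norm_pow_on p f {x} = ennreal (\<bar>f x\<bar> powr p)"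
      using w_pos[OF x(1)] by (simp flip: ennreal_mult)
    then have "ennreal (1 / w x) * norm_pow_on p f {x} \<le> tame p f x"
      using tame_ge_pointwise[of f x p] by simp
    moreover have "{x} \<subseteq> mball y (\<kappa> * r)" using assms(2) sub by blast
    moreover have "w x \<le> sum w {x}" "mball y r \<subseteq> {x}" using True by simp_all
    ultimately show ?thesis
      using avg_le_tame[OF assms(3,4) w_pos[OF x(1)] finite.insertI[OF finite.emptyI] _ _ _ assms(5,6)] by blast
  next
    case False
    have "\<exists>z\<in>mball y r. c n \<le> w z"
    proof (cases "\<exists>i. y = Spoke n i")
      case True
      then obtain i where i: "y = Spoke n i" by blast
      have "1 < r"
      proof (rule ccontr)
        assume "\<not> 1 < r"
        then have "z = y" if "z \<in> mball y r" for z
          using that by (cases z) (auto simp: i split: if_splits)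
        then have "mball y r = {y}" using assms(3,4) by auto
        then have "mball y r = {x}" using assms(2) by auto
        with False show False by simp
      qed
      then show ?thesis using i assms(3) by (intro bexI[of _ "Hub n"]) auto
    next
      case no: False
      have "c n \<le> c n * m n i" if "i < N n" for i using m_ge_1[OF that] c_pos[of n] by simp
      then have "c n \<le> w y" using no y by (cases y) auto
      then show ?thesis using assms by (intro bexI[of _ y]) auto
    qed
    then obtain z where z: "z \<in> mball y r" "c n \<le> w z" by blast
    have "ennreal (1 / c n) * indicator (Y n) z \<le> ennreal (1 / W) + kern x z" for z
      using assms(1) by (cases x) (auto simp: kern_def add_increasing)
    then have "ennreal (1 / c n) * norm_pow_on p f (Y n) \<le> tame p f x"
      by (rule le_tame)
    moreover have "{z} \<subseteq> mball y (\<kappa> * r)" using z(1) sub by blast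
    moreover have "c n \<le> sum w {z}" using z(2) by simp
    ultimately show ?thesis
      using avg_le_tame[OF assms(3,4) c_pos finite.insertI[OF finite.emptyI] _ _
        small_ball_block(1)[OF assms(2) r4 x(2)] assms(5,6)] by blast
  qed
qed (use assms avg_le_big in auto)

lemma avg_le_all_leaves:
  assumes "x = Leaf n i" "x \<in> mball y r" "y \<in> X" "0 < r" "r \<le> 4" "0 < s" "1 \<le> p"
    "Hub n \<in> mball y r" "\<And>k. k < N n \<Longrightarrow> Leaf n k \<in> mball y r"
  shows "avg \<kappa> f y r \<le> ennreal s + ennreal (s powr (1 - p)) * tame p f x"
proof -
  let ?S = "insert (Hub n) (Leaf n ` {..<N n})"
  have xY: "x \<in> Y n" using assms(1,2) by auto
  have "(\<Sum>x\<in>?S. w x) = c n + (\<Sum>x\<in>Leaf n ` {..<N n}. w x)" by (subst sum.insert) auto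
  also have "(\<Sum>x\<in>Leaf n ` {..<N n}. w x) = c n * (\<Sum>i<N n. m n i)"
    by (subst sum.reindex) (auto simp: inj_on_def sum_distrib_left)
  finally have "b n \<le> (\<Sum>x\<in>?S. w x)" by (simp add: b_def distrib_left)
  moreover have "ennreal (1 / b n) * indicator (Y n) z \<le> ennreal (1 / W) + kern x z" for z
    using assms(1) by (auto simp: kern_def add_increasing add_increasing2)
  then have "ennreal (1 / b n) * norm_pow_on p f (Y n) \<le> tame p f x"
    by (rule le_tame)
  moreover have "?S \<subseteq> mball y r" using assms(8,9) by blast
  then have "?S \<subseteq> mball y (\<kappa> * r)" using mball_sub_kappa[OF assms(4), of y] by (rule order_trans)
  moreover have "finite ?S" by simp
  ultimately show ?thesis
    using avg_le_tame[OF assms(3,4) b_pos _ _ _ small_ball_block(1)[OF assms(2,5) xY] assms(6,7)]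
    by blast
qed

text \<open>If the ball meets a second leaf, its mass is at least b n. Otherwise it lies in the core
  together with x, and division by w x leaves |f x| and the \<open>wild\<close> term. The latter is
  not linearised here because weak type needs its level sets.\<close>

lemma avg_le_leaf:
  assumes x: "x = Leaf n i" "x \<in> mball y r" "y \<in> X" "0 < r" "0 < s" "1 \<le> p" "n \<in> S"
  shows "avg \<kappa> f y r \<le> ennreal s + ennreal (s powr (1 - p)) * tame p f x + wild S E f x"
proof -
  consider (big) "4 < r" | (two) j where "r \<le> 4" "Leaf n j \<in> mball y r" "i \<noteq> j"
    | (one) "r \<le> 4" "\<And>j. Leaf n j \<in> mball y r \<Longrightarrow> j = i" by force
  then show ?thesis
  proof cases
    case big
    show ?thesis by (rule le_add_ennreal) (rule avg_le_big[OF assms(3) big assms(5,6)])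
  next
    case two
    have xY: "x \<in> Y n" using assms(1,2) by auto
    \<comment> \<open>With the hub as centre, the radius exceeds 2. With a spoke as centre, at least
      one of the two leaves is not its own, and the radius exceeds 3. With a leaf as centre, the
      radius exceeds q n, hence also 2, the distance to the hub.\<close>
    have "Hub n \<in> mball y r \<and> (\<forall>k<N n. Leaf n k \<in> mball y r)"
      using two(2,3) x(1,2,3,4) q_bounds[of n] small_ball_block(2)[OF assms(2) two(1) xY]
      by (cases y) (auto split: if_splits)
    then have "avg \<kappa> f y r \<le> ennreal s + ennreal (s powr (1 - p)) * tame p f x"
      by (intro avg_le_all_leaves[OF assms(1-4) two(1) assms(5,6)]) auto
    then show ?thesis by (rule le_add_ennreal)
  next
    case one
    have xX: "x \<in> X" and xY: "x \<in> Y n" using assms(1,2) by auto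
    have sub: "mball y r \<subseteq> insert x (K n)"
    proof
      fix z assume z: "z \<in> mball y r"
      then have "z \<in> Y n" using small_ball_block(1)[OF assms(2) one(1) xY] by auto
      then show "z \<in> insert x (K n)" using one(2) z x(1) by (cases z) auto
    qed
    have wx: "0 < w x" using w_pos[OF xX] .
    have "ennreal (w x) \<le> emeasure \<mu> (mball y (\<kappa> * r))"
      unfolding emeasure_singleton_mu[OF xX, symmetric]
      using subsetD[OF mball_sub_kappa[OF assms(4)] assms(2)] by (intro emeasure_mono_mu mball_subset) simp
    then have "avg \<kappa> f y r \<le> ennreal (1 / w x) * abs_on f (insert x (K n))"
      using sub wx by (intro avg_le) auto
    also have "abs_on f (insert x (K n))
       = (\<integral>\<^sup>+z. ennreal \<bar>f z\<bar> * indicator {x} z + ennreal \<bar>f z\<bar> * indicator (K n) z \<partial>\<mu>)"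
      using x(1) by (intro nn_integral_cong) (auto split: split_indicator)
    also have "\<dots> = ennreal (w x) * ennreal \<bar>f x\<bar> + abs_on f (K n)"
      by (simp add: nn_integral_add nn_integral_singleton_mu[OF xX])
    also have "ennreal (1 / w x) * (ennreal (w x) * ennreal \<bar>f x\<bar> + abs_on f (K n))
        = ennreal (1 / w x * w x) * ennreal \<bar>f x\<bar> + ennreal (1 / w x) * abs_on f (K n)"
      using wx by (simp only: distrib_left mult.assoc ennreal_mult' divide_nonneg_pos zero_le_one)
    also have "\<dots> = ennreal \<bar>f x\<bar> + wild S E f x"
      using wx assms(7) by (simp add: x(1) wild_Leaf del: w_simps)
    finally have 1: "avg \<kappa> f y r \<le> ennreal \<bar>f x\<bar> + wild S E f x" .
    have "ennreal \<bar>f x\<bar> \<le> ennreal (s + s powr (1 - p) * \<bar>f x\<bar> powr p)"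
      using assms by (intro ennreal_leI le_add_powr_dual) auto
    also have "\<dots> = ennreal s + ennreal (s powr (1 - p)) * ennreal (\<bar>f x\<bar> powr p)"
      using assms by (simp add: ennreal_plus ennreal_mult)
    also have "\<dots> \<le> ennreal s + ennreal (s powr (1 - p)) * tame p f x"
      by (intro add_left_mono mult_left_mono tame_ge_pointwise) auto
    finally show ?thesis by (rule order_trans[OF 1 add_right_mono])
  qed
qed

text \<open>Let t be the least index in the ball. The ball lies in the tail from t, its dilate has
  mass at least chain_w t, and t \<le> l because x is in the ball.\<close>

lemma avg_le_link:
  assumes x: "x = Link e l" "x \<in> mball y r" "y \<in> X" "0 < r" "0 < s" "1 \<le> p" "e \<in> E"
  shows "avg \<kappa> f y r \<le> ennreal s + ennreal (s powr (1 - p)) * tame p f x + wild S E f x"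
proof (cases "4 < r")
  case True
  show ?thesis by (rule le_add_ennreal) (rule avg_le_big[OF assms(3) True assms(5,6)])
next
  case False
  define t where "t = (LEAST j. Link e j \<in> mball y r)"
  have t: "Link e t \<in> mball y r" "t \<le> l" "\<And>j. Link e j \<in> mball y r \<Longrightarrow> t \<le> j"
    unfolding t_def using x by (auto intro: LeastI Least_le)
  have tX: "Link e t \<in> X" using t(1) mball_subset by blast
  have sub: "mball y r \<subseteq> tail e t"
  proof
    fix z assume z: "z \<in> mball y r"
    then have "z \<in> tail e 0" using small_ball_block(3)[OF assms(2) _ x(1)] False by auto
    then show "z \<in> tail e t" using t(3) z by (cases z) auto
  qed
  have "ennreal (chain_w t) = emeasure \<mu> {Link e t}" using emeasure_singleton_mu[OF tX] by simp
  also have "\<dots> \<le> emeasure \<mu> (mball y (\<kappa> * r))"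
    using subsetD[OF mball_sub_kappa[OF assms(4)] t(1)] by (intro emeasure_mono_mu mball_subset) simp
  finally have "avg \<kappa> f y r \<le> ennreal (1 / chain_w t) * abs_on f (tail e t)"
    using sub chain_w_pos by (intro avg_le) auto
  also have "\<dots> \<le> wild S E f x"
    unfolding x(1) wild_Link using t(2) x(7) by (auto intro: SUP_upper)
  finally show ?thesis by (rule order_trans) simp
qed

lemma umax_le_wild:
  assumes "x \<in> X" "0 < s" "1 \<le> p"
  shows "umax X d \<mu> \<kappa> f x \<le> ennreal s + ennreal (s powr (1 - p)) * tame p f x + wild UNIV UNIV f x"
  unfolding umax_le_iff
proof (intro ballI allI impI)
  fix y r assume y: "y \<in> X" "0 < r" "x \<in> mball y r"
  show "avg \<kappa> f y r \<le> ennreal s + ennreal (s powr (1 - p)) * tame p f x + wild UNIV UNIV f x"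
  proof (cases x)
    case (Leaf n i)
    then show ?thesis using y assms by (intro avg_le_leaf) auto
  next
    case (Link e l)
    then show ?thesis using y assms by (intro avg_le_link) auto
  next
    case (Hub n)
    show ?thesis by (rule le_add_ennreal, rule avg_le_core[of x n]) (use Hub y assms in auto)
  next
    case (Spoke n i)
    show ?thesis by (rule le_add_ennreal, rule avg_le_core[of x n]) (use Spoke y assms in auto)
  qed
qed

text \<open>The dilated ball contains x, so w x serves as denominator. The value at x then costs |f
  x| powr p, and the value at y is covered by row x of \<open>kern\<close>.\<close>

lemma avg_le_pair:
  assumes x: "x \<in> X" "0 < r" "0 < s" "1 \<le> p" "x \<noteq> y" and sub: "mball x r \<subseteq> {x, y}"
    and kern: "\<And>z. ennreal (1 / w x) * indicator {y} z \<le> kern x z"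
  shows "avg \<kappa> f x r \<le> ennreal s + ennreal (s powr (1 - p)) * tame p f x"
proof -
  let ?F = "\<lambda>z. ennreal (\<bar>f z\<bar> powr p)"
  have wx: "0 < w x" using w_pos x(1) .
  have "ennreal (1 / w x) * indicator {y} z \<le> ennreal (1 / W) + kern x z" for z
    by (rule order_trans[OF kern]) simp
  then have "?F x + ennreal (1 / w x) * (\<integral>\<^sup>+z\<in>{y}. ?F z \<partial>\<mu>) \<le> tame p f x"
    by (rule le_tame)
  moreover have "(\<integral>\<^sup>+z\<in>{x, y}. ?F z \<partial>\<mu>) = (\<integral>\<^sup>+z. ?F z * indicator {x} z + ?F z * indicator {y} z \<partial>\<mu>)"
    using x(5) by (intro nn_integral_cong) (auto split: split_indicator)
  then have "(\<integral>\<^sup>+z\<in>{x, y}. ?F z \<partial>\<mu>) = ennreal (w x) * ?F x + (\<integral>\<^sup>+z\<in>{y}. ?F z \<partial>\<mu>)"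
    by (simp add: nn_integral_add nn_integral_singleton_mu[OF x(1)])
  then have "ennreal (1 / w x) * (\<integral>\<^sup>+z\<in>{x, y}. ?F z \<partial>\<mu>)
     = ennreal (1 / w x * w x) * ?F x + ennreal (1 / w x) * (\<integral>\<^sup>+z\<in>{y}. ?F z \<partial>\<mu>)"
    using wx by (simp only: distrib_left mult.assoc ennreal_mult' divide_nonneg_pos zero_le_one)
  then have "ennreal (1 / w x) * (\<integral>\<^sup>+z\<in>{x, y}. ?F z \<partial>\<mu>)
     = ?F x + ennreal (1 / w x) * (\<integral>\<^sup>+z\<in>{y}. ?F z \<partial>\<mu>)"
    using wx by simp
  ultimately have "ennreal (1 / w x) * (\<integral>\<^sup>+z\<in>{x, y}. ?F z \<partial>\<mu>) \<le> tame p f x" by simp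
  moreover have "{x} \<subseteq> mball x (\<kappa> * r)"
    using mball_sub_kappa[OF x(2), of x] centre_in_mball_iff[of x r] x by blast
  moreover have "w x \<le> sum w {x}" by simp
  ultimately show ?thesis
    using avg_le_tame[OF x(1,2) wx finite.insertI[OF finite.emptyI] _ _ sub x(3,4)] by blast
qed

text \<open>Leaf distance 2 removes the wild case: an open ball of radius at most 2 about a leaf
  contains only the leaf and its spoke, and once it reaches the hub it contains all leaves as
  well.\<close>

lemma avg_le_leaf_centred:
  assumes x: "x = Leaf n i" "x \<in> X" "q n = 2" "0 < r" "0 < s" "1 \<le> p"
  shows "avg \<kappa> f x r \<le> ennreal s + ennreal (s powr (1 - p)) * tame p f x"
proof -
  have xb: "x \<in> mball x r" using x(2,4) centre_in_mball_iff by blast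
  consider "4 < r" | "r \<le> 2" | "2 < r" "r \<le> 4" by linarith
  then show ?thesis
  proof cases
    case 1
    then show ?thesis by (intro avg_le_big x)
  next
    case 2
    have sub: "mball x r \<subseteq> {x, Spoke n i}"
    proof
      fix z assume z: "z \<in> mball x r"
      with 2 x show "z \<in> {x, Spoke n i}" by (cases z) (auto split: if_splits)
    qed
    show ?thesis by (rule avg_le_pair[OF x(2,4,5,6) _ sub]) (simp_all add: x(1) kern_def)
  next
    case 3
    have "Hub n \<in> mball x r" "k < N n \<Longrightarrow> Leaf n k \<in> mball x r" for k using x 3 by auto
    then show ?thesis by (intro avg_le_all_leaves[OF x(1) xb x(2,4) 3(2) x(5,6)])
  qed
qed

text \<open>If the dilated ball contains a point of index at most l - 1, its mass is at least
  chain_w (l - 1), the denominator in \<open>kern\<close>; for l = 0 that point is x itself.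
  Otherwise the ball has no point beyond the successor of x, since reaching one would, after
  dilation by \<kappa> = lam e, include the predecessor.\<close>

lemma avg_le_link_centred:
  assumes x: "x = Link e l" "x \<in> X" "lam e = \<kappa>" "0 < r" "0 < s" "1 \<le> p"
  shows "avg \<kappa> f x r \<le> ennreal s + ennreal (s powr (1 - p)) * tame p f x"
proof (cases "4 < r")
  case True
  then show ?thesis by (intro avg_le_big x)
next
  case False
  let ?F = "\<lambda>z. ennreal (\<bar>f z\<bar> powr p)"
  have he: "h e" using x by simp
  have xb: "x \<in> mball x r" using x(2,4) centre_in_mball_iff by blast
  note sub0 = small_ball_block(3)[OF xb _ x(1)] and subk = mball_sub_kappa[OF x(4), of x]
  show ?thesis
  proof (cases "\<exists>j\<le>l - 1. Link e j \<in> mball x (\<kappa> * r)")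
    case True
    then obtain j where j: "Link e j \<in> mball x (\<kappa> * r)" "chain_w (l - 1) \<le> chain_w j"
      using chain_w_antimono by blast
    have "ennreal (1 / chain_w (l - 1)) * indicator (tail e 0) z \<le> ennreal (1 / W) + kern x z" for z
      unfolding x(1) kern_def by (simp add: add_increasing add_increasing2)
    then have "ennreal (1 / chain_w (l - 1)) * (\<integral>\<^sup>+z\<in>tail e 0. ?F z \<partial>\<mu>) \<le> tame p f x"
      by (rule le_tame)
    moreover have "{Link e j} \<subseteq> mball x (\<kappa> * r)" using j by blast
    moreover have "chain_w (l - 1) \<le> sum w {Link e j}" using j by simp
    ultimately show ?thesis using False
      using avg_le_tame[OF x(2,4) chain_w_pos finite.insertI[OF finite.emptyI] _ _ sub0 x(5,6)]
      by (meson not_less)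
  next
    case no: False
    have "l \<noteq> 0" 
    proof
      assume "l = 0"
      then show False using no xb subk x(1) by fastforce
    qed
    have sub: "mball x r \<subseteq> {x, Link e (Suc l)}"
    proof
      fix z assume z: "z \<in> mball x r"
      then have "z \<in> tail e 0" using sub0 False by auto
      then obtain j where j: "z = Link e j" by (cases z) auto
      have ge: "\<not> j < l" using no subsetD[OF subk z] j by auto
      have "j \<noteq> Suc (l + k)" if "k \<ge> 1" for k
      proof
        assume jk: "j = Suc (l + k)"
        have l0: "0 < \<kappa>" using kappa by simp
        from z j x(1) jk that have "(1 + 1 / \<kappa>) * (1 / \<kappa>) ^ l < r"
          by (auto simp: chain_dist_def x(3))
        then have "\<kappa> * ((1 + 1 / \<kappa>) * (1 / \<kappa>) ^ l) < \<kappa> * r" using l0 by simp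
        moreover have "(1 / \<kappa>) ^ (l - 1) \<le> \<kappa> * ((1 + 1 / \<kappa>) * (1 / \<kappa>) ^ l)"
        proof -
          have "(1 / \<kappa>) ^ l = (1 / \<kappa>) * (1 / \<kappa>) ^ (l - 1)" using \<open>l \<noteq> 0\<close> by (cases l) auto
          then have "\<kappa> * ((1 + 1 / \<kappa>) * (1 / \<kappa>) ^ l) = (1 + 1 / \<kappa>) * (1 / \<kappa>) ^ (l - 1)" using l0 by simp
          also have "\<dots> \<ge> 1 * (1 / \<kappa>) ^ (l - 1)" using l0 by (intro mult_right_mono) auto
          finally show ?thesis by simp
        qed
        ultimately have "Link e (l - 1) \<in> mball x (\<kappa> * r)"
          using \<open>l \<noteq> 0\<close> x(1,2) by (auto simp: chain_dist_def x(3))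
        then show False using no by blast
      qed
      then have "\<not> (1 \<le> j - Suc l \<and> j = Suc (l + (j - Suc l)))" by blast
      then have "\<not> Suc l < j" by linarith
      with ge have "j = l \<or> j = Suc l" by linarith
      then show "z \<in> {x, Link e (Suc l)}" using j x(1) by auto
    qed
    show ?thesis by (rule avg_le_pair[OF x(2,4,5,6) _ sub]) (simp_all add: x(1) kern_def)
  qed
qed

lemma cmax_le_wild:
  assumes "x \<in> X" "0 < s" "1 \<le> p"
  shows "cmax X d \<mu> \<kappa> f x \<le>
    ennreal s + ennreal (s powr (1 - p)) * tame p f x + wild {n. q n = 4} {e. lam e \<noteq> \<kappa>} f x"
  unfolding cmax_le_iff
proof (intro allI impI)
  fix r :: real assume r: "0 < r"
  have xb: "x \<in> mball x r" using assms r by simp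
  show "avg \<kappa> f x r \<le>
    ennreal s + ennreal (s powr (1 - p)) * tame p f x + wild {n. q n = 4} {e. lam e \<noteq> \<kappa>} f x"
  proof (cases x)
    case (Leaf n i)
    show ?thesis
    proof (cases "q n = 4")
      case True
      then show ?thesis by (intro avg_le_leaf[OF Leaf xb assms(1) r assms(2,3)]) simp
    next
      case False
      then have "q n = 2" using q_cases by auto
      then show ?thesis by (intro le_add_ennreal avg_le_leaf_centred[OF Leaf assms(1) _ r assms(2,3)])
    qed
  next
    case (Link e l)
    show ?thesis
    proof (cases "lam e = \<kappa>")
      case False
      then show ?thesis by (intro avg_le_link[OF Link xb assms(1) r assms(2,3)]) simp
    next
      case True
      then show ?thesis by (rule le_add_ennreal[OF avg_le_link_centred[OF Link assms(1) _ r assms(2,3)]])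
    qed
  next
    case (Hub n)
    show ?thesis by (rule le_add_ennreal, rule avg_le_core[of x n]) (use Hub r assms in auto)
  next
    case (Spoke n i)
    show ?thesis by (rule le_add_ennreal, rule avg_le_core[of x n]) (use Spoke r assms in auto)
  qed
qed

end

section \<open>Norm estimates for the wild part\<close>

lemma ennreal_mult_add:
  assumes "0 \<le> a" "0 \<le> b" "0 \<le> c" "0 \<le> e"
  shows "ennreal a * (ennreal b * ennreal c + ennreal e * I) = ennreal (a * (b * c)) + ennreal (a * e) * I"
  using assms by (simp add: distrib_left ennreal_mult mult.assoc)

context glued
begin

text \<open>Obtained by inserting variable scales into \<open>le_add_powr_dual\<close>: s * m n i on
  a core, s * sqrt (chain_w t / chain_w j) at index j of the tail from t. A chain entry is the
  supremum of the resulting weights over t \<le> min j l. With a constant scale the entries for l <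
  j would be 1 / chain_w l, and these rows would add up to j in column j, which is the failure at p
  = 1.\<close>

definition wild_kern :: "real \<Rightarrow> nat set \<Rightarrow> bool set \<Rightarrow> pt \<Rightarrow> pt \<Rightarrow> ennreal" where
  "wild_kern p S E x z = (case x of
     Leaf n i \<Rightarrow> if n \<in> S then ennreal (m n i powr (1 - p) / w x) * indicator (K n) z else 0
   | Link e l \<Rightarrow> if e \<in> E then
       (case z of Link e' j \<Rightarrow> if e' \<noteq> e then 0 else if j \<le> l then ennreal (1 / chain_w j)
          else ennreal ((chain_w j / chain_w l) powr ((p - 1) / 2) / chain_w l)
        | _ \<Rightarrow> 0) else 0
   | _ \<Rightarrow> 0)"

abbreviation wild_avg :: "real \<Rightarrow> nat set \<Rightarrow> bool set \<Rightarrow> (pt \<Rightarrow> real) \<Rightarrow> pt \<Rightarrow> ennreal" where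
  "wild_avg p S E f x \<equiv> \<integral>\<^sup>+z. wild_kern p S E x z * ennreal (\<bar>f z\<bar> powr p) \<partial>\<mu>"

text \<open>With scale s * m n i the first term is 2 * s, because a core of mass at most 2 * c n is
  divided by c n * m n i. The second acquires the factor m n i powr (1 - p), the source of the
  strong condition.\<close>

lemma wild_leaf_dual:
  assumes "Leaf n i \<in> X" "0 < s" "1 \<le> p"
  shows "wild S E f (Leaf n i) \<le> ennreal (2 * s) +
    ennreal (s powr (1 - p)) * wild_avg p S E f (Leaf n i)"
proof (cases "n \<in> S")
  case True
  let ?I = "\<integral>\<^sup>+z\<in>K n. ennreal (\<bar>f z\<bar> powr p) \<partial>\<mu>"
  have m: "1 \<le> m n i" using assms m_ge_1 by simp
  then have sm: "0 < s * m n i" using assms by simp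
  have "abs_on f (K n) \<le>
      ennreal (s * m n i) * emeasure \<mu> (K n \<inter> X) + ennreal ((s * m n i) powr (1 - p)) * ?I"
    by (rule nn_integral_ball_dual[OF sm assms(3)])
  also have "\<dots> \<le> ennreal (s * m n i) * ennreal (2 * c n) + ennreal ((s * m n i) powr (1 - p)) * ?I"
    using emeasure_K[of n] K_subset[of n] by (intro add_right_mono mult_left_mono) (auto simp: Int_absorb2)
  finally have "wild S E f (Leaf n i) \<le> ennreal (1 / (c n * m n i)) *
      (ennreal (s * m n i) * ennreal (2 * c n) + ennreal ((s * m n i) powr (1 - p)) * ?I)"
    using True by (simp add: wild_Leaf mult_left_mono)
  also have "\<dots> = ennreal (1 / (c n * m n i) * (s * m n i * (2 * c n)))
      + ennreal (1 / (c n * m n i) * (s * m n i) powr (1 - p)) * ?I"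
    using sm m c_pos[of n] assms by (intro ennreal_mult_add) auto
  also have "1 / (c n * m n i) * (s * m n i * (2 * c n)) = 2 * s"
    using m c_pos[of n] by simp
  also have "1 / (c n * m n i) * (s * m n i) powr (1 - p) = s powr (1 - p) * (m n i powr (1 - p) / w (Leaf n i))"
    using m assms by (simp add: powr_mult)
  also have "ennreal (s powr (1 - p) * (m n i powr (1 - p) / w (Leaf n i))) * ?I =
      ennreal (s powr (1 - p)) * (ennreal (m n i powr (1 - p) / w (Leaf n i)) * ?I)"
    using w_pos[OF assms(1)] by (simp add: mult.assoc[symmetric] flip: ennreal_mult del: w_simps)
  also have "ennreal (m n i powr (1 - p) / w (Leaf n i)) * ?I
      = wild_avg p S E f (Leaf n i)"
    using True by (simp add: wild_kern_def nn_integral_cmult[symmetric] mult_ac)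
  finally show ?thesis .
qed (simp add: wild_Leaf)

text \<open>The scale grows along the tail like the inverse square root of the weight. Its integral
  over the tail divided by chain_w t is still at most 4, while u powr (1 - p) yields the decay that
  makes the columns summable for p > 1.\<close>

lemma wild_link_dual:
  assumes "h e" "0 < s" "1 < p"
  shows "wild S E f (Link e l) \<le> ennreal (4 * s) +
    ennreal (s powr (1 - p)) * wild_avg p S E f (Link e l)"
proof (cases "e \<in> E")
  case True
  have "ennreal (1 / chain_w t) * abs_on f (tail e t) \<le> ennreal (4 * s) +
    ennreal (s powr (1 - p)) * wild_avg p S E f (Link e l)"
    if "t \<le> l" for t
  proof -
    define u where "u z = (case z of Link e' j \<Rightarrow> sqrt (chain_w t / chain_w j) | _ \<Rightarrow> 1)" for z
    have u: "0 < u z" for z using chain_w_pos by (auto simp: u_def split: pt.split)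
    have "ennreal (1 / chain_w t) * (\<integral>\<^sup>+z\<in>tail e t. ennreal (u z) \<partial>\<mu>)
       = ennreal (1 / chain_w t) * (\<Sum>k. ennreal (chain_w (t + k)) * ennreal (sqrt (chain_w t / chain_w (t + k))))"
      by (simp add: nn_integral_tail[OF assms(1)] u_def)
    also have "\<dots> = (\<Sum>k. ennreal (1 / chain_w t) * (ennreal (chain_w (t + k)) * ennreal (sqrt (chain_w t / chain_w (t + k)))))"
      by simp
    \<comment> \<open>3 / 4 is a rational number above sqrt (1 / 2); the sum of its powers is the
      constant 4 of the statement.\<close>
    also have "\<dots> \<le> (\<Sum>k. ennreal ((3 / 4) ^ k))"
    proof (intro suminf_le)
      fix k
      define a where "a = chain_w t" 
      define b' where "b' = chain_w (t + k)"
      have ab: "0 < a" "0 < b'" "b' \<le> (1 / 2) ^ k * a"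
        using chain_w_pos chain_w_add[of t k] by (simp_all add: a_def b'_def)
      have "1 / a * (b' * sqrt (a / b')) = sqrt (b' / a)"
        using ab by (simp add: real_sqrt_divide field_simps)
      also have "\<dots> \<le> sqrt ((1 / 2) ^ k)" using ab by (intro real_sqrt_le_mono) (simp add: divide_simps mult.commute)
      also have "\<dots> \<le> sqrt (((3 / 4) ^ k)\<^sup>2)"
        by (intro real_sqrt_le_mono) (simp add: power2_eq_square power_mono flip: power_mult_distrib)
      also have "\<dots> = (3 / 4) ^ k" by simp
      finally show "ennreal (1 / chain_w t) * (ennreal (chain_w (t + k)) * ennreal (sqrt (chain_w t / chain_w (t + k))))
          \<le> ennreal ((3 / 4) ^ k)"
        using ab by (simp add: a_def b'_def ennreal_leI flip: ennreal_mult)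
    qed auto
    also have "\<dots> = ennreal (\<Sum>k. (3 / 4) ^ k)" by (intro suminf_ennreal2 summable_geometric) auto
    also have "(\<Sum>k. (3 / 4 :: real) ^ k) = 4" by (simp add: suminf_geometric)
    finally have U: "ennreal (1 / chain_w t) * (\<integral>\<^sup>+z\<in>tail e t. ennreal (u z) \<partial>\<mu>) \<le> ennreal 4" .
    have ker: "ennreal (1 / chain_w t) * (ennreal (u z powr (1 - p)) * indicator (tail e t) z) \<le> wild_kern p S E (Link e l) z" for z
    proof (cases "z \<in> tail e t")
      case zt: True
      then obtain j where j: "z = Link e j" "t \<le> j" by (auto simp: tail_def)
      define \<alpha> where "\<alpha> = (p - 1) / 2"
      have \<alpha>: "0 < \<alpha>" using assms by (simp add: \<alpha>_def)
      have pos: "0 < chain_w t" "0 < chain_w j" "0 < chain_w l" using chain_w_pos by auto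
      have "u z powr (1 - p) = ((chain_w t / chain_w j) powr (1 / 2)) powr (1 - p)"
        using pos by (simp add: u_def j powr_half_sqrt)
      also have "\<dots> = (chain_w t / chain_w j) powr (- \<alpha>)"
        by (simp only: powr_powr) (simp add: \<alpha>_def diff_divide_distrib)
      also have "\<dots> = (chain_w j / chain_w t) powr \<alpha>"
        using pos by (simp add: powr_minus powr_divide)
      finally have uz: "u z powr (1 - p) = (chain_w j / chain_w t) powr \<alpha>" .
      show ?thesis
      \<comment> \<open>The weight increases with t, and t \<le> min j l. So the bound is its value
        at t = j or at t = l, the two entries of \<open>wild_kern\<close>.\<close>
      proof (cases "j \<le> l")
        case True
        have "(chain_w j / chain_w t) powr \<alpha> \<le> 1"
          using pos chain_w_antimono[OF j(2)] \<alpha> by (intro powr_le1) auto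
        moreover have "1 / chain_w t \<le> 1 / chain_w j"
          using pos chain_w_antimono[OF j(2)] by (simp add: divide_simps)
        ultimately have "1 / chain_w t * (chain_w j / chain_w t) powr \<alpha> \<le> 1 / chain_w j * 1"
          using pos by (intro mult_mono) auto
        then show ?thesis using zt True \<open>e \<in> E\<close> pos
          by (simp add: wild_kern_def j uz[unfolded j(1)] ennreal_leI flip: ennreal_mult)
      next
        case False
        have le: "1 / chain_w t \<le> 1 / chain_w l" "chain_w j / chain_w t \<le> chain_w j / chain_w l"
          using pos chain_w_antimono[OF \<open>t \<le> l\<close>] by (simp_all add: divide_simps)
        then have "1 / chain_w t * (chain_w j / chain_w t) powr \<alpha> \<le> 1 / chain_w l * (chain_w j / chain_w l) powr \<alpha>"
          using pos \<alpha> by (intro mult_mono powr_mono2) auto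
        then show ?thesis using zt False \<open>e \<in> E\<close> pos
          by (simp add: wild_kern_def j uz[unfolded j(1)] ennreal_leI \<alpha>_def flip: ennreal_mult)
      qed
    qed simp
    have "ennreal (1 / chain_w t) * abs_on f (tail e t)
      \<le> ennreal (1 / chain_w t) * (\<integral>\<^sup>+z. ennreal s * (ennreal (u z) * indicator (tail e t) z) +
          ennreal (s powr (1 - p)) * ((ennreal (u z powr (1 - p)) * indicator (tail e t) z) * ennreal (\<bar>f z\<bar> powr p)) \<partial>\<mu>)"
    proof (intro mult_left_mono nn_integral_mono)
      fix z
      have "\<bar>f z\<bar> \<le> s * u z + (s * u z) powr (1 - p) * \<bar>f z\<bar> powr p"
        using u[of z] assms by (intro le_add_powr_dual) auto
      then show "ennreal \<bar>f z\<bar> * indicator (tail e t) z \<le> ennreal s * (ennreal (u z) * indicator (tail e t) z) +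
          ennreal (s powr (1 - p)) * ((ennreal (u z powr (1 - p)) * indicator (tail e t) z) * ennreal (\<bar>f z\<bar> powr p))"
        using u[of z] assms by (auto simp: powr_mult ennreal_leI less_imp_le mult.assoc split: split_indicator
            simp flip: ennreal_mult ennreal_plus)
    qed auto
    also have "\<dots> = ennreal s * (ennreal (1 / chain_w t) * (\<integral>\<^sup>+z\<in>tail e t. ennreal (u z) \<partial>\<mu>)) +
       ennreal (s powr (1 - p)) * (\<integral>\<^sup>+z. ennreal (1 / chain_w t) * (ennreal (u z powr (1 - p)) * indicator (tail e t) z) * ennreal (\<bar>f z\<bar> powr p) \<partial>\<mu>)"
    proof -
      have lin: "a * (\<integral>\<^sup>+z. b * A z + c' * (B z * F z) \<partial>\<mu>)
          = b * (a * (\<integral>\<^sup>+z. A z \<partial>\<mu>)) + c' * (\<integral>\<^sup>+z. a * B z * F z \<partial>\<mu>)" for a b c' A B F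
        by (simp add: nn_integral_add nn_integral_cmult distrib_left mult.assoc)
          (simp add: mult.left_commute)
      show ?thesis by (rule lin)
    qed
    also have "\<dots> \<le> ennreal s * ennreal 4 +
       ennreal (s powr (1 - p)) * wild_avg p S E f (Link e l)"
      by (intro add_mono mult_left_mono U nn_integral_mono mult_right_mono ker) auto
    also have "ennreal s * ennreal 4 = ennreal (4 * s)" using assms(2) by (simp add: ennreal_mult mult.commute)
    finally show ?thesis .
  qed
  then show ?thesis using True by (auto simp: wild_Link intro!: SUP_least)
qed (simp add: wild_Link)

text \<open>Only the leaves of star n see z, and their weights cancel against the denominators,
  leaving the sum of m n i powr (1 - p).\<close>

lemma wild_kern_column_K:
  assumes z: "z \<in> K n" and C: "n \<in> S \<Longrightarrow> (\<Sum>i<N n. m n i powr (1 - p)) \<le> C" "0 \<le> C"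
  shows "(\<integral>\<^sup>+x. wild_kern p S E x z \<partial>\<mu>) \<le> ennreal C"
proof (cases "n \<in> S")
  case True
  have Kz: "indicator (K k) z = (if k = n then 1 else (0 :: ennreal))" for k using z by (cases z) (auto split: split_indicator)
  have zl: "z \<noteq> Link e l" for e l using z by auto
  have "wild_kern p S E x z \<le> (\<Sum>i<N n. ennreal (m n i powr (1 - p) / w (Leaf n i)) * indicator {Leaf n i} x)"
    if "x \<in> X" for x
  proof (cases "\<exists>i<N n. x = Leaf n i")
    case True
    then obtain i where i: "i < N n" "x = Leaf n i" by blast
    have "wild_kern p S E x z \<le> ennreal (m n i powr (1 - p) / w (Leaf n i)) * indicator {Leaf n i} x"
      using i z by (simp add: wild_kern_def)
    also have "\<dots> \<le> (\<Sum>i<N n. ennreal (m n i powr (1 - p) / w (Leaf n i)) * indicator {Leaf n i} x)"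
      using i by (intro member_le_sum) auto
    finally show ?thesis .
  next
    case False
    then have "wild_kern p S E x z = 0"
      using that by (cases x) (auto simp: wild_kern_def Kz zl split: pt.split)
    then show ?thesis by simp
  qed
  then have "(\<integral>\<^sup>+x. wild_kern p S E x z \<partial>\<mu>)
     \<le> (\<integral>\<^sup>+x. (\<Sum>i<N n. ennreal (m n i powr (1 - p) / w (Leaf n i)) * indicator {Leaf n i} x) \<partial>\<mu>)"
    by (intro nn_integral_mono) simp
  also have "\<dots> = (\<Sum>i<N n. \<integral>\<^sup>+x. ennreal (m n i powr (1 - p) / w (Leaf n i)) * indicator {Leaf n i} x \<partial>\<mu>)"
    by (rule nn_integral_sum) auto
  also have "\<dots> = (\<Sum>i<N n. ennreal (w (Leaf n i)) * ennreal (m n i powr (1 - p) / w (Leaf n i)))"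
  proof (intro sum.cong refl)
    fix i assume "i \<in> {..<N n}"
    then show "(\<integral>\<^sup>+x. ennreal (m n i powr (1 - p) / w (Leaf n i)) * indicator {Leaf n i} x \<partial>\<mu>)
        = ennreal (w (Leaf n i)) * ennreal (m n i powr (1 - p) / w (Leaf n i))"
      using nn_integral_singleton_mu[of "Leaf n i" "\<lambda>_. ennreal (m n i powr (1 - p) / w (Leaf n i))"] by simp
  qed
  also have "\<dots> = (\<Sum>i<N n. ennreal (m n i powr (1 - p)))"
  proof (intro sum.cong refl)
    fix i assume "i \<in> {..<N n}"
    then have "0 < w (Leaf n i)" by (intro w_pos) simp
    then show "ennreal (w (Leaf n i)) * ennreal (m n i powr (1 - p) / w (Leaf n i)) = ennreal (m n i powr (1 - p))"
      by (simp flip: ennreal_mult del: w_simps)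
  qed
  also have "\<dots> \<le> ennreal C" using C(1)[OF True] by (simp add: ennreal_leI)
  finally show ?thesis .
next
  case False
  have Kz: "indicator (K k) z = (if k = n then 1 else (0 :: ennreal))" for k using z by (cases z) (auto split: split_indicator)
  have zl: "z \<noteq> Link e l" for e l using z by auto
  have "wild_kern p S E x z = 0" for x
    using False by (cases x) (auto simp: wild_kern_def Kz zl split: pt.split)
  then show ?thesis by simp
qed

text \<open>The rows l \<ge> j form the tail from j, of mass at most 2 * chain_w j. The rows l < j
  are dominated by a geometric series whose ratio \<rho> is below 1 because p > 1.\<close>

lemma wild_kern_column_Link:
  assumes "h e" "1 < p" and z: "z = Link e j"
  shows "(\<integral>\<^sup>+x. wild_kern p S E x z \<partial>\<mu>) \<le> ennreal (2 + 1 / (1 - (1 / 2) powr ((p - 1) / 2)))"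
proof -
  define \<alpha> where "\<alpha> = (p - 1) / 2"
  define \<rho> :: real where "\<rho> = (1 / 2) powr \<alpha>"
  have \<alpha>: "0 < \<alpha>" using assms by (simp add: \<alpha>_def)
  have \<rho>: "0 < \<rho>" "\<rho> < 1" using powr_less_mono2[OF \<alpha>, of "1/2" 1] by (simp_all add: \<rho>_def)
  let ?g = "\<lambda>l. ennreal ((chain_w j / chain_w l) powr \<alpha> / chain_w l)"
  have "wild_kern p S E x z \<le> ennreal (1 / chain_w j) * indicator (tail e j) x + (\<Sum>l<j. ?g l * indicator {Link e l} x)"
    if "x \<in> X" for x
  proof (cases "\<exists>l<j. x = Link e l")
    case True
    then obtain l where l: "l < j" "x = Link e l" by blast
    have "wild_kern p S E x z \<le> ?g l * indicator {Link e l} x"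
      using l by (simp add: wild_kern_def z \<alpha>_def)
    also have "\<dots> \<le> (\<Sum>l<j. ?g l * indicator {Link e l} x)"
      using l by (intro member_le_sum) auto
    finally show ?thesis by (intro add_increasing) auto
  next
    case False
    then have "wild_kern p S E x z \<le> ennreal (1 / chain_w j) * indicator (tail e j) x"
      by (cases x) (auto simp: wild_kern_def z not_less)
    then show ?thesis by (rule le_add_ennreal)
  qed
  then have "(\<integral>\<^sup>+x. wild_kern p S E x z \<partial>\<mu>)
     \<le> (\<integral>\<^sup>+x. ennreal (1 / chain_w j) * indicator (tail e j) x + (\<Sum>l<j. ?g l * indicator {Link e l} x) \<partial>\<mu>)"
    by (intro nn_integral_mono) simp
  also have "\<dots> = (\<integral>\<^sup>+x. ennreal (1 / chain_w j) * indicator (tail e j) x \<partial>\<mu>)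
      + (\<integral>\<^sup>+x. (\<Sum>l<j. ?g l * indicator {Link e l} x) \<partial>\<mu>)"
    by (rule nn_integral_add) auto
  also have "(\<integral>\<^sup>+x. ennreal (1 / chain_w j) * indicator (tail e j) x \<partial>\<mu>)
      = ennreal (1 / chain_w j) * emeasure \<mu> (tail e j)"
    using tail_subset[OF assms(1)] by (intro nn_integral_cmult_indicator) auto
  also have "(\<integral>\<^sup>+x. (\<Sum>l<j. ?g l * indicator {Link e l} x) \<partial>\<mu>)
      = (\<Sum>l<j. \<integral>\<^sup>+x. ?g l * indicator {Link e l} x \<partial>\<mu>)"
    by (rule nn_integral_sum) auto
  also have "\<dots> = (\<Sum>l<j. ennreal (chain_w l) * ?g l)"
  proof (intro sum.cong refl)
    fix l
    show "(\<integral>\<^sup>+x. ?g l * indicator {Link e l} x \<partial>\<mu>) = ennreal (chain_w l) * ?g l"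
      using nn_integral_singleton_mu[of "Link e l" "\<lambda>_. ?g l"] assms(1) by simp
  qed
  also have "ennreal (1 / chain_w j) * emeasure \<mu> (tail e j) + (\<Sum>l<j. ennreal (chain_w l) * ?g l)
      \<le> ennreal 2 + ennreal (1 / (1 - \<rho>))"
  proof (intro add_mono)
    have "ennreal (1 / chain_w j) * emeasure \<mu> (tail e j) \<le> ennreal (1 / chain_w j) * ennreal (2 * chain_w j)"
      by (intro mult_left_mono emeasure_tail assms(1)) auto
    then show "ennreal (1 / chain_w j) * emeasure \<mu> (tail e j) \<le> ennreal 2"
      using chain_w_pos[of j] by (simp flip: ennreal_mult)
    have "(\<Sum>l<j. ennreal (chain_w l) * ?g l) \<le> (\<Sum>l<j. ennreal (\<rho> ^ (j - l)))"
    proof (intro sum_mono)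
      fix l assume "l \<in> {..<j}"
      then have "chain_w j \<le> (1 / 2) ^ (j - l) * chain_w l" using chain_w_add[of l "j - l"] by simp
      then have "chain_w j / chain_w l \<le> (1 / 2) ^ (j - l)" using chain_w_pos[of l] by (simp add: divide_simps mult.commute)
      then have "(chain_w j / chain_w l) powr \<alpha> \<le> ((1 / 2) ^ (j - l)) powr \<alpha>"
        using \<alpha> chain_w_pos by (intro powr_mono2) (auto intro: less_imp_le)
      also have "\<dots> = \<rho> ^ (j - l)"
        by (simp add: \<rho>_def powr_powr powr_realpow[symmetric] mult.commute del: powr_realpow)
      finally show "ennreal (chain_w l) * ?g l \<le> ennreal (\<rho> ^ (j - l))"
        using chain_w_pos[of l] by (simp add: ennreal_leI flip: ennreal_mult)
    qed
    also have "\<dots> = ennreal (\<Sum>l<j. \<rho> ^ (j - l))" using \<rho> by simp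
    also have "(\<Sum>l<j. \<rho> ^ (j - l)) = (\<Sum>l<j. \<rho> ^ Suc l)"
      by (rule sum.reindex_bij_witness[of _ "\<lambda>l. j - Suc l" "\<lambda>l. j - Suc l"]) (auto simp: Suc_diff_Suc simp flip: power_Suc)
    also have "\<dots> \<le> (\<Sum>l. \<rho> ^ Suc l)"
      using \<rho> by (intro sum_le_suminf) (auto intro!: summable_mult summable_geometric)
    also have "\<dots> = \<rho> * (1 / (1 - \<rho>))"
      using \<rho> by (simp add: suminf_mult summable_geometric suminf_geometric)
    also have "\<dots> \<le> 1 / (1 - \<rho>)" using \<rho> by (simp add: divide_right_mono)
    finally show "(\<Sum>l<j. ennreal (chain_w l) * ?g l) \<le> ennreal (1 / (1 - \<rho>))"
      by (simp add: ennreal_leI)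
  qed
  also have "\<dots> = ennreal (2 + 1 / (1 - \<rho>))" using \<rho> by (simp add: ennreal_plus)
  finally show ?thesis by (simp add: \<rho>_def \<alpha>_def)
qed

lemma nn_integral_wild_kern:
  assumes "\<And>n. n \<in> S \<Longrightarrow> (\<Sum>i<N n. m n i powr (1 - p)) \<le> C" "0 \<le> C"
    and chain: "1 < p \<or> (\<forall>e\<in>E. \<not> h e)"
  shows "\<exists>D>0. \<forall>f. (\<integral>\<^sup>+x. wild_avg p S E f x \<partial>\<mu>)
    \<le> ennreal D * norm_pow p f"
proof -
  define D' where "D' = 2 + 1 / (1 - (1 / 2) powr ((p - 1) / 2))"
  \<comment> \<open>C + 1 rather than C makes D positive whatever the value of D'.\<close>
  define D where "D = max D' (C + 1)"
  have "(\<integral>\<^sup>+x. wild_kern p S E x z \<partial>\<mu>) \<le> ennreal D" if z: "z \<in> X" for z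
  proof -
    have core: ?thesis if "z \<in> K n" for n
    proof -
      have "(\<integral>\<^sup>+x. wild_kern p S E x z \<partial>\<mu>) \<le> ennreal C"
        by (rule wild_kern_column_K[OF that]) (use assms in auto)
      also have "\<dots> \<le> ennreal D" by (intro ennreal_leI) (simp add: D_def)
      finally show ?thesis .
    qed
    show ?thesis
    proof (cases z)
      case (Hub n) then show ?thesis by (intro core) simp
    next
      case (Spoke n i) with z show ?thesis by (intro core[of n]) simp
    next
      case (Leaf n i)
      then have "wild_kern p S E x z = 0" for x by (cases x) (auto simp: wild_kern_def)
      then show ?thesis by simp
    next
      case (Link e j)
      show ?thesis
      proof (cases "1 < p")
        case True
        then have "(\<integral>\<^sup>+x. wild_kern p S E x z \<partial>\<mu>) \<le> ennreal D'"
          unfolding D'_def using Link z by (intro wild_kern_column_Link) auto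
        also have "\<dots> \<le> ennreal D" by (intro ennreal_leI) (simp add: D_def)
        finally show ?thesis .
      next
        case False
        then have "e \<notin> E" using chain Link z by auto
        then have "wild_kern p S E x z = 0" for x using Link by (cases x) (auto simp: wild_kern_def)
        then show ?thesis by simp
      qed
    qed
  qed
  moreover have "0 < D" using assms(2) by (simp add: D_def less_max_iff_disj)
  ultimately show ?thesis by (intro exI[of _ D] conjI allI kernel_nn_integral_le)
qed

lemma wild_dual:
  assumes "x \<in> X" "0 < s" "1 \<le> p" and chain: "1 < p \<or> (\<forall>e\<in>E. \<not> h e)"
  shows "wild S E f x \<le> ennreal (4 * s) +
    ennreal (s powr (1 - p)) * wild_avg p S E f x"
proof (cases x)
  case (Leaf n i)
  have "wild S E f x \<le> ennreal (2 * s) +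
      ennreal (s powr (1 - p)) * wild_avg p S E f x"
    unfolding Leaf by (rule wild_leaf_dual) (use assms Leaf in auto)
  also have "\<dots> \<le> ennreal (4 * s) +
      ennreal (s powr (1 - p)) * wild_avg p S E f x"
    using assms by (intro add_right_mono ennreal_leI) simp
  finally show ?thesis .
next
  case (Link e l)
  show ?thesis
  proof (cases "e \<in> E")
    case True
    then have "1 < p" "h e" using chain Link assms by auto
    then show ?thesis unfolding Link using assms by (intro wild_link_dual)
  qed (simp add: Link wild_Link)
qed (simp_all add: wild_def)

lemma strong_type_of_wild:
  assumes p: "1 \<le> p"
    and T: "\<And>f x s. x \<in> X \<Longrightarrow> 0 < s \<Longrightarrow>
      T f x \<le> ennreal s + ennreal (s powr (1 - p)) * tame p f x + wild S E f x"
    and C: "\<And>n. n \<in> S \<Longrightarrow> (\<Sum>i<N n. m n i powr (1 - p)) \<le> C" "0 \<le> C"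
    and chain: "1 < p \<or> (\<forall>e\<in>E. \<not> h e)"
  shows "strong_type \<mu> T (ereal p)"
proof -
  let ?k = "wild_avg p S E"
  from nn_integral_wild_kern[of S p C E] C chain obtain D where D: "0 < D"
    "\<And>f. (\<integral>\<^sup>+x. ?k f x \<partial>\<mu>) \<le> ennreal D * norm_pow p f" by blast
  show ?thesis
  \<comment> \<open>5 adds the s of the tame estimate and the 4 * s of \<open>wild_dual\<close>; 6 +
    D adds the two integral bounds.\<close>
  proof (rule strong_typeI[of p 5 "6 + D"])
    fix f x and s :: real assume x: "x \<in> X" and s: "0 < s"
    have "T f x \<le> ennreal s + ennreal (s powr (1 - p)) * tame p f x
        + (ennreal (4 * s) + ennreal (s powr (1 - p)) * ?k f x)"
      by (rule order_trans[OF T[OF x s] add_left_mono[OF wild_dual[OF x s p chain]]])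
    also have "\<dots> = (ennreal s + ennreal (4 * s)) + ennreal (s powr (1 - p)) * (tame p f x + ?k f x)"
      by (simp add: distrib_left add_ac)
    also have "ennreal s + ennreal (4 * s) = ennreal (5 * s)" using s by (simp flip: ennreal_plus)
    finally show "T f x \<le> ennreal (5 * s) + ennreal (s powr (1 - p)) * (tame p f x + ?k f x)" .
  next
    fix f
    show "(\<integral>\<^sup>+x. tame p f x + ?k f x \<partial>\<mu>) \<le> ennreal (6 + D) * norm_pow p f"
      using D by (intro nn_integral_add_le nn_integral_tame) auto
  qed (use p D in auto)
qed

text \<open>The leaves above level t are those with m n i below a threshold. If j is the heaviest of
  them, the hypothesis bounds their total weight by C * m n j powr p, and duality on the core bounds
  c n * (t * m n j) powr p by a multiple of the integral of |f| powr p over the core.\<close>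

lemma wild_leaf_level:
  assumes p: "1 \<le> p" and t: "0 < t" and C: "0 \<le> C"
    and Psi: "\<And>j. j < N n \<Longrightarrow> (\<Sum>i | i < N n \<and> m n i \<le> m n j. m n i) \<le> C * m n j powr p"
  shows "ennreal (t powr p) * emeasure \<mu> (Leaf n ` {i. i < N n \<and>
      ennreal t < ennreal (1 / w (Leaf n i)) * abs_on f (K n)})
    \<le> ennreal (2 * 4 powr (p - 1) * C) * norm_pow_on p f (K n)"
proof -
  let ?g = "\<integral>\<^sup>+z\<in>K n. ennreal \<bar>f z\<bar> \<partial>\<mu>" and ?I = "\<integral>\<^sup>+z\<in>K n. ennreal (\<bar>f z\<bar> powr p) \<partial>\<mu>"
  define A where "A = {i. i < N n \<and> ennreal t < ennreal (1 / w (Leaf n i)) * ?g}"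
  have A: "finite A" "\<And>i. i \<in> A \<Longrightarrow> i < N n" by (auto simp: A_def)
  show ?thesis
    unfolding A_def[symmetric]
  proof (cases "A = {} \<or> ?I = \<infinity> \<or> C = 0")
    case True
    moreover have "A = {}" if "C = 0"
    proof (rule ccontr)
      assume "A \<noteq> {}"
      then obtain j where j: "j < N n" using A by auto
      have "m n j \<le> (\<Sum>i | i < N n \<and> m n i \<le> m n j. m n i)"
        using j m_ge_1 by (intro member_le_sum) (auto intro: order_trans[of 0 1])
      then show False using Psi[OF j] m_ge_1[OF j] that by simp
    qed
    ultimately show "ennreal (t powr p) * emeasure \<mu> (Leaf n ` A) \<le> ennreal (2 * 4 powr (p - 1) * C) * ?I"
      using C by (cases "C = 0") (auto simp: ennreal_mult_top)
  next
    case False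
    obtain I where I: "?I = ennreal I" "0 \<le> I" using False by (cases ?I) auto
    obtain j where j: "j \<in> A" "\<And>i. i \<in> A \<Longrightarrow> m n i \<le> m n j"
    proof -
      have "finite (m n ` A)" "m n ` A \<noteq> {}" using False A(1) by auto
      then have "Max (m n ` A) \<in> m n ` A" "\<And>i. i \<in> A \<Longrightarrow> m n i \<le> Max (m n ` A)" by auto
      then show thesis using that by auto
    qed
    have m: "1 \<le> m n j" using j A m_ge_1 by auto
    have c: "0 < c n" by (rule c_pos)
    define M where "M = m n j"
    have M: "1 \<le> M" using m by (simp add: M_def)
    have "ennreal (t * (c n * M)) = ennreal (c n * M) * ennreal t"
      using t c M by (simp add: mult.commute flip: ennreal_mult)
    also have "\<dots> \<le> ennreal (c n * M) * (ennreal (1 / (c n * M)) * ?g)"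
      using j(1) by (intro mult_left_mono) (auto simp: A_def M_def)
    also have "\<dots> = ?g" using c M by (simp add: mult.assoc[symmetric] flip: ennreal_mult)
    \<comment> \<open>With the scale t * M / 4 the first term becomes at most half of t * (c n * M)
      and is absorbed by the left-hand side.\<close>
    also have "\<dots> \<le> ennreal (t * M / 4) * emeasure \<mu> (K n \<inter> X) + ennreal ((t * M / 4) powr (1 - p)) * ?I"
      using t M p by (intro nn_integral_ball_dual) auto
    also have "\<dots> \<le> ennreal (t * M / 4) * ennreal (2 * c n) + ennreal ((t * M / 4) powr (1 - p)) * ennreal I"
      using emeasure_K[of n] K_subset[of n] I by (intro add_mono mult_left_mono) (auto simp: Int_absorb2)
    also have "\<dots> = ennreal (t * M / 4 * (2 * c n) + (t * M / 4) powr (1 - p) * I)"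
    proof -
      have lin: "ennreal a * ennreal b + ennreal x * ennreal y = ennreal (a * b + x * y)"
        if "0 \<le> a" "0 \<le> b" "0 \<le> x" "0 \<le> y" for a b x y
        using that by (simp add: ennreal_mult ennreal_plus)
      show ?thesis using t M c I by (intro lin) auto
    qed
    finally have "t * (c n * M) \<le> t * M / 4 * (2 * c n) + (t * M / 4) powr (1 - p) * I"
      using t M c I by (subst (asm) ennreal_le_iff) auto
    then have "c n * (t * M) / 2 \<le> (t * M / 4) powr (1 - p) * I" by (simp add: algebra_simps)
    then have "(t * M / 4) powr (p - 1) * (c n * (t * M) / 2) \<le> (t * M / 4) powr (p - 1) * ((t * M / 4) powr (1 - p) * I)"
      by (intro mult_left_mono) auto
    also have "\<dots> = I" using t M by (simp add: mult.assoc[symmetric] flip: powr_add)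
    also have "(t * M / 4) powr (p - 1) = (t * M) powr (p - 1) / 4 powr (p - 1)"
      using t M by (simp add: powr_divide)
    finally have "c n * ((t * M) powr (p - 1) * (t * M)) \<le> 2 * 4 powr (p - 1) * I"
      by (simp add: field_simps)
    moreover have "(t * M) powr (p - 1) * (t * M) = (t * M) powr p"
      using t M by (simp add: powr_diff)
    ultimately have main: "c n * (t powr p * M powr p) \<le> 2 * 4 powr (p - 1) * I"
      using t M by (simp add: powr_mult)
    have "emeasure \<mu> (Leaf n ` A) = ennreal (\<Sum>x\<in>Leaf n ` A. w x)"
      using A by (intro emeasure_finite_mu) auto
    also have "(\<Sum>x\<in>Leaf n ` A. w x) = (\<Sum>i\<in>A. c n * m n i)"
      by (subst sum.reindex) (auto simp: inj_on_def)
    also have "\<dots> = c n * (\<Sum>i\<in>A. m n i)" by (simp add: sum_distrib_left)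
    finally have "ennreal (t powr p) * emeasure \<mu> (Leaf n ` A) = ennreal (t powr p * (c n * (\<Sum>i\<in>A. m n i)))"
      by (simp add: ennreal_mult')
    also have "\<dots> \<le> ennreal (t powr p * (c n * (C * M powr p)))"
    proof (intro ennreal_leI mult_left_mono)
      have "(\<Sum>i\<in>A. m n i) \<le> (\<Sum>i | i < N n \<and> m n i \<le> m n j. m n i)"
        using A j m_ge_1 by (intro sum_mono2) (auto intro: order_trans[of 0 1])
      also have "\<dots> \<le> C * M powr p" using Psi[of j] A j by (simp add: M_def)
      finally show "(\<Sum>i\<in>A. m n i) \<le> C * M powr p" .
    qed (use c in auto)
    also have "\<dots> \<le> ennreal (C * (2 * 4 powr (p - 1) * I))"
      using mult_left_mono[OF main C] by (intro ennreal_leI) (simp add: mult_ac)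
    also have "\<dots> = ennreal (2 * 4 powr (p - 1) * C) * ?I"
      using I C by (simp add: mult_ac flip: ennreal_mult)
    finally show "ennreal (t powr p) * emeasure \<mu> (Leaf n ` A) \<le> ennreal (2 * 4 powr (p - 1) * C) * ?I" .
  qed
qed

text \<open>The level set lies in the tail from its least index l, of mass at most 2 * chain_w l.
  The average witnessing l starts at some u \<le> l, so t * chain_w l \<le> t * chain_w u, which the
  integral of |f| dominates.\<close>

lemma wild_link_level:
  assumes t: "0 < t" and h: "h e"
  shows "ennreal t * emeasure \<mu> (Link e ` {l. ennreal t < wild S E f (Link e l)})
    \<le> ennreal 2 * (\<integral>\<^sup>+z. ennreal \<bar>f z\<bar> \<partial>\<mu>)"
proof (cases "{l. ennreal t < wild S E f (Link e l)} = {}")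
  case False
  let ?g = "\<integral>\<^sup>+z. ennreal \<bar>f z\<bar> \<partial>\<mu>"
  define l where "l = (LEAST l. ennreal t < wild S E f (Link e l))"
  have l: "ennreal t < wild S E f (Link e l)" "\<And>k. ennreal t < wild S E f (Link e k) \<Longrightarrow> l \<le> k"
    unfolding l_def using False by (auto intro: LeastI Least_le)
  then have E: "e \<in> E" by (auto simp: wild_Link split: if_splits)
  from l(1) obtain u where u: "u \<le> l"
    "ennreal t < ennreal (1 / chain_w u) * abs_on f (tail e u)"
    by (auto simp: wild_Link E less_SUP_iff)
  have "ennreal (t * chain_w l) \<le> ennreal (chain_w u * t)"
    using t chain_w_antimono[OF u(1)] by (intro ennreal_leI) (simp add: mult.commute)
  also have "\<dots> = ennreal (chain_w u) * ennreal t" using t chain_w_pos[of u] by (simp add: ennreal_mult)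
  also have "\<dots> \<le> ennreal (chain_w u) * (ennreal (1 / chain_w u) * abs_on f (tail e u))"
    using u by (intro mult_left_mono) auto
  also have "\<dots> = abs_on f (tail e u)"
    using chain_w_pos[of u] by (simp add: mult.assoc[symmetric] flip: ennreal_mult)
  also have "\<dots> \<le> ?g" by (intro nn_integral_mono) (auto split: split_indicator)
  finally have "ennreal (t * chain_w l) \<le> ?g" .
  have "emeasure \<mu> (Link e ` {l. ennreal t < wild S E f (Link e l)}) \<le> emeasure \<mu> (tail e l)"
    using l(2) tail_subset[OF h] by (intro emeasure_mono_mu) (auto simp: tail_def)
  also have "\<dots> \<le> ennreal (2 * chain_w l)" by (rule emeasure_tail[OF h])
  finally have "ennreal t * emeasure \<mu> (Link e ` {l. ennreal t < wild S E f (Link e l)})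
      \<le> ennreal t * ennreal (2 * chain_w l)" by (rule mult_left_mono) simp
  also have "\<dots> = ennreal 2 * ennreal (t * chain_w l)"
  proof -
    have "ennreal t * ennreal (2 * chain_w l) = ennreal (t * (2 * chain_w l))"
      using t chain_w_pos[of l] by (intro ennreal_mult[symmetric]) auto
    also have "t * (2 * chain_w l) = 2 * (t * chain_w l)" by simp
    also have "ennreal \<dots> = ennreal 2 * ennreal (t * chain_w l)"
      using t chain_w_pos[of l] by (intro ennreal_mult) auto
    finally show ?thesis .
  qed
  also have "\<dots> \<le> ennreal 2 * ?g" by (intro mult_left_mono) (use \<open>ennreal (t * chain_w l) \<le> ?g\<close> in auto)
  finally show ?thesis .
qed simp

lemma suminf_nn_integral_K_le:
  "(\<Sum>n. \<integral>\<^sup>+z\<in>K n. F z \<partial>\<mu>) \<le> (\<integral>\<^sup>+z. F z \<partial>\<mu>)"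
proof -
  have "disjoint_family K"
  proof (unfold disjoint_family_on_def, intro ballI impI)
    fix k n :: nat assume "k \<noteq> n"
    then show "K k \<inter> K n = {}" by (auto simp: K_def)
  qed
  have "(\<Sum>n. \<integral>\<^sup>+z\<in>K n. F z \<partial>\<mu>) = (\<integral>\<^sup>+z. (\<Sum>n. F z * indicator (K n) z) \<partial>\<mu>)"
    by (rule nn_integral_suminf[symmetric]) auto
  also have "\<dots> = (\<integral>\<^sup>+z. F z * indicator (\<Union>n. K n) z \<partial>\<mu>)"
    using \<open>disjoint_family K\<close> by (simp add: suminf_indicator)
  also have "\<dots> \<le> (\<integral>\<^sup>+z. F z \<partial>\<mu>)" by (intro nn_integral_mono) (auto split: split_indicator)
  finally show ?thesis .
qed

lemma wild_level:
  assumes p: "1 \<le> p" and t: "0 < t" and C: "0 \<le> C"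
    and Psi: "\<And>n j. n \<in> S \<Longrightarrow> j < N n \<Longrightarrow> (\<Sum>i | i < N n \<and> m n i \<le> m n j. m n i) \<le> C * m n j powr p"
    and chain: "p = 1 \<or> E = {}"
  shows "ennreal (t powr p) * emeasure \<mu> {x\<in>X. ennreal t < wild S E f x}
    \<le> ennreal (2 * 4 powr (p - 1) * C + 4) * norm_pow p f"
proof -
  let ?I = "\<integral>\<^sup>+z. ennreal (\<bar>f z\<bar> powr p) \<partial>\<mu>"
  define A where "A n = (if n \<in> S then Leaf n ` {i. i < N n \<and>
      ennreal t < ennreal (1 / w (Leaf n i)) * abs_on f (K n)} else {})" for n
  define B where "B e = (if h e then Link e ` {l. ennreal t < wild S E f (Link e l)} else {})" for e
  have AX: "A n \<subseteq> X" for n by (auto simp: A_def)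
  have BX: "B e \<subseteq> X" for e by (auto simp: B_def)
  have B: "ennreal (t powr p) * emeasure \<mu> (B e) \<le> ennreal 2 * ?I" for e
  proof (cases "h e \<and> p = 1")
    case True
    then show ?thesis using wild_link_level[OF t, of e S E f] t by (simp add: B_def)
  next
    case False
    then have "B e = {}" using chain by (auto simp: B_def wild_Link)
    then show ?thesis by simp
  qed
  have A: "ennreal (t powr p) * emeasure \<mu> (A n) \<le>
      ennreal (2 * 4 powr (p - 1) * C) * norm_pow_on p f (K n)" for n
  proof (cases "n \<in> S")
    case True
    show ?thesis unfolding A_def if_P[OF True] by (rule wild_leaf_level[OF p t C Psi[OF True]])
  qed (simp add: A_def)
  have "ennreal (t powr p) * emeasure \<mu> (\<Union>n. A n) \<le> ennreal (t powr p) * (\<Sum>n. emeasure \<mu> (A n))"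
    using AX by (intro mult_left_mono emeasure_subadditive_countably) auto
  also have "\<dots> = (\<Sum>n. ennreal (t powr p) * emeasure \<mu> (A n))" by simp
  also have "\<dots> \<le> (\<Sum>n. ennreal (2 * 4 powr (p - 1) * C) * norm_pow_on p f (K n))"
    by (intro suminf_le A) auto
  also have "\<dots> = ennreal (2 * 4 powr (p - 1) * C) * (\<Sum>n. \<integral>\<^sup>+z\<in>K n. ennreal (\<bar>f z\<bar> powr p) \<partial>\<mu>)" by simp
  also have "\<dots> \<le> ennreal (2 * 4 powr (p - 1) * C) * ?I"
    by (intro mult_left_mono suminf_nn_integral_K_le) auto
  finally have UA: "ennreal (t powr p) * emeasure \<mu> (\<Union>n. A n) \<le> ennreal (2 * 4 powr (p - 1) * C) * ?I" .
  have sub: "{x\<in>X. ennreal t < wild S E f x} \<subseteq> (\<Union>n. A n) \<union> (B True \<union> B False)"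
  proof
    fix x assume x: "x \<in> {x\<in>X. ennreal t < wild S E f x}"
    show "x \<in> (\<Union>n. A n) \<union> (B True \<union> B False)"
    proof (cases x)
      case (Leaf n i)
      then have "x \<in> A n" using x by (auto simp: A_def wild_Leaf simp del: w_simps split: if_splits)
      then show ?thesis by blast
    next
      case (Link e l)
      then have "x \<in> B e" using x by (auto simp: B_def)
      then show ?thesis by (cases e) auto
    qed (use x in \<open>auto simp: wild_def\<close>)
  qed
  have "emeasure \<mu> {x\<in>X. ennreal t < wild S E f x} \<le> emeasure \<mu> ((\<Union>n. A n) \<union> (B True \<union> B False))"
    using AX BX by (intro emeasure_mono_mu sub) blast
  also have "\<dots> \<le> emeasure \<mu> (\<Union>n. A n) + emeasure \<mu> (B True \<union> B False)"
    using AX BX by (intro emeasure_subadditive) auto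
  also have "emeasure \<mu> (B True \<union> B False) \<le> emeasure \<mu> (B True) + emeasure \<mu> (B False)"
    using BX by (intro emeasure_subadditive) auto
  finally have "ennreal (t powr p) * emeasure \<mu> {x\<in>X. ennreal t < wild S E f x} \<le>
     ennreal (t powr p) * (emeasure \<mu> (\<Union>n. A n) + (emeasure \<mu> (B True) + emeasure \<mu> (B False)))"
    by (intro mult_left_mono) (auto intro: add_left_mono order_trans)
  also have "\<dots> = ennreal (t powr p) * emeasure \<mu> (\<Union>n. A n) + (ennreal (t powr p) * emeasure \<mu> (B True)
     + ennreal (t powr p) * emeasure \<mu> (B False))"
    by (simp add: distrib_left)
  also have "\<dots> \<le> ennreal (2 * 4 powr (p - 1) * C) * ?I + (ennreal 2 * ?I + ennreal 2 * ?I)"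
    by (intro add_mono UA B)
  also have "\<dots> = (ennreal (2 * 4 powr (p - 1) * C) + (ennreal 2 + ennreal 2)) * ?I"
    by (simp only: distrib_right)
  also have "ennreal (2 * 4 powr (p - 1) * C) + (ennreal 2 + ennreal 2) = ennreal (2 * 4 powr (p - 1) * C + 4)"
    using C by (simp add: ennreal_plus)
  finally show ?thesis .
qed

text \<open>At p = 1 stars and chains are both treated through level sets. For p > 1 the chain part
  has a kernel with bounded columns and moves to the integrable part Q, so that only the stars
  remain in R.\<close>

lemma weak_type_of_wild:
  assumes p: "1 \<le> p"
    and T: "\<And>f x s. x \<in> X \<Longrightarrow> 0 < s \<Longrightarrow>
      T f x \<le> ennreal s + ennreal (s powr (1 - p)) * tame p f x + wild S E f x"
    and C: "0 \<le> C"
    and Psi: "\<And>n j. n \<in> S \<Longrightarrow> j < N n \<Longrightarrow> (\<Sum>i | i < N n \<and> m n i \<le> m n j. m n i) \<le> C * m n j powr p"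
  shows "weak_type \<mu> T (ereal p)"
proof (cases "p = 1")
  case True
  show ?thesis
  proof (rule weak_typeI[where c = 1 and D = 6 and D' = "2 * 4 powr (p - 1) * C + 4" and Q = "tame p" and R = "wild S E"])
    show "ennreal (t powr p) * emeasure \<mu> {x\<in>X. ennreal t < wild S E f x}
      \<le> ennreal (2 * 4 powr (p - 1) * C + 4) * norm_pow p f" if "0 < t" for t f
      by (rule wild_level[OF p that C Psi]) (simp_all add: True)
    show "0 < 2 * 4 powr (p - 1) * C + 4" using C by (intro add_nonneg_pos) auto
    show "T f x \<le> ennreal (1 * s) + ennreal (s powr (1 - p)) * tame p f x + wild S E f x" if "x \<in> X" "0 < s" for f x s
      using T[OF that] by simp
  qed (rule p nn_integral_tame zero_less_one | simp)+
next
  case False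
  then have p1: "1 < p" using p by simp
  let ?k = "wild_avg p {} E"
  from nn_integral_wild_kern[of "{}" p 0 E] p1 obtain D where D: "0 < D"
    "\<And>f. (\<integral>\<^sup>+x. ?k f x \<partial>\<mu>) \<le> ennreal D * norm_pow p f" by auto
  show ?thesis
  proof (rule weak_typeI[of p 5 "6 + D" "2 * 4 powr (p - 1) * C + 4" T "\<lambda>f x. tame p f x + ?k f x" "wild S {}"])
    fix f x and s :: real assume x: "x \<in> X" and s: "0 < s"
    have "wild S E f x = wild {} E f x + wild S {} f x" by (cases x) (auto simp: wild_def)
    then have "T f x \<le> ennreal s + ennreal (s powr (1 - p)) * tame p f x
        + (wild {} E f x + wild S {} f x)" using T[OF x s] by metis
    also have "\<dots> \<le> ennreal s + ennreal (s powr (1 - p)) * tame p f x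
        + ((ennreal (4 * s) + ennreal (s powr (1 - p)) * ?k f x) + wild S {} f x)"
      by (intro add_left_mono add_right_mono wild_dual[OF x s p]) (use p1 in auto)
    also have "\<dots> = (ennreal s + ennreal (4 * s)) + ennreal (s powr (1 - p)) * (tame p f x + ?k f x) + wild S {} f x"
      by (simp add: distrib_left add_ac)
    also have "ennreal s + ennreal (4 * s) = ennreal (5 * s)" using s by (simp flip: ennreal_plus)
    finally show "T f x \<le> ennreal (5 * s) + ennreal (s powr (1 - p)) * (tame p f x + ?k f x) + wild S {} f x" .
  next
    fix f
    show "(\<integral>\<^sup>+x. tame p f x + ?k f x \<partial>\<mu>) \<le> ennreal (6 + D) * norm_pow p f"
      using D by (intro nn_integral_add_le nn_integral_tame) auto
  next
    fix f and t :: real assume "0 < t"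
    then show "ennreal (t powr p) * emeasure \<mu> {x \<in> X. ennreal t < wild S {} f x}
         \<le> ennreal (2 * 4 powr (p - 1) * C + 4) * norm_pow p f"
      by (intro wild_level p C Psi) auto
  qed (use p C D in \<open>auto intro!: add_nonneg_pos\<close>)
qed

end

section \<open>Test functions\<close>

context glued
begin

lemma emeasure_star:
  assumes "i < N n"
  shows "emeasure \<mu> (insert (Leaf n i) (K n)) \<le> ennreal (3 * (c n * m n i))"
proof -
  have 1: "emeasure \<mu> (insert (Leaf n i) (K n)) = ennreal (\<Sum>x\<in>insert (Leaf n i) (K n). w x)"
    using assms K_subset by (intro emeasure_finite_mu) auto
  have "(\<Sum>x\<in>insert (Leaf n i) (K n). w x) = c n * m n i + (\<Sum>x\<in>K n. w x)"
    by (subst sum.insert) auto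
  also have "\<dots> \<le> c n * m n i + 2 * (c n * m n i)"
  proof -
    have "c n * 1 \<le> c n * m n i" using m_ge_1[OF assms] c_pos[of n] by (intro mult_left_mono) auto
    then show ?thesis using sum_w_K[of n] by linarith
  qed
  finally have "(\<Sum>x\<in>insert (Leaf n i) (K n). w x) \<le> 3 * (c n * m n i)" by simp
  then show ?thesis unfolding 1 by (rule ennreal_leI)
qed

lemma cmax_leaf_ge:
  assumes "i < N n" "q n = 4" "\<kappa> < 2"
  shows "ennreal (1 / (3 * m n i)) \<le> cmax X d \<mu> \<kappa> (indicator {Hub n}) (Leaf n i)"
proof -
  \<comment> \<open>Radius 4 / \<kappa> exceeds 2 and reaches the hub; the dilated open ball of
    radius 4 just misses the other leaves because q n = 4.\<close>
  have k: "2 < 4 / \<kappa>" "0 < \<kappa>" using assms kappa by (auto simp: field_simps)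
  have "mball (Leaf n i) (\<kappa> * (4 / \<kappa>)) \<subseteq> insert (Leaf n i) (K n)"
  proof
    fix x assume "x \<in> mball (Leaf n i) (\<kappa> * (4 / \<kappa>))"
    then show "x \<in> insert (Leaf n i) (K n)"
      using assms k by (cases x) (auto split: if_splits)
  qed
  then have "ennreal (w (Hub n) / (3 * (c n * m n i))) \<le> avg \<kappa> (indicator {Hub n}) (Leaf n i) (4 / \<kappa>)"
    using assms k K_subset[of n] w_pos[of "Leaf n i"]
    by (intro le_avg_indicator[where Z = "insert (Leaf n i) (K n)"] emeasure_star) auto
  also have "\<dots> \<le> cmax X d \<mu> \<kappa> (indicator {Hub n}) (Leaf n i)"
    using k by (intro avg_le_cmax) auto
  finally show ?thesis using c_pos[of n] by simp
qed

lemma umax_leaf_ge: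
  assumes "i < N n" "\<kappa> < 3"
  shows "ennreal (1 / (3 * m n i)) \<le> umax X d \<mu> \<kappa> (indicator {Hub n}) (Leaf n i)"
proof -
  \<comment> \<open>From the spoke, radius 3 / \<kappa> exceeds 1 and reaches both hub and leaf i;
    the dilated open ball of radius 3 just misses the other leaves, whatever q n is.\<close>
  have k: "1 < 3 / \<kappa>" "0 < \<kappa>" using assms kappa by (auto simp: field_simps)
  have "mball (Spoke n i) (\<kappa> * (3 / \<kappa>)) \<subseteq> insert (Leaf n i) (K n)"
  proof
    fix x assume "x \<in> mball (Spoke n i) (\<kappa> * (3 / \<kappa>))"
    then show "x \<in> insert (Leaf n i) (K n)"
      using assms k by (cases x) (auto split: if_splits)
  qed
  then have "ennreal (w (Hub n) / (3 * (c n * m n i))) \<le> avg \<kappa> (indicator {Hub n}) (Spoke n i) (3 / \<kappa>)"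
    using assms k K_subset[of n] w_pos[of "Leaf n i"]
    by (intro le_avg_indicator[where Z = "insert (Leaf n i) (K n)"] emeasure_star) auto
  also have "\<dots> \<le> umax X d \<mu> \<kappa> (indicator {Hub n}) (Leaf n i)"
    using k assms by (intro avg_le_umax) auto
  finally show ?thesis using c_pos[of n] by simp
qed

lemma star_strong_necessary:
  assumes "strong_type \<mu> T (ereal p)" "1 \<le> p"
    and T: "\<And>n i. n \<in> S \<Longrightarrow> i < N n \<Longrightarrow> ennreal (1 / (3 * m n i)) \<le> T (indicator {Hub n}) (Leaf n i)"
  shows "\<exists>C\<ge>0. \<forall>n\<in>S. (\<Sum>i<N n. m n i powr (1 - p)) \<le> C"
proof -
  from strong_type_indicator[OF assms(1,2)] obtain C :: real where C: "0 < C"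
    "\<And>z A g. z \<in> X \<Longrightarrow> finite A \<Longrightarrow> A \<subseteq> X \<Longrightarrow>
      (\<And>x. x \<in> A \<Longrightarrow> 0 \<le> g x \<and> ennreal (g x) \<le> T (indicator {z}) x) \<Longrightarrow>
      (\<Sum>x\<in>A. w x * g x powr p) \<le> C * w z" by blast
  have "(\<Sum>i<N n. m n i powr (1 - p)) \<le> 3 powr p * C" if n: "n \<in> S" for n
  proof -
    define g where "g x = (case x of Leaf k i \<Rightarrow> 1 / (3 * m k i) | _ \<Rightarrow> 0)" for x
    have m: "0 < m n i" if "i < N n" for i using m_ge_1[OF that] by simp
    have "(\<Sum>x\<in>Leaf n ` {..<N n}. w x * g x powr p) \<le> C * w (Hub n)"
      using T[OF n] m by (intro C(2)) (auto simp: g_def less_imp_le)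
    also have "(\<Sum>x\<in>Leaf n ` {..<N n}. w x * g x powr p) = (\<Sum>i<N n. c n * m n i * (1 / (3 * m n i)) powr p)"
      by (subst sum.reindex) (auto simp: inj_on_def g_def)
    also have "(\<Sum>i<N n. c n * m n i * (1 / (3 * m n i)) powr p) = (\<Sum>i<N n. c n / 3 powr p * m n i powr (1 - p))"
    proof (intro sum.cong refl)
      fix i assume "i \<in> {..<N n}"
      then have "0 < m n i" using m by simp
      then show "c n * m n i * (1 / (3 * m n i)) powr p = c n / 3 powr p * m n i powr (1 - p)"
        by (simp add: powr_divide powr_mult powr_diff)
    qed
    also have "\<dots> = (\<Sum>i<N n. m n i powr (1 - p)) / 3 powr p * c n"
      by (simp add: sum_distrib_left sum_divide_distrib mult.commute)
    finally have "(\<Sum>i<N n. m n i powr (1 - p)) / 3 powr p * c n \<le> C * c n" by simp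
    then have "(\<Sum>i<N n. m n i powr (1 - p)) / 3 powr p \<le> C"
      using c_pos[of n] by (rule mult_right_le_imp_le)
    then show ?thesis by (simp add: divide_le_eq mult.commute)
  qed
  then show ?thesis using C(1) by (intro exI[of _ "3 powr p * C"]) auto
qed

lemma star_weak_necessary:
  assumes "weak_type \<mu> T (ereal p)" "1 \<le> p"
    and T: "\<And>n i. n \<in> S \<Longrightarrow> i < N n \<Longrightarrow> ennreal (1 / (3 * m n i)) \<le> T (indicator {Hub n}) (Leaf n i)"
  shows "\<exists>C\<ge>0. \<forall>n\<in>S. \<forall>j<N n. (\<Sum>i | i < N n \<and> m n i \<le> m n j. m n i) \<le> C * m n j powr p"
proof -
  from weak_type_indicator[OF assms(1,2)] obtain C :: real where C: "0 < C"
    "\<And>z A t. z \<in> X \<Longrightarrow> finite A \<Longrightarrow> A \<subseteq> X \<Longrightarrow> 0 < t \<Longrightarrow>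
      (\<And>x. x \<in> A \<Longrightarrow> ennreal t < T (indicator {z}) x) \<Longrightarrow>
      t powr p * (\<Sum>x\<in>A. w x) \<le> C * w z" by blast
  have "(\<Sum>i | i < N n \<and> m n i \<le> m n j. m n i) \<le> 6 powr p * C * m n j powr p" if n: "n \<in> S" and j: "j < N n" for n j
  proof -
    let ?A = "{i. i < N n \<and> m n i \<le> m n j}"
    have m: "0 < m n i" if "i < N n" for i using m_ge_1[OF that] by simp
    \<comment> \<open>The factor 6 instead of 3 ensures that the level is strictly exceeded also at
      i = j.\<close>
    have "(1 / (6 * m n j)) powr p * (\<Sum>x\<in>Leaf n ` ?A. w x) \<le> C * w (Hub n)"
    proof (intro C(2))
      fix x assume "x \<in> Leaf n ` ?A"
      then obtain i where i: "x = Leaf n i" "i < N n" "m n i \<le> m n j" by auto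
      then have "1 / (6 * m n j) < 1 / (3 * m n i)" using m[OF i(2)] m[OF j] by (simp add: field_simps)
      then have "ennreal (1 / (6 * m n j)) < ennreal (1 / (3 * m n i))"
        using m[OF j] by (simp add: ennreal_lessI m i)
      also have "\<dots> \<le> T (indicator {Hub n}) (Leaf n i)" using T n i by simp
      finally show "ennreal (1 / (6 * m n j)) < T (indicator {Hub n}) x" by (simp add: i)
    qed (use m[OF j] in auto)
    moreover have "(\<Sum>x\<in>Leaf n ` ?A. w x) = (\<Sum>i\<in>?A. c n * m n i)"
      by (subst sum.reindex) (auto simp: inj_on_def)
    moreover have "\<dots> = c n * (\<Sum>i\<in>?A. m n i)" by (simp add: sum_distrib_left)
    moreover have "(1 / (6 * m n j)) powr p = 1 / (6 powr p * m n j powr p)"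
      using m[OF j] by (simp add: powr_divide powr_mult)
    ultimately have "(\<Sum>i\<in>?A. m n i) / (6 powr p * m n j powr p) * c n \<le> C * c n"
      by (simp only: w_simps) (simp add: mult_ac)
    then have "(\<Sum>i\<in>?A. m n i) / (6 powr p * m n j powr p) \<le> C"
      using c_pos[of n] by (rule mult_right_le_imp_le)
    then show ?thesis using m[OF j] by (simp add: divide_le_eq mult_ac)
  qed
  then show ?thesis using C(1) by (intro exI[of _ "6 powr p * C"]) auto
qed

text \<open>Each l with 0 < l < L contributes chain_w l * (chain_w L / (2 * chain_w l)) = chain_w L
  / 2, independently of l. These L - 1 equal shares cannot stay below C * chain_w L for all
  L.\<close>

lemma chain_strong_one_necessary:
  assumes T: "\<And>l L. 0 < l \<Longrightarrow> l < L \<Longrightarrow>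
      ennreal (chain_w L / (2 * chain_w l)) \<le> T (indicator {Link e L}) (Link e l)"
    and h: "h e"
  shows "\<not> strong_type \<mu> T 1"
proof
  assume "strong_type \<mu> T 1"
  then have "strong_type \<mu> T (ereal 1)" by (simp add: one_ereal_def)
  from strong_type_indicator[OF this] obtain C :: real where C: "0 < C"
    "\<And>z A g. z \<in> X \<Longrightarrow> finite A \<Longrightarrow> A \<subseteq> X \<Longrightarrow>
      (\<And>x. x \<in> A \<Longrightarrow> 0 \<le> g x \<and> ennreal (g x) \<le> T (indicator {z}) x) \<Longrightarrow>
      (\<Sum>x\<in>A. w x * g x powr 1) \<le> C * w z" by auto
  have "real (L - 1) \<le> 2 * C" for L
  proof -
    define g where "g x = (case x of Link e l \<Rightarrow> chain_w L / (2 * chain_w l) | _ \<Rightarrow> 0)" for x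
    have "(\<Sum>x\<in>Link e ` {0<..<L}. w x * g x powr 1) \<le> C * w (Link e L)"
      using T h chain_w_pos by (intro C(2)) (auto simp: g_def less_imp_le)
    moreover have "(\<Sum>x\<in>Link e ` {0<..<L}. w x * g x powr 1) = (\<Sum>l\<in>{0<..<L}. chain_w l * (chain_w L / (2 * chain_w l)) powr 1)"
      by (subst sum.reindex) (auto simp: inj_on_def g_def)
    also have "\<dots> = (\<Sum>l\<in>{0<..<L}. chain_w L / 2)"
      using chain_w_pos by (intro sum.cong) (auto simp: less_imp_le less_imp_neq[THEN not_sym])
    ultimately have "real (L - 1) * (chain_w L / 2) \<le> C * chain_w L" by simp
    then show ?thesis using chain_w_pos[of L] by (simp add: field_simps)
  qed
  from this[of "Suc (nat \<lceil>2 * C\<rceil> + 1)"] show False by linarith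
qed

lemma cmax_link_ge:
  assumes "h e" "lam e = 4 * \<kappa>" "0 < l" "l < L"
  shows "ennreal (chain_w L / (2 * chain_w l)) \<le> cmax X d \<mu> \<kappa> (indicator {Link e L}) (Link e l)"
proof -
  define a where "a = 1 / lam e"
  \<comment> \<open>The tail from l lies within (1 + a) * a ^ l, hence inside this radius. As lam e
    = 4 * \<kappa>, the dilated radius is a ^ (l - 1), exactly the distance to the predecessor,
    which the open ball omits.\<close>
  define r where "r = 4 * a ^ l"
  have l1: "1 \<le> lam e" using lam[of e] by simp
  have a: "0 < a" "a \<le> 1" using lam[of e] by (auto simp: a_def)
  have r: "0 < r" using a by (simp add: r_def)
  have kr: "\<kappa> * r = a ^ (l - 1)"
    using assms(3) kappa by (cases l) (auto simp: r_def a_def assms(2))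
  then have kr1: "\<kappa> * r \<le> 1" using a by (simp add: power_le_one)
  have "mball (Link e l) (\<kappa> * r) \<subseteq> tail e l"
  proof
    fix x assume x: "x \<in> mball (Link e l) (\<kappa> * r)"
    then have "d (Link e l) x < 1" using kr1 by auto
    then obtain j where j: "x = Link e j" by (cases x) (auto split: if_splits)
    have "\<not> j < l"
    proof
      assume "j < l"
      then have "a ^ (l - 1) \<le> a ^ j" using a by (intro power_decreasing) auto
      also have "\<dots> \<le> chain_dist (lam e) j l" using chain_dist_bounds(1)[OF l1 \<open>j < l\<close>] by (simp add: a_def)
      finally show False using x j kr by (simp add: chain_dist_commute[of _ l j])
    qed
    then show "x \<in> tail e l" by (simp add: j)
  qed
  moreover have "Link e L \<in> mball (Link e l) r"
  proof -
    have "chain_dist (lam e) l L \<le> (1 + a) * a ^ l" using chain_dist_bounds(2)[OF l1 assms(4)] by (simp add: a_def)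
    also have "\<dots> < r" using a by (simp add: r_def)
    finally show ?thesis using assms by simp
  qed
  ultimately have "ennreal (w (Link e L) / (2 * chain_w l)) \<le> avg \<kappa> (indicator {Link e L}) (Link e l) r"
    using assms chain_w_pos[of l] by (intro le_avg_indicator[where Z = "tail e l"] emeasure_tail tail_subset) auto
  also have "\<dots> \<le> cmax X d \<mu> \<kappa> (indicator {Link e L}) (Link e l)"
    using r by (intro avg_le_cmax)
  finally show ?thesis by simp
qed

text \<open>The centre is the successor of l. Its ball reaches l and everything beyond, while all
  points before l are nonneighbours of the centre. The extra factor 1 + a in their distance puts
  them just outside the dilated radius (1 + a) * a ^ (l - 1).\<close>

lemma umax_link_ge:
  assumes "h e" "lam e = \<kappa>" "0 < l" "l < L"
  shows "ennreal (chain_w L / (2 * chain_w l)) \<le> umax X d \<mu> \<kappa> (indicator {Link e L}) (Link e l)"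
proof -
  define a where "a = 1 / lam e"
  define r where "r = (1 + a) * a ^ l"
  have l1: "1 \<le> lam e" using lam[of e] by simp
  have a: "0 < a" "a \<le> 1 / 2" using lam[of e] by (auto simp: a_def)
  have r: "0 < r" using a by (simp add: r_def)
  have kr: "\<kappa> * r = (1 + a) * a ^ (l - 1)"
    using assms(3) kappa by (cases l) (auto simp: r_def a_def assms(2))
  have "(1 + a) * a ^ (l - 1) \<le> 2 * 1" using a by (intro mult_mono power_le_one) auto
  then have kr2: "\<kappa> * r \<le> 2" using kr by simp
  have "mball (Link e (Suc l)) (\<kappa> * r) \<subseteq> tail e l"
  proof
    fix x assume x: "x \<in> mball (Link e (Suc l)) (\<kappa> * r)"
    then have "d (Link e (Suc l)) x < 2" using kr2 by auto
    then obtain j where j: "x = Link e j" by (cases x) (auto split: if_splits)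
    have "\<not> j < l"
    proof
      assume "j < l"
      then have "(1 + a) * a ^ (l - 1) \<le> (1 + a) * a ^ j" using a by (intro mult_left_mono power_decreasing) auto
      also have "\<dots> = chain_dist (lam e) j (Suc l)" using \<open>j < l\<close> by (simp add: a_def chain_dist_def)
      finally show False using x j kr by (simp add: chain_dist_commute[of _ "Suc l" j])
    qed
    then show "x \<in> tail e l" by (simp add: j)
  qed
  moreover have "Link e L \<in> mball (Link e (Suc l)) r"
  proof (cases "L = Suc l")
    case False
    then have "chain_dist (lam e) (Suc l) L \<le> (1 + a) * a ^ Suc l"
      using chain_dist_bounds(2)[OF l1, of "Suc l" L] assms(4) by (simp add: a_def)
    also have "\<dots> < r" using a by (simp add: r_def)
    finally show ?thesis using assms by simp
  qed (use assms r in \<open>simp add: chain_dist_def\<close>)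
  ultimately have "ennreal (w (Link e L) / (2 * chain_w l)) \<le> avg \<kappa> (indicator {Link e L}) (Link e (Suc l)) r"
    using assms chain_w_pos[of l] by (intro le_avg_indicator[where Z = "tail e l"] emeasure_tail tail_subset) auto
  also have "\<dots> \<le> umax X d \<mu> \<kappa> (indicator {Link e L}) (Link e l)"
  proof (intro avg_le_umax)
    have "a ^ l < r" using a by (simp add: r_def)
    then show "Link e l \<in> mball (Link e (Suc l)) r" using assms by (simp add: chain_dist_def a_def)
  qed (use r assms in auto)
  finally show ?thesis by simp
qed

end

section \<open>Sequences of stars\<close>

definition strong_bound :: "(nat \<Rightarrow> nat) \<Rightarrow> (nat \<Rightarrow> nat \<Rightarrow> real) \<Rightarrow> real \<Rightarrow> bool" where
  "strong_bound N m p \<longleftrightarrow> (\<exists>C\<ge>0. \<forall>n. (\<Sum>i<N n. m n i powr (1 - p)) \<le> C)"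

definition weak_bound :: "(nat \<Rightarrow> nat) \<Rightarrow> (nat \<Rightarrow> nat \<Rightarrow> real) \<Rightarrow> real \<Rightarrow> bool" where
  "weak_bound N m p \<longleftrightarrow>
     (\<exists>C\<ge>0. \<forall>n. \<forall>j<N n. (\<Sum>i | i < N n \<and> m n i \<le> m n j. m n i) \<le> C * m n j powr p)"

lemma strong_bound_const:
  "strong_bound N (\<lambda>n i. M n) p \<longleftrightarrow> (\<exists>C\<ge>0. \<forall>n. real (N n) * M n powr (1 - p) \<le> C)"
  by (simp add: strong_bound_def)

text \<open>With equal leaves the only sublevel set is the whole star, so the two conditions
  coincide. Separating them requires leaves of different weights in one star.\<close>

lemma weak_bound_const:
  assumes "\<And>n. 1 \<le> M n"
  shows "weak_bound N (\<lambda>n i. M n) p \<longleftrightarrow> strong_bound N (\<lambda>n i. M n) p"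
proof -
  have "(\<forall>j<N n. (\<Sum>i | i < N n \<and> M n \<le> M n. M n) \<le> C * M n powr p) \<longleftrightarrow> real (N n) * M n powr (1 - p) \<le> C"
    if "0 \<le> C" for n C
  proof (cases "N n = 0")
    case False
    have "{i. i < N n \<and> M n \<le> M n} = {..<N n}" by auto
    moreover have "0 < M n" using assms[of n] by simp
    ultimately show ?thesis using False by (auto simp: powr_diff divide_le_eq)
  qed (use that in auto)
  then show ?thesis unfolding weak_bound_def strong_bound_const by (intro ex_cong1 conj_cong refl) auto
qed

lemma half_le_nat_floor: "1 \<le> x \<Longrightarrow> x / 2 \<le> real (nat \<lfloor>x\<rfloor>)"
proof -
  assume "1 \<le> x"
  then have "1 \<le> \<lfloor>x\<rfloor>" by simp
  then have "1 \<le> real_of_int \<lfloor>x\<rfloor>" "real (nat \<lfloor>x\<rfloor>) = real_of_int \<lfloor>x\<rfloor>" by auto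
  then show ?thesis using floor_correct[of x] by linarith
qed

lemma exp_unbounded: "0 < \<delta> \<Longrightarrow> \<exists>n::nat. C < exp (real n * \<delta>)"
proof -
  assume d: "0 < \<delta>"
  obtain n :: nat where "\<bar>C\<bar> < real n * \<delta>" using reals_Archimedean3[OF d] by blast
  also have "\<dots> < exp (real n * \<delta>)" using exp_ge_add_one_self[of "real n * \<delta>"] by linarith
  finally show ?thesis by (intro exI[of _ n]) linarith
qed

lemma star_sequence_infinity:
  "\<exists>N m. (\<forall>n i. i < N n \<longrightarrow> 1 \<le> m n i) \<and> (\<forall>p\<ge>1. \<not> strong_bound N m p \<and> \<not> weak_bound N m p)"
proof -
  have "\<not> strong_bound (\<lambda>n. n) (\<lambda>n i. 1) p" for p
    unfolding strong_bound_const using reals_Archimedean2 by (auto simp: not_le)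
  then show ?thesis
    by (intro exI[of _ "\<lambda>n. n"] exI[of _ "\<lambda>n i. 1"]) (simp add: weak_bound_const)
qed

text \<open>Weights exp n on about K n * exp (n (p0 - 1)) leaves turn the bound into K n * exp (n
  (p0 - p)), up to a factor 2 lost by rounding. The factor K decides about p = p0.\<close>

lemma star_sequence_const:
  fixes K :: "nat \<Rightarrow> real"
  assumes K: "\<And>n. 1 \<le> K n" and p0: "1 \<le> p0"
  shows "\<exists>N m. (\<forall>n i. i < N n \<longrightarrow> 1 \<le> m n i) \<and>
    (\<forall>p. strong_bound N m p \<longleftrightarrow> (\<exists>C\<ge>0. \<forall>n. K n * exp (real n * (p0 - p)) \<le> C)) \<and>
    (\<forall>p. weak_bound N m p \<longleftrightarrow> (\<exists>C\<ge>0. \<forall>n. K n * exp (real n * (p0 - p)) \<le> C))"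
proof -
  define x where "x n = K n * exp (real n * (p0 - 1))" for n
  define N where "N n = nat \<lfloor>x n\<rfloor>" for n
  define M :: "nat \<Rightarrow> real" where "M n = exp (real n)" for n
  have x: "1 \<le> x n" for n
    unfolding x_def using K[of n] p0 mult_mono[of 1 "K n" 1 "exp (real n * (p0 - 1))"] by simp
  have eq: "x n * M n powr (1 - p) = K n * exp (real n * (p0 - p))" for n p
    by (simp add: x_def M_def powr_def algebra_simps flip: exp_add)
  have lo: "K n * exp (real n * (p0 - p)) \<le> 2 * (real (N n) * M n powr (1 - p))" for n p
  proof -
    have "x n / 2 * M n powr (1 - p) \<le> real (N n) * M n powr (1 - p)"
      using half_le_nat_floor[OF x[of n]] by (intro mult_right_mono) (auto simp: N_def)
    then show ?thesis using eq[of n p] by simp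
  qed
  have hi: "real (N n) * M n powr (1 - p) \<le> K n * exp (real n * (p0 - p))" for n p
  proof -
    have "real (N n) \<le> x n" using x[of n] by (simp add: N_def)
    then show ?thesis unfolding eq[symmetric] by (intro mult_right_mono) auto
  qed
  have s: "strong_bound N (\<lambda>n i. M n) p \<longleftrightarrow> (\<exists>C\<ge>0. \<forall>n. K n * exp (real n * (p0 - p)) \<le> C)" for p
  proof
    assume "strong_bound N (\<lambda>n i. M n) p"
    then obtain C where C: "0 \<le> C" "\<And>n. real (N n) * M n powr (1 - p) \<le> C"
      unfolding strong_bound_const by blast
    have "K n * exp (real n * (p0 - p)) \<le> 2 * C" for n using lo[of n p] C(2)[of n] by linarith
    then show "\<exists>C\<ge>0. \<forall>n. K n * exp (real n * (p0 - p)) \<le> C"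
      using C(1) by (intro exI[of _ "2 * C"]) auto
  next
    assume "\<exists>C\<ge>0. \<forall>n. K n * exp (real n * (p0 - p)) \<le> C"
    then show "strong_bound N (\<lambda>n i. M n) p"
      unfolding strong_bound_const using hi by (meson order_trans)
  qed
  have M: "1 \<le> M n" for n by (simp add: M_def)
  show ?thesis
    by (intro exI[of _ N] exI[of _ "\<lambda>n i. M n"]) (simp add: weak_bound_const M s)
qed

lemma star_sequence_closed:
  assumes p0: "1 \<le> p0"
  shows "\<exists>N m. (\<forall>n i. i < N n \<longrightarrow> 1 \<le> m n i) \<and>
    (\<forall>p. strong_bound N m p \<longleftrightarrow> p0 \<le> p) \<and> (\<forall>p. weak_bound N m p \<longleftrightarrow> p0 \<le> p)"
proof -
  have "(\<exists>C\<ge>0. \<forall>n. 1 * exp (real n * (p0 - p)) \<le> C) \<longleftrightarrow> p0 \<le> p" for p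
  proof
    assume "\<exists>C\<ge>0. \<forall>n. 1 * exp (real n * (p0 - p)) \<le> C"
    then obtain C where C: "\<And>n. exp (real n * (p0 - p)) \<le> C" by auto
    show "p0 \<le> p"
    proof (rule ccontr)
      assume "\<not> p0 \<le> p"
      then obtain n :: nat where "C < exp (real n * (p0 - p))" using exp_unbounded[of "p0 - p" C] by auto
      with C[of n] show False by simp
    qed
  next
    assume "p0 \<le> p"
    then show "\<exists>C\<ge>0. \<forall>n. 1 * exp (real n * (p0 - p)) \<le> C"
      by (intro exI[of _ 1]) (auto simp: mult_nonneg_nonpos)
  qed
  with star_sequence_const[of "\<lambda>_. 1", OF order_refl p0] show ?thesis by simp
qed

text \<open>K n = n + 1 is unbounded, which excludes p0, but loses against every exponential
  decay.\<close>

lemma star_sequence_open: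
  assumes p0: "1 \<le> p0"
  shows "\<exists>N m. (\<forall>n i. i < N n \<longrightarrow> 1 \<le> m n i) \<and>
    (\<forall>p. strong_bound N m p \<longleftrightarrow> p0 < p) \<and> (\<forall>p. weak_bound N m p \<longleftrightarrow> p0 < p)"
proof -
  have "(\<exists>C\<ge>0. \<forall>n. (real n + 1) * exp (real n * (p0 - p)) \<le> C) \<longleftrightarrow> p0 < p" for p
  proof
    assume "\<exists>C\<ge>0. \<forall>n. (real n + 1) * exp (real n * (p0 - p)) \<le> C"
    then obtain C where C: "\<And>n. (real n + 1) * exp (real n * (p0 - p)) \<le> C" by blast
    show "p0 < p"
    proof (rule ccontr)
      assume "\<not> p0 < p"
      then have "real n * 1 \<le> (real n + 1) * exp (real n * (p0 - p))" for n
        by (intro mult_mono) auto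
      then have "real n \<le> C" for n using C[of n] by (metis mult.right_neutral order_trans)
      then show False using reals_Archimedean2[of C] by (auto simp: not_less[symmetric])
    qed
  next
    assume "p0 < p"
    define \<delta> where "\<delta> = p - p0"
    have \<delta>: "0 < \<delta>" using \<open>p0 < p\<close> by (simp add: \<delta>_def)
    have "(real n + 1) * exp (real n * (p0 - p)) \<le> 1 + 1 / \<delta>" for n
    proof -
      have e: "exp (real n * (p0 - p)) = 1 / exp (real n * \<delta>)"
        by (simp add: \<delta>_def exp_minus[symmetric] inverse_eq_divide[symmetric] algebra_simps)
      have "real n + 1 \<le> (1 + 1 / \<delta>) * (1 + real n * \<delta>)"
        using \<delta> by (simp add: field_simps)
      also have "\<dots> \<le> (1 + 1 / \<delta>) * exp (real n * \<delta>)"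
        using \<delta> exp_ge_add_one_self[of "real n * \<delta>"] by (intro mult_left_mono) (auto simp: add.commute)
      finally show ?thesis by (simp add: e divide_le_eq)
    qed
    then show "\<exists>C\<ge>0. \<forall>n. (real n + 1) * exp (real n * (p0 - p)) \<le> C"
      using \<delta> by (intro exI[of _ "1 + 1 / \<delta>"]) auto
  qed
  with star_sequence_const[of "\<lambda>n. real n + 1", OF _ p0] show ?thesis by simp
qed

lemma sum_powers_le:
  fixes x :: real
  assumes "2 \<le> x" shows "(\<Sum>k\<le>J. x ^ k) \<le> 2 * x ^ J"
proof (induction J)
  case (Suc J)
  have "2 * x ^ J \<le> x * x ^ J" using assms by (intro mult_right_mono) auto
  then show ?case using Suc by simp
qed simp

text \<open>Star n has leaves of all weights exp j with j < n, about exp (j (p0 - 1)) of each. The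
  strong sum is comparable to the sum of exp (j (p0 - p)), of order n at p = p0. The leaves up to
  weight exp J, however, have a geometric sum dominated by its last term exp (J p0), the p0-th power
  of the heaviest leaf.\<close>

lemma star_sequence_half_open:
  assumes p0: "1 \<le> p0"
  shows "\<exists>N m. (\<forall>n i. i < N n \<longrightarrow> 1 \<le> m n i) \<and>
    (\<forall>p. strong_bound N m p \<longleftrightarrow> p0 < p) \<and> (\<forall>p. weak_bound N m p \<longleftrightarrow> p0 \<le> p)"
proof -
  define \<tau> where "\<tau> j = nat \<lfloor>exp (real j * (p0 - 1))\<rfloor>" for j :: nat
  have x: "1 \<le> exp (real j * (p0 - 1))" for j :: nat using p0 by simp
  have \<tau>: "exp (real j * (p0 - 1)) / 2 \<le> real (\<tau> j)" "real (\<tau> j) \<le> exp (real j * (p0 - 1))" "1 \<le> \<tau> j" for j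
    using half_le_nat_floor[OF x[of j]] x[of j] by (simp_all add: \<tau>_def le_nat_floor)
  define N where "N n = (\<Sum>j<n. \<tau> j)" for n
  have N_Suc: "N (Suc n) = N n + \<tau> n" for n by (simp add: N_def)
  have N_mono: "N a \<le> N b" if "a \<le> b" for a b
    unfolding N_def using that by (intro sum_mono2) auto
  have N_ge: "n \<le> N n" for n :: nat
  proof (induction n)
    case (Suc n) then show ?case using \<tau>(3)[of n] by (simp add: N_Suc)
  qed simp
  \<comment> \<open>Leaves are listed by increasing weight, and g i is the scale of leaf i. It does
    not depend on n: longer stars only append leaves.\<close>
  define g where "g i = (LEAST j. i < N (Suc j))" for i
  have g_le: "g i \<le> j \<longleftrightarrow> i < N (Suc j)" for i j
  proof
    assume "g i \<le> j"
    have "i < N (Suc i)" using N_ge[of "Suc i"] by simp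
    then have "i < N (Suc (g i))" unfolding g_def by (rule LeastI)
    also have "\<dots> \<le> N (Suc j)" using \<open>g i \<le> j\<close> by (intro N_mono) simp
    finally show "i < N (Suc j)" .
  qed (simp add: g_def Least_le)
  have g_eq: "g i = j" if "N j \<le> i" "i < N (Suc j)" for i j
  proof -
    have "\<not> g i \<le> k" if "k < j" for k
      using g_le[of i k] N_mono[of "Suc k" j] \<open>N j \<le> i\<close> that by auto
    then have "\<not> g i < j" by blast
    moreover have "g i \<le> j" using g_le[of i j] that(2) by simp
    ultimately show ?thesis by simp
  qed
  have sum_g: "(\<Sum>i<N n. \<phi> (g i)) = (\<Sum>j<n. real (\<tau> j) * \<phi> j)" for n and \<phi> :: "nat \<Rightarrow> real"
  proof (induction n)
    case (Suc n)
    have "(\<Sum>i<N (Suc n). \<phi> (g i)) = (\<Sum>i<N n. \<phi> (g i)) + (\<Sum>i\<in>{N n..<N (Suc n)}. \<phi> (g i))"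
      using N_mono[of n "Suc n"] by (subst sum.atLeastLessThan_concat[of 0, symmetric, simplified atLeast0LessThan]) auto
    also have "(\<Sum>i\<in>{N n..<N (Suc n)}. \<phi> (g i)) = (\<Sum>i\<in>{N n..<N (Suc n)}. \<phi> n)"
      by (intro sum.cong) (auto simp: g_eq)
    also have "\<dots> = real (\<tau> n) * \<phi> n" by (simp add: N_Suc)
    finally show ?case using Suc by simp
  qed (simp add: N_def)
  define m :: "nat \<Rightarrow> nat \<Rightarrow> real" where "m n i = exp (real (g i))" for n i
  have strong: "strong_bound N m p \<longleftrightarrow> p0 < p" for p
  proof -
    have eq: "(\<Sum>i<N n. m n i powr (1 - p)) = (\<Sum>j<n. real (\<tau> j) * exp (real j) powr (1 - p))" for n
      unfolding m_def by (rule sum_g)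
    show ?thesis
    proof
      assume "strong_bound N m p"
      then obtain C where C: "\<And>n. (\<Sum>j<n. real (\<tau> j) * exp (real j) powr (1 - p)) \<le> C"
        unfolding strong_bound_def eq by blast
      show "p0 < p"
      proof (rule ccontr)
        assume "\<not> p0 < p"
        have "1 / 2 \<le> real (\<tau> j) * exp (real j) powr (1 - p)" for j
        proof -
          have "1 / 2 * exp 0 \<le> 1 / 2 * exp (real j * (p0 - p))"
            using \<open>\<not> p0 < p\<close> by (intro mult_left_mono) auto
          also have "\<dots> = exp (real j * (p0 - 1)) / 2 * exp (real j) powr (1 - p)"
            by (simp add: powr_def algebra_simps flip: exp_add)
          also have "\<dots> \<le> real (\<tau> j) * exp (real j) powr (1 - p)" by (intro mult_right_mono \<tau>) auto
          finally show ?thesis by simp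
        qed
        then have "(\<Sum>j<n. 1 / 2) \<le> C" for n :: nat using C[of n] by (meson order_trans sum_mono)
        then have "real n \<le> 2 * C" for n :: nat by (simp add: mult.commute)
        then show False using reals_Archimedean2[of "2 * C"] by (auto simp: not_less[symmetric])
      qed
    next
      assume "p0 < p"
      define y where "y = exp (p0 - p)"
      have y: "0 < y" "y < 1" using \<open>p0 < p\<close> by (auto simp: y_def)
      have "(\<Sum>j<n. real (\<tau> j) * exp (real j) powr (1 - p)) \<le> 1 / (1 - y)" for n
      proof -
        have "(\<Sum>j<n. real (\<tau> j) * exp (real j) powr (1 - p)) \<le> (\<Sum>j<n. y ^ j)"
        proof (intro sum_mono)
          fix j
          have "real (\<tau> j) * exp (real j) powr (1 - p) \<le> exp (real j * (p0 - 1)) * exp (real j) powr (1 - p)"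
            by (intro mult_right_mono \<tau>) auto
          also have "\<dots> = y ^ j" by (simp add: y_def powr_def algebra_simps flip: exp_add exp_of_nat_mult)
          finally show "real (\<tau> j) * exp (real j) powr (1 - p) \<le> y ^ j" .
        qed
        also have "\<dots> \<le> (\<Sum>j. y ^ j)" using y by (intro sum_le_suminf summable_geometric) auto
        also have "\<dots> = 1 / (1 - y)" using y by (simp add: suminf_geometric)
        finally show ?thesis .
      qed
      then show "strong_bound N m p" unfolding strong_bound_def eq using y
        by (intro exI[of _ "1 / (1 - y)"]) auto
    qed
  qed
  have psum: "(\<Sum>i | i < N n \<and> m n i \<le> m n j. m n i) = (\<Sum>k\<le>g j. real (\<tau> k) * exp (real k))" if "j < N n" for n j
  proof -
    have "n \<noteq> 0" using that by (cases "n = 0") (auto simp: N_def)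
    then have "g j \<le> n - 1" using g_le[of j "n - 1"] that by simp
    then have "N (Suc (g j)) \<le> N n" using \<open>n \<noteq> 0\<close> by (intro N_mono) simp
    then have "{i. i < N n \<and> m n i \<le> m n j} = {..<N (Suc (g j))}"
      by (auto simp: m_def g_le)
    then show ?thesis unfolding m_def using sum_g[of "\<lambda>k. exp (real k)" "Suc (g j)"] by (simp add: lessThan_Suc_atMost)
  qed
  have weak: "weak_bound N m p \<longleftrightarrow> p0 \<le> p" for p
  proof
    assume "weak_bound N m p"
    then obtain C where C: "\<And>n j. j < N n \<Longrightarrow> (\<Sum>i | i < N n \<and> m n i \<le> m n j. m n i) \<le> C * m n j powr p"
      unfolding weak_bound_def by blast
    have "exp (real J * (p0 - p)) \<le> 2 * C" for J
    proof -
      have gJ: "g (N J) = J" "N J < N (Suc J)" using g_eq[of J "N J"] \<tau>(3)[of J] by (auto simp: N_Suc)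
      have "exp (real J * (p0 - 1)) / 2 * exp (real J) \<le> real (\<tau> J) * exp (real J)" by (intro mult_right_mono \<tau>) auto
      also have "\<dots> \<le> (\<Sum>k\<le>J. real (\<tau> k) * exp (real k))"
        by (rule member_le_sum[of J "{..J}" "\<lambda>k. real (\<tau> k) * exp (real k)"]) auto
      also have "\<dots> \<le> C * exp (real J) powr p"
        using C[OF gJ(2)] psum[OF gJ(2)] by (simp add: m_def gJ(1))
      finally have "exp (real J * (p0 - 1)) / 2 * exp (real J) \<le> C * exp (real J) powr p" .
      then have "(exp (real J * (p0 - 1)) * exp (real J)) * exp (- (real J * p)) \<le> (2 * C * exp (real J) powr p) * exp (- (real J * p))"
        by (intro mult_right_mono) auto
      then show ?thesis by (simp add: powr_def mult.assoc algebra_simps flip: exp_add)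
    qed
    then show "p0 \<le> p" using exp_unbounded[of "p0 - p" "2 * C"] by (meson diff_gt_0_iff_gt not_less)
  next
    assume "p0 \<le> p"
    have "(\<Sum>i | i < N n \<and> m n i \<le> m n j. m n i) \<le> 2 * m n j powr p" if "j < N n" for n j
    proof -
      have "(\<Sum>k\<le>g j. real (\<tau> k) * exp (real k)) \<le> (\<Sum>k\<le>g j. exp p0 ^ k)"
      proof (intro sum_mono)
        fix k
        have "real (\<tau> k) * exp (real k) \<le> exp (real k * (p0 - 1)) * exp (real k)" by (intro mult_right_mono \<tau>) auto
        also have "\<dots> = exp p0 ^ k" by (simp add: algebra_simps flip: exp_add exp_of_nat_mult)
        finally show "real (\<tau> k) * exp (real k) \<le> exp p0 ^ k" .
      qed
      also have "\<dots> \<le> 2 * exp p0 ^ g j"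
      proof (intro sum_powers_le)
        show "2 \<le> exp p0" using exp_ge_add_one_self[of p0] p0 by linarith
      qed
      also have "exp p0 ^ g j = exp (real (g j)) powr p0" by (simp add: powr_def mult.commute flip: exp_of_nat_mult)
      also have "\<dots> \<le> exp (real (g j)) powr p" using \<open>p0 \<le> p\<close> by (intro powr_mono) auto
      finally show ?thesis unfolding psum[OF that] by (simp add: m_def)
    qed
    then show "weak_bound N m p" unfolding weak_bound_def by (intro exI[of _ 2]) auto
  qed
  show ?thesis by (intro exI[of _ N] exI[of _ m]) (simp add: strong weak m_def)
qed

lemma closure_exp_set:
  "closure {\<infinity>::ereal} = {\<infinity>}" "closure {ereal a..} = {ereal a..}" "closure {ereal a<..} \<subseteq> {ereal a..}"
  using closure_minimal[of "{ereal a<..}" "{ereal a..}"] by (auto simp: less_imp_le subset_iff)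

text \<open>Between P and its closure there is room only for Q = P, or for Q = [p0, \<infinity>]
  when P = (p0, \<infinity>]. The resulting four cases match the four constructions above.\<close>

lemma star_sequence:
  assumes "exp_set_form P" "exp_set_form Q" "P \<subseteq> Q" "Q \<subseteq> closure P"
  shows "\<exists>N m. (\<forall>n i. i < N n \<longrightarrow> 1 \<le> m n i) \<and>
    (\<forall>p\<ge>1. (strong_bound N m p \<longleftrightarrow> ereal p \<in> P) \<and> (weak_bound N m p \<longleftrightarrow> ereal p \<in> Q))"
proof -
  consider "P = {\<infinity>}" | p0 where "1 \<le> p0" "P = {ereal p0..}" | p0 where "1 \<le> p0" "P = {ereal p0<..}"
    using assms(1) by (auto simp: exp_set_form_def)
  then show ?thesis
  proof cases
    case 1
    then have "Q = {\<infinity>}" using assms(3,4) closure_exp_set(1) by auto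
    then show ?thesis using 1 star_sequence_infinity by simp
  next
    case (2 p0)
    then have "Q = P" using assms(3,4) closure_exp_set(2) by auto
    moreover obtain N m where "\<forall>n i. i < N n \<longrightarrow> 1 \<le> m n i"
      "\<forall>p. strong_bound N m p \<longleftrightarrow> p0 \<le> p" "\<forall>p. weak_bound N m p \<longleftrightarrow> p0 \<le> p"
      using star_sequence_closed[OF 2(1)] by blast
    ultimately show ?thesis using 2 by (intro exI[of _ N] exI[of _ m]) simp
  next
    case (3 p0)
    then have Q: "{ereal p0<..} \<subseteq> Q" "Q \<subseteq> {ereal p0..}" using assms(3,4) closure_exp_set(3) by auto
    show ?thesis
    proof (cases "ereal p0 \<in> Q")
      case True
      have "{ereal p0..} = insert (ereal p0) {ereal p0<..}" by auto
      then have "Q = {ereal p0..}" using Q True by auto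
      moreover obtain N m where "\<forall>n i. i < N n \<longrightarrow> 1 \<le> m n i"
        "\<forall>p. strong_bound N m p \<longleftrightarrow> p0 < p" "\<forall>p. weak_bound N m p \<longleftrightarrow> p0 \<le> p"
        using star_sequence_half_open[OF 3(1)] by blast
      ultimately show ?thesis using 3 by (intro exI[of _ N] exI[of _ m]) simp
    next
      case False
      then have "x \<in> {ereal p0<..}" if "x \<in> Q" for x using Q(2) that by (auto simp: order.order_iff_strict)
      then have "Q = {ereal p0<..}" using Q(1) by auto
      moreover obtain N m where "\<forall>n i. i < N n \<longrightarrow> 1 \<le> m n i"
        "\<forall>p. strong_bound N m p \<longleftrightarrow> p0 < p" "\<forall>p. weak_bound N m p \<longleftrightarrow> p0 < p"
        using star_sequence_open[OF 3(1)] by blast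
      ultimately show ?thesis using 3 by (intro exI[of _ N] exI[of _ m]) simp
    qed
  qed
qed

text \<open>If 1 lies in the closure, P is [1, \<infinity>] or (1, \<infinity>]. So when the weak
  set is everything, only membership of 1 in the strong set is open.\<close>

lemma mem_of_closure_eq_all:
  assumes "exp_set_form P" "{1..} \<subseteq> closure P" "1 < p"
  shows "p \<in> P"
proof -
  have 1: "(1::ereal) \<in> closure P" using assms(2) by auto
  consider "P = {\<infinity>}" | p0 where "1 \<le> p0" "P = {ereal p0..}" | p0 where "1 \<le> p0" "P = {ereal p0<..}"
    using assms(1) by (auto simp: exp_set_form_def)
  then show ?thesis
  proof cases
    case 1
    then show ?thesis using \<open>1 \<in> closure P\<close> closure_exp_set(1) by auto
  next
    case (2 p0)
    then have "ereal p0 \<le> 1" using 1 closure_exp_set(2) by auto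
    then show ?thesis using 2 less_imp_le[OF assms(3)] order_trans[of "ereal p0" 1 p] by auto
  next
    case (3 p0)
    then have "1 \<in> {ereal p0..}" using 1 closure_exp_set(3)[of p0] by blast
    then show ?thesis using 3 le_less_trans[of "ereal p0" 1 p] assms(3) by auto
  qed
qed

section \<open>Change of the underlying set\<close>

text \<open>The glued space lives on the type \<open>pt\<close>, but a subset of the reals is
  wanted, so metric, weights and operators are transported along an injection.\<close>

locale discrete_mm_embedding = discrete_mm X d w for X :: "'a set" and d w +
  fixes \<phi> :: "'a \<Rightarrow> 'b"
  assumes inj: "inj \<phi>"
begin

abbreviation X' where "X' \<equiv> \<phi> ` X"
abbreviation d' where "d' \<equiv> \<lambda>x y. d (inv \<phi> x) (inv \<phi> y)"
abbreviation w' where "w' \<equiv> \<lambda>x. w (inv \<phi> x)"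

lemma inv_phi [simp]: "inv \<phi> (\<phi> x) = x"
  using inj by simp

lemma phi_eq_iff [simp]: "\<phi> x = \<phi> y \<longleftrightarrow> x = y"
  by (rule inj_eq[OF inj])

lemma phi_in_image [simp]: "\<phi> x \<in> \<phi> ` S \<longleftrightarrow> x \<in> S"
  by (rule inj_image_mem_iff[OF inj])

lemma metric_image: "Metric_space X' d'"
proof
  show "d' x z \<le> d' x y + d' y z" if "x \<in> X'" "y \<in> X'" "z \<in> X'" for x y z
    using that triangle by auto
qed (auto simp: commute)

lemma mball_image: "Metric_space.mball X' d' (\<phi> x) s = \<phi> ` mball x s"
  by (auto simp: Metric_space.mball_def[OF metric_image] mball_def image_iff)

lemma nn_integral_image:
  "(\<integral>\<^sup>+y. g y \<partial>density (count_space X') (\<lambda>x. ennreal (w' x))) = (\<integral>\<^sup>+x. g (\<phi> x) \<partial>\<mu>)"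
proof -
  have bij: "bij_betw \<phi> X X'" using inj_on_subset[OF inj] by (simp add: bij_betw_def)
  have "(\<integral>\<^sup>+y. g y \<partial>density (count_space X') (\<lambda>x. ennreal (w' x)))
      = (\<integral>\<^sup>+y. ennreal (w' y) * g y \<partial>count_space X')"
    by (rule nn_integral_density) auto
  also have "\<dots> = (\<integral>\<^sup>+x. ennreal (w' (\<phi> x)) * g (\<phi> x) \<partial>count_space X)"
    by (rule nn_integral_bij_count_space[OF bij, symmetric])
  finally show ?thesis by (simp add: nn_integral_mu)
qed

lemma emeasure_image:
  assumes "S \<subseteq> X"
  shows "emeasure (density (count_space X') (\<lambda>x. ennreal (w' x))) (\<phi> ` S) = emeasure \<mu> S"
proof -
  have "emeasure (density (count_space X') (\<lambda>x. ennreal (w' x))) (\<phi> ` S)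
      = (\<integral>\<^sup>+y. indicator (\<phi> ` S) y \<partial>density (count_space X') (\<lambda>x. ennreal (w' x)))"
    using assms by (intro nn_integral_indicator[symmetric]) auto
  also have "\<dots> = (\<integral>\<^sup>+x. indicator S x \<partial>\<mu>)"
    unfolding nn_integral_image by (intro nn_integral_cong) (simp add: indicator_def)
  also have "\<dots> = emeasure \<mu> S" using assms by (intro nn_integral_indicator) auto
  finally show ?thesis .
qed

sublocale image: discrete_mm X' d' w'
proof -
  interpret M: Metric_space X' d' by (rule metric_image)
  show "discrete_mm X' d' w'"
  proof
    show "X' \<noteq> {}" using X_nonempty by simp
    show "countable X'" using X_countable by simp
    show "0 < w' x" if "x \<in> X'" for x using that w_pos by auto
    show "\<exists>r>0. M.mball x r = {x}" if "x \<in> X'" for x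
      using that discrete by (auto simp: mball_image) (metis image_empty image_insert)
    show "emeasure (density (count_space X') (\<lambda>x. ennreal (w' x))) X' < \<infinity>"
      using emeasure_image[of X] emeasure_mu_less_top[of X] by simp
  qed
qed

lemma nn_integral_image_mu: "(\<integral>\<^sup>+y. g y \<partial>image.\<mu>) = (\<integral>\<^sup>+x. g (\<phi> x) \<partial>\<mu>)"
  unfolding image.\<mu>_def by (rule nn_integral_image)

lemma emeasure_image_mu: "S \<subseteq> X \<Longrightarrow> emeasure image.\<mu> (\<phi> ` S) = emeasure \<mu> S"
  unfolding image.\<mu>_def by (rule emeasure_image)

lemma avg_image: "image.avg \<kappa> f (\<phi> y) r = avg \<kappa> (f \<circ> \<phi>) y r"
proof -
  have "(\<integral>\<^sup>+z\<in>\<phi> ` mball y r. ennreal \<bar>f z\<bar> \<partial>image.\<mu>) = (\<integral>\<^sup>+z\<in>mball y r. ennreal \<bar>(f \<circ> \<phi>) z\<bar> \<partial>\<mu>)"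
    unfolding nn_integral_image_mu by (intro nn_integral_cong) (simp add: indicator_def)
  then show ?thesis
    by (simp add: image.avg_def avg_def mball_image emeasure_image_mu[OF mball_subset])
qed

lemma cmax_image: "cmax X' d' image.\<mu> \<kappa> f (\<phi> x) = cmax X d \<mu> \<kappa> (f \<circ> \<phi>) x"
proof (rule antisym)
  show "cmax X' d' image.\<mu> \<kappa> f (\<phi> x) \<le> cmax X d \<mu> \<kappa> (f \<circ> \<phi>) x"
    unfolding image.cmax_le_iff avg_image by (auto intro: avg_le_cmax)
  show "cmax X d \<mu> \<kappa> (f \<circ> \<phi>) x \<le> cmax X' d' image.\<mu> \<kappa> f (\<phi> x)"
    unfolding cmax_le_iff avg_image[symmetric] by (auto intro: image.avg_le_cmax)
qed

lemma umax_image: "umax X' d' image.\<mu> \<kappa> f (\<phi> x) = umax X d \<mu> \<kappa> (f \<circ> \<phi>) x"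
proof (rule antisym)
  show "umax X' d' image.\<mu> \<kappa> f (\<phi> x) \<le> umax X d \<mu> \<kappa> (f \<circ> \<phi>) x"
    unfolding image.umax_le_iff
  proof (intro ballI allI impI)
    fix y r assume "y \<in> X'" "0 < (r::real)" "\<phi> x \<in> image.mball y r"
    then show "image.avg \<kappa> f y r \<le> umax X d \<mu> \<kappa> (f \<circ> \<phi>) x"
      by (elim imageE) (simp only: avg_image mball_image phi_in_image avg_le_umax)
  qed
  show "umax X d \<mu> \<kappa> (f \<circ> \<phi>) x \<le> umax X' d' image.\<mu> \<kappa> f (\<phi> x)"
    unfolding umax_le_iff avg_image[symmetric]
  proof (intro ballI allI impI)
    fix y r assume "y \<in> X" "0 < (r::real)" "x \<in> mball y r"
    then show "image.avg \<kappa> f (\<phi> y) r \<le> umax X' d' image.\<mu> \<kappa> f (\<phi> x)"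
      by (intro image.avg_le_umax) (simp_all only: mball_image phi_in_image)
  qed
qed

text \<open>Every f on the source is of the form g \<circ> \<phi>, namely with g = f \<circ> inv
  \<phi>.\<close>

lemma all_functions_iff: "(\<forall>f :: 'b \<Rightarrow> real. P (f \<circ> \<phi>)) \<longleftrightarrow> (\<forall>f :: 'a \<Rightarrow> real. P f)"
proof
  assume *: "\<forall>f :: 'b \<Rightarrow> real. P (f \<circ> \<phi>)"
  show "\<forall>f. P f"
  proof
    fix f :: "'a \<Rightarrow> real"
    have "f \<circ> inv \<phi> \<circ> \<phi> = f" by auto
    then show "P f" using * by metis
  qed
qed simp

lemma doubling_image: "doubling X' d' image.\<mu> \<longleftrightarrow> doubling X d \<mu>"
  by (simp add: doubling_def mball_image emeasure_image_mu[OF mball_subset])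

lemma strong_type_image:
  assumes T: "\<And>f x. x \<in> X \<Longrightarrow> T' f (\<phi> x) = T (f \<circ> \<phi>) x"
  shows "strong_type image.\<mu> T' p \<longleftrightarrow> strong_type \<mu> T p"
proof (cases "p = \<infinity>")
  case True
  have "(SUP y\<in>X'. T' f y) = (SUP x\<in>X. T (f \<circ> \<phi>) x)" for f
    unfolding image_image by (intro SUP_cong refl T)
  moreover have "(SUP y\<in>X'. ennreal \<bar>f y\<bar>) = (SUP x\<in>X. ennreal \<bar>(f \<circ> \<phi>) x\<bar>)" for f
    by (simp add: image_image)
  ultimately show ?thesis
    unfolding strong_type_def if_P[OF True] ess_norm_mu image.ess_norm_mu
    by (simp only: Ball_def borel_measurable_mu image.borel_measurable_mu simp_thms
      all_functions_iff[where P = "\<lambda>f. (SUP x\<in>X. ennreal \<bar>f x\<bar>) < \<infinity> \<longrightarrow> (SUP x\<in>X. T f x) \<le> ennreal _ * (SUP x\<in>X. ennreal \<bar>f x\<bar>)"])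
next
  case False
  have "(\<integral>\<^sup>+y. epow (T' f y) r \<partial>image.\<mu>) = (\<integral>\<^sup>+x. epow (T (f \<circ> \<phi>) x) r \<partial>\<mu>)" for f r
    unfolding nn_integral_image_mu by (intro nn_integral_cong) (simp add: T)
  moreover have "(\<integral>\<^sup>+y. ennreal (\<bar>f y\<bar> powr r) \<partial>image.\<mu>) = (\<integral>\<^sup>+x. ennreal (\<bar>(f \<circ> \<phi>) x\<bar> powr r) \<partial>\<mu>)" for f r
    by (simp add: nn_integral_image_mu)
  ultimately show ?thesis
    unfolding strong_type_def if_not_P[OF False] upper_nn_integral_mu image.upper_nn_integral_mu
    by (simp only: Ball_def borel_measurable_mu image.borel_measurable_mu simp_thms
      all_functions_iff[where P = "\<lambda>f. (\<integral>\<^sup>+x. ennreal (\<bar>f x\<bar> powr _) \<partial>\<mu>) < \<infinity> \<longrightarrow> (\<integral>\<^sup>+x. epow (T f x) _ \<partial>\<mu>) \<le> ennreal _ * (\<integral>\<^sup>+x. ennreal (\<bar>f x\<bar> powr _) \<partial>\<mu>)"])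
qed

lemma weak_type_image:
  assumes T: "\<And>f x. x \<in> X \<Longrightarrow> T' f (\<phi> x) = T (f \<circ> \<phi>) x"
  shows "weak_type image.\<mu> T' p \<longleftrightarrow> weak_type \<mu> T p"
proof (cases "p = \<infinity>")
  case True
  then show ?thesis using strong_type_image[where T' = T' and T = T and p = p] T by (simp add: weak_type_def)
next
  case False
  have "outer_meas image.\<mu> {y \<in> space image.\<mu>. ennreal t < T' f y} = outer_meas \<mu> {x \<in> space \<mu>. ennreal t < T (f \<circ> \<phi>) x}" for f t
  proof -
    have "{y \<in> X'. ennreal t < T' f y} = \<phi> ` {x \<in> X. ennreal t < T (f \<circ> \<phi>) x}"
      using T by auto
    moreover have "outer_meas image.\<mu> {y \<in> X'. ennreal t < T' f y} = emeasure image.\<mu> {y \<in> X'. ennreal t < T' f y}"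
      by (rule image.outer_meas_mu) auto
    moreover have "outer_meas \<mu> {x \<in> X. ennreal t < T (f \<circ> \<phi>) x} = emeasure \<mu> {x \<in> X. ennreal t < T (f \<circ> \<phi>) x}"
      by (rule outer_meas_mu) auto
    ultimately show ?thesis by (simp add: emeasure_image_mu)
  qed
  moreover have "(\<integral>\<^sup>+y. ennreal (\<bar>f y\<bar> powr r) \<partial>image.\<mu>) = (\<integral>\<^sup>+x. ennreal (\<bar>(f \<circ> \<phi>) x\<bar> powr r) \<partial>\<mu>)" for f r
    by (simp add: nn_integral_image_mu)
  ultimately show ?thesis
    unfolding weak_type_def if_not_P[OF False]
    by (simp only: Ball_def borel_measurable_mu image.borel_measurable_mu simp_thms
      all_functions_iff[where P = "\<lambda>f. (\<integral>\<^sup>+x. ennreal (\<bar>f x\<bar> powr _) \<partial>\<mu>) < \<infinity> \<longrightarrow> (\<forall>t>0. ennreal (t powr _) * outer_meas \<mu> {x \<in> space \<mu>. ennreal t < T f x} \<le> ennreal _ * (\<integral>\<^sup>+x. ennreal (\<bar>f x\<bar> powr _) \<partial>\<mu>))"])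
qed

end

lemma (in discrete_mm_embedding) maximal_type_image:
  "strong_type image.\<mu> (cmax X' d' image.\<mu> \<kappa>) p \<longleftrightarrow> strong_type \<mu> (cmax X d \<mu> \<kappa>) p"
  "weak_type image.\<mu> (cmax X' d' image.\<mu> \<kappa>) p \<longleftrightarrow> weak_type \<mu> (cmax X d \<mu> \<kappa>) p"
  "strong_type image.\<mu> (umax X' d' image.\<mu> \<kappa>) p \<longleftrightarrow> strong_type \<mu> (umax X d \<mu> \<kappa>) p"
  "weak_type image.\<mu> (umax X' d' image.\<mu> \<kappa>) p \<longleftrightarrow> weak_type \<mu> (umax X d \<mu> \<kappa>) p"
  by (rule strong_type_image weak_type_image, rule cmax_image umax_image)+

context glued
begin

lemma star_bounds_imp_strong:
  assumes "1 \<le> p" "0 \<le> C"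
  shows "(\<And>n. q n = 4 \<Longrightarrow> (\<Sum>i<N n. m n i powr (1 - p)) \<le> C) \<Longrightarrow>
      1 < p \<or> (\<forall>e. lam e \<noteq> \<kappa> \<longrightarrow> \<not> h e) \<Longrightarrow> strong_type \<mu> (cmax X d \<mu> \<kappa>) (ereal p)"
    "(\<And>n. (\<Sum>i<N n. m n i powr (1 - p)) \<le> C) \<Longrightarrow>
      1 < p \<or> (\<forall>e. \<not> h e) \<Longrightarrow> strong_type \<mu> (umax X d \<mu> \<kappa>) (ereal p)"
  using assms
  by (auto intro!: strong_type_of_wild[where C = C and S = "{n. q n = 4}" and E = "{e. lam e \<noteq> \<kappa>}"] cmax_le_wild
      strong_type_of_wild[where T = "umax X d \<mu> \<kappa>" and C = C and S = UNIV and E = UNIV] umax_le_wild)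

lemma star_bounds_imp_weak:
  assumes "1 \<le> p" "0 \<le> C"
  shows "(\<And>n j. q n = 4 \<Longrightarrow> j < N n \<Longrightarrow> (\<Sum>i | i < N n \<and> m n i \<le> m n j. m n i) \<le> C * m n j powr p) \<Longrightarrow>
      weak_type \<mu> (cmax X d \<mu> \<kappa>) (ereal p)"
    "(\<And>n j. j < N n \<Longrightarrow> (\<Sum>i | i < N n \<and> m n i \<le> m n j. m n i) \<le> C * m n j powr p) \<Longrightarrow>
      weak_type \<mu> (umax X d \<mu> \<kappa>) (ereal p)"
  using assms
  by (auto intro!: weak_type_of_wild[where C = C and S = "{n. q n = 4}" and E = "{e. lam e \<noteq> \<kappa>}"] cmax_le_wild
      weak_type_of_wild[where T = "umax X d \<mu> \<kappa>" and C = C and S = UNIV and E = UNIV] umax_le_wild)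

end

theorem theorem3p2p2:
  fixes \<kappa> :: real and Pcs Pcw Ps Pw :: "ereal set"
  assumes "1 \<le> \<kappa>"
    and "exp_set_form Pcs" "exp_set_form Pcw" "exp_set_form Ps" "exp_set_form Pw"
    and "Ps \<subseteq> Pcs" "Pw \<subseteq> Pcw"
    and "Pcs \<subseteq> Pcw" "Pcw \<subseteq> closure Pcs"
    and "Ps \<subseteq> Pw" "Pw \<subseteq> closure Ps"
    and "2 \<le> \<kappa> \<Longrightarrow> Pcw = {1..}"
    and "3 \<le> \<kappa> \<Longrightarrow> Pw = {1..}"
  shows "\<exists>(X::real set) \<rho> \<mu>. mm_space X \<rho> \<mu> \<and> \<not> doubling X \<rho> \<mu> \<and>
     (\<forall>p::ereal. 1 \<le> p \<longrightarrow>
        (strong_type \<mu> (cmax X \<rho> \<mu> \<kappa>) p \<longleftrightarrow> p \<in> Pcs) \<and>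
        (weak_type \<mu> (cmax X \<rho> \<mu> \<kappa>) p \<longleftrightarrow> p \<in> Pcw) \<and>
        (strong_type \<mu> (umax X \<rho> \<mu> \<kappa>) p \<longleftrightarrow> p \<in> Ps) \<and>
        (weak_type \<mu> (umax X \<rho> \<mu> \<kappa>) p \<longleftrightarrow> p \<in> Pw))"
proof -
  have full: "exp_set_form {1..}" "{1..} \<subseteq> closure {1 :: ereal..}"
    by (auto simp: exp_set_form_def one_ereal_def)
  \<comment> \<open>For \<kappa> \<ge> 2 the stars are built for the exponent set [1, \<infinity>]
    and hence constrain nothing; the implication states both cases at once.\<close>
  have "\<exists>N m. (\<forall>n i. i < N n \<longrightarrow> 1 \<le> m n i) \<and>
      (\<forall>p\<ge>1. (strong_bound N m p \<longleftrightarrow> \<kappa> < 2 \<longrightarrow> ereal p \<in> Pcs) \<and> (weak_bound N m p \<longleftrightarrow> \<kappa> < 2 \<longrightarrow> ereal p \<in> Pcw))"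
    using star_sequence[OF assms(2,3,8,9)] star_sequence[OF full(1) full(1) order_refl full(2)]
    by (cases "\<kappa> < 2") (simp_all add: one_ereal_def)
  then obtain N1 m1 where 1: "\<And>n i. i < N1 n \<Longrightarrow> 1 \<le> m1 n i"
    "\<And>p. 1 \<le> p \<Longrightarrow> strong_bound N1 m1 p \<longleftrightarrow> \<kappa> < 2 \<longrightarrow> ereal p \<in> Pcs"
    "\<And>p. 1 \<le> p \<Longrightarrow> weak_bound N1 m1 p \<longleftrightarrow> \<kappa> < 2 \<longrightarrow> ereal p \<in> Pcw" by blast
  have "\<exists>N m. (\<forall>n i. i < N n \<longrightarrow> 1 \<le> m n i) \<and>
      (\<forall>p\<ge>1. (strong_bound N m p \<longleftrightarrow> \<kappa> < 3 \<longrightarrow> ereal p \<in> Ps) \<and> (weak_bound N m p \<longleftrightarrow> \<kappa> < 3 \<longrightarrow> ereal p \<in> Pw))"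
    using star_sequence[OF assms(4,5,10,11)] star_sequence[OF full(1) full(1) order_refl full(2)]
    by (cases "\<kappa> < 3") (simp_all add: one_ereal_def)
  then obtain N2 m2 where 2: "\<And>n i. i < N2 n \<Longrightarrow> 1 \<le> m2 n i"
    "\<And>p. 1 \<le> p \<Longrightarrow> strong_bound N2 m2 p \<longleftrightarrow> \<kappa> < 3 \<longrightarrow> ereal p \<in> Ps"
    "\<And>p. 1 \<le> p \<Longrightarrow> weak_bound N2 m2 p \<longleftrightarrow> \<kappa> < 3 \<longrightarrow> ereal p \<in> Pw" by blast
  \<comment> \<open>Even indices carry the stars for the centred sets, odd ones, with leaf distance
    2, those for the noncentred sets.\<close>
  define N where "N n = (if even n then N1 (n div 2) else N2 (n div 2))" for n
  define m where "m n = (if even n then m1 (n div 2) else m2 (n div 2))" for n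
  define q :: "nat \<Rightarrow> real" where "q n = (if even n then 4 else 2)" for n
  \<comment> \<open>A chain is present only where \<kappa> is too large for stars and p = 1 has to
    be excluded.\<close>
  define h where "h e = (if e then 3 \<le> \<kappa> \<and> 1 \<notin> Ps else 2 \<le> \<kappa> \<and> 1 \<notin> Pcs)" for e
  \<comment> \<open>The maximum with 2 meets the locale assumption; whenever chain
    \<open>True\<close> is present, \<kappa> \<ge> 3 and the value is \<kappa>.\<close>
  define lam where "lam e = (if e then max \<kappa> 2 else 4 * \<kappa>)" for e
  have q4: "q n = 4 \<longleftrightarrow> even n" for n by (simp add: q_def)
  interpret G: glued \<kappa> N m q h lam
    using assms(1) 1(1) 2(1) by unfold_locales (auto simp: N_def m_def q_def lam_def)
  interpret E: discrete_mm_embedding G.X G.d G.w "real \<circ> to_nat"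
    by unfold_locales (auto intro: inj_compose)
  have two: "1 < p \<Longrightarrow> ereal p \<in> Pcs" "1 \<le> p \<Longrightarrow> ereal p \<in> Pcw" if "2 \<le> \<kappa>" for p
    using that assms(2,9,12) mem_of_closure_eq_all[of Pcs "ereal p"] by (auto simp: one_ereal_def)
  have three: "1 < p \<Longrightarrow> ereal p \<in> Ps" "1 \<le> p \<Longrightarrow> ereal p \<in> Pw" if "3 \<le> \<kappa>" for p
    using that assms(4,11,13) mem_of_closure_eq_all[of Ps "ereal p"] by (auto simp: one_ereal_def)
  have split: "(\<forall>n. even n \<longrightarrow> P n) \<longleftrightarrow> (\<forall>n. P (2 * n))" "(\<forall>n. odd n \<longrightarrow> P n) \<longleftrightarrow> (\<forall>n. P (Suc (2 * n)))"
    for P :: "nat \<Rightarrow> bool" by (auto elim!: evenE oddE)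
  have real_case: "(strong_type G.\<mu> (cmax G.X G.d G.\<mu> \<kappa>) (ereal p) \<longleftrightarrow> ereal p \<in> Pcs) \<and>
        (weak_type G.\<mu> (cmax G.X G.d G.\<mu> \<kappa>) (ereal p) \<longleftrightarrow> ereal p \<in> Pcw) \<and>
        (strong_type G.\<mu> (umax G.X G.d G.\<mu> \<kappa>) (ereal p) \<longleftrightarrow> ereal p \<in> Ps) \<and>
        (weak_type G.\<mu> (umax G.X G.d G.\<mu> \<kappa>) (ereal p) \<longleftrightarrow> ereal p \<in> Pw)" if p: "1 \<le> p" for p
  proof -
    let ?s = "\<lambda>n. \<Sum>i<N n. m n i powr (1 - p)"
    let ?w = "\<lambda>C n. \<forall>j<N n. (\<Sum>i | i < N n \<and> m n i \<le> m n j. m n i) \<le> C * m n j powr p"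
    have s1: "strong_bound N1 m1 p \<longleftrightarrow> (\<exists>C\<ge>0. \<forall>n. even n \<longrightarrow> ?s n \<le> C)"
      and s2: "strong_bound N2 m2 p \<longleftrightarrow> (\<exists>C\<ge>0. \<forall>n. odd n \<longrightarrow> ?s n \<le> C)"
      and w1: "weak_bound N1 m1 p \<longleftrightarrow> (\<exists>C\<ge>0. \<forall>n. even n \<longrightarrow> ?w C n)"
      and w2: "weak_bound N2 m2 p \<longleftrightarrow> (\<exists>C\<ge>0. \<forall>n. odd n \<longrightarrow> ?w C n)"
      unfolding split by (simp_all add: strong_bound_def weak_bound_def N_def m_def)
    have s12: "\<exists>C\<ge>0. \<forall>n. ?s n \<le> C" if "strong_bound N1 m1 p" "strong_bound N2 m2 p"
    proof -
      obtain C1 C2 where "0 \<le> C1" "\<And>n. even n \<Longrightarrow> ?s n \<le> C1" "\<And>n. odd n \<Longrightarrow> ?s n \<le> C2"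
        using \<open>strong_bound N1 m1 p\<close> \<open>strong_bound N2 m2 p\<close> unfolding s1 s2 by blast
      then show ?thesis by (intro exI[of _ "max C1 C2"]) (auto simp: le_max_iff_disj)
    qed
    have w12: "\<exists>C\<ge>0. \<forall>n. ?w C n" if "weak_bound N1 m1 p" "weak_bound N2 m2 p"
    proof -
      obtain C1 C2 where C: "0 \<le> C1" "\<And>n. even n \<Longrightarrow> ?w C1 n" "\<And>n. odd n \<Longrightarrow> ?w C2 n"
        using \<open>weak_bound N1 m1 p\<close> \<open>weak_bound N2 m2 p\<close> unfolding w1 w2 by blast
      have "?w (max C1 C2) n" for n
      proof (cases "even n")
        case True
        have "C1 * m n j powr p \<le> max C1 C2 * m n j powr p" for j by (intro mult_right_mono) auto
        with C(2)[OF True] show ?thesis by (blast intro: order_trans)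
      next
        case False
        have "C2 * m n j powr p \<le> max C1 C2 * m n j powr p" for j by (intro mult_right_mono) auto
        with C(3)[OF False] show ?thesis by (blast intro: order_trans)
      qed
      then show ?thesis using C(1) by (intro exI[of _ "max C1 C2"]) auto
    qed
    \<comment> \<open>Chain \<open>True\<close>, when present, has ratio \<kappa> and is exempt;
      chain \<open>False\<close> is absent as soon as 1 lies in Pcs.\<close>
    have chain_c: "1 < p \<or> (\<forall>e. lam e \<noteq> \<kappa> \<longrightarrow> \<not> h e)" if "ereal p \<in> Pcs"
      using that p by (cases "p = 1") (auto simp: h_def lam_def one_ereal_def split: if_splits)
    have chain_u: "1 < p \<or> (\<forall>e. \<not> h e)" if "ereal p \<in> Ps"
      using that p assms(6) by (cases "p = 1") (auto simp: h_def one_ereal_def split: if_splits)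
    have cs: "ereal p \<in> Pcs" if st: "strong_type G.\<mu> (cmax G.X G.d G.\<mu> \<kappa>) (ereal p)"
    proof (cases "\<kappa> < 2")
      case True
      have "\<exists>C\<ge>0. \<forall>n\<in>{n. even n}. ?s n \<le> C"
        by (rule G.star_strong_necessary[OF st p]) (use True in \<open>auto intro!: G.cmax_leaf_ge simp: q4\<close>)
      then show ?thesis using 1(2)[OF p] True unfolding s1 by auto
    next
      case False
      show ?thesis
      proof (rule ccontr)
        assume no: "ereal p \<notin> Pcs"
        then have "p = 1" using two(1) p False by force
        then have "h False" using no False by (simp add: h_def one_ereal_def)
        have "\<not> strong_type G.\<mu> (cmax G.X G.d G.\<mu> \<kappa>) 1"
          by (rule G.chain_strong_one_necessary[where e = False, OF G.cmax_link_ge]) (use \<open>h False\<close> in \<open>auto simp: lam_def\<close>)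
        then show False using st \<open>p = 1\<close> by (simp add: one_ereal_def)
      qed
    qed
    have us: "ereal p \<in> Ps" if st: "strong_type G.\<mu> (umax G.X G.d G.\<mu> \<kappa>) (ereal p)"
    proof (cases "\<kappa> < 3")
      case True
      have "\<exists>C\<ge>0. \<forall>n\<in>UNIV. ?s n \<le> C"
        by (rule G.star_strong_necessary[OF st p]) (use True in \<open>auto intro!: G.umax_leaf_ge\<close>)
      then show ?thesis using 2(2)[OF p] True unfolding s2 by auto
    next
      case False
      show ?thesis
      proof (rule ccontr)
        assume no: "ereal p \<notin> Ps"
        then have "p = 1" using three(1) p False by force
        then have "h True" using no False by (simp add: h_def one_ereal_def)
        have "\<not> strong_type G.\<mu> (umax G.X G.d G.\<mu> \<kappa>) 1"
          by (rule G.chain_strong_one_necessary[where e = True, OF G.umax_link_ge]) (use \<open>h True\<close> False in \<open>auto simp: lam_def\<close>)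
        then show False using st \<open>p = 1\<close> by (simp add: one_ereal_def)
      qed
    qed
    have cw: "ereal p \<in> Pcw" if wt: "weak_type G.\<mu> (cmax G.X G.d G.\<mu> \<kappa>) (ereal p)"
    proof (cases "\<kappa> < 2")
      case True
      have "\<exists>C\<ge>0. \<forall>n\<in>{n. even n}. ?w C n"
        by (rule G.star_weak_necessary[OF wt p]) (use True in \<open>auto intro!: G.cmax_leaf_ge simp: q4\<close>)
      then show ?thesis using 1(3)[OF p] True unfolding w1 by auto
    qed (use two(2) p in auto)
    have uw: "ereal p \<in> Pw" if wt: "weak_type G.\<mu> (umax G.X G.d G.\<mu> \<kappa>) (ereal p)"
    proof (cases "\<kappa> < 3")
      case True
      have "\<exists>C\<ge>0. \<forall>n\<in>UNIV. ?w C n"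
        by (rule G.star_weak_necessary[OF wt p]) (use True in \<open>auto intro!: G.umax_leaf_ge\<close>)
      then show ?thesis using 2(3)[OF p] True unfolding w2 by auto
    qed (use three(2) p in auto)
    have "strong_type G.\<mu> (cmax G.X G.d G.\<mu> \<kappa>) (ereal p)" if "ereal p \<in> Pcs"
    proof -
      have "strong_bound N1 m1 p" using 1(2)[OF p] that by simp
      then obtain C where "0 \<le> C" "\<And>n. even n \<Longrightarrow> ?s n \<le> C" unfolding s1 by blast
      then show ?thesis using chain_c[OF that] by (intro G.star_bounds_imp_strong(1)[OF p]) (auto simp: q4)
    qed
    moreover have "strong_type G.\<mu> (umax G.X G.d G.\<mu> \<kappa>) (ereal p)" if "ereal p \<in> Ps"
    proof -
      \<comment> \<open>The noncentred operator meets the even stars as well, so their bound is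
        required too; it is available because Ps \<subseteq> Pcs.\<close>
      have "ereal p \<in> Pcs" using that assms(6) by blast
      then have "strong_bound N1 m1 p" "strong_bound N2 m2 p" using 1(2)[OF p] 2(2)[OF p] that by simp_all
      from s12[OF this] obtain C where "0 \<le> C" "\<And>n. ?s n \<le> C" by blast
      then show ?thesis using chain_u[OF that] by (intro G.star_bounds_imp_strong(2)[OF p]) auto
    qed
    moreover have "weak_type G.\<mu> (cmax G.X G.d G.\<mu> \<kappa>) (ereal p)" if "ereal p \<in> Pcw"
    proof -
      have "weak_bound N1 m1 p" using 1(3)[OF p] that by simp
      then obtain C where "0 \<le> C" "\<And>n. even n \<Longrightarrow> ?w C n" unfolding w1 by blast
      then show ?thesis by (intro G.star_bounds_imp_weak(1)[OF p]) (auto simp: q4)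
    qed
    moreover have "weak_type G.\<mu> (umax G.X G.d G.\<mu> \<kappa>) (ereal p)" if "ereal p \<in> Pw"
    proof -
      have "ereal p \<in> Pcw" using that assms(7) by blast
      then have "weak_bound N1 m1 p" "weak_bound N2 m2 p" using 1(3)[OF p] 2(3)[OF p] that by simp_all
      from w12[OF this] obtain C where "0 \<le> C" "\<And>n. ?w C n" by blast
      then show ?thesis by (intro G.star_bounds_imp_weak(2)[OF p]) auto
    qed
    ultimately show ?thesis using cs us cw uw by blast
  qed
  have inf: "\<infinity> \<in> P" if "exp_set_form P" for P using that by (auto simp: exp_set_form_def)
  show ?thesis
  proof (intro exI[of _ E.X'] exI[of _ E.d'] exI[of _ E.image.\<mu>] conjI allI impI)
    show "mm_space E.X' E.d' E.image.\<mu>" by (rule E.image.mm_space_mu)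
    show "\<not> doubling E.X' E.d' E.image.\<mu>" unfolding E.doubling_image by (rule G.not_doubling)
    fix p :: ereal assume p: "1 \<le> p"
    have *: "(strong_type G.\<mu> (cmax G.X G.d G.\<mu> \<kappa>) p \<longleftrightarrow> p \<in> Pcs) \<and>
        (weak_type G.\<mu> (cmax G.X G.d G.\<mu> \<kappa>) p \<longleftrightarrow> p \<in> Pcw) \<and>
        (strong_type G.\<mu> (umax G.X G.d G.\<mu> \<kappa>) p \<longleftrightarrow> p \<in> Ps) \<and>
        (weak_type G.\<mu> (umax G.X G.d G.\<mu> \<kappa>) p \<longleftrightarrow> p \<in> Pw)"
    proof (cases p)
      case (real r)
      then show ?thesis using real_case[of r] p by simp
    next
      case PInf
      then show ?thesis using G.strong_type_infinity[OF assms(1)] inf assms(2-5) by auto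
    qed (use p in auto)
    show "strong_type E.image.\<mu> (cmax E.X' E.d' E.image.\<mu> \<kappa>) p \<longleftrightarrow> p \<in> Pcs"
      unfolding E.maximal_type_image using * by blast
    show "weak_type E.image.\<mu> (cmax E.X' E.d' E.image.\<mu> \<kappa>) p \<longleftrightarrow> p \<in> Pcw"
      unfolding E.maximal_type_image using * by blast
    show "strong_type E.image.\<mu> (umax E.X' E.d' E.image.\<mu> \<kappa>) p \<longleftrightarrow> p \<in> Ps"
      unfolding E.maximal_type_image using * by blast
    show "weak_type E.image.\<mu> (umax E.X' E.d' E.image.\<mu> \<kappa>) p \<longleftrightarrow> p \<in> Pw"
      unfolding E.maximal_type_image using * by blast
  qed
qed

end
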